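(* There exists an algorithm which, given samples from an unknown distribution $\mathbf p$ on $[n]$, an error parameter $\varepsilon\in(0,1]$, and a failure probability $\delta\in(0,1]$, outputs an integer $1\le K\le n$ such that the following holds. Let $1\le k\le n$ be the smallest integer such that $\mathbf p\in\mathcal H_k^n$. With probability at least $1-\delta$: (1) the algorithm takes $\widetilde O\big((\sqrt n/\varepsilon^2+k/\varepsilon^2+\sqrt{kn}/\varepsilon)\log(1/\delta)\big)$ samples; (2) $1\le K\le 2k$; (3) $\mathbf p$ is at total variation distance at most $\varepsilon$ from some $H\in\mathcal H_K^n$. Moreover, the algorithm runs in time $\operatorname{poly}(m)$, where $m$ is the number of samples taken.
   Context: $[n]=\{1,\dots,n\}$. For an integer $j$, $\mathcal H_j^n$ is the set of $j$-histograms on $[n]$: distributions $\mathbf p$ for which there exists a partition of $[n]$ into $j$ consecutive intervals with $\mathbf p$ constant on each interval. Total variation distance: $\mathrm{TV}(\mathbf p,\mathbf q)=\frac12\sum_i|\mathbf p(i)-\mathbf q(i)|$. $\widetilde O(\cdot)$ hides polylogarithmic factors in its argument.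
   Formalization: The factor log(1/δ) in the sample bound is read as max(1, ln(1/δ)); for δ very close to 1 the literal factor would allow no samples, and hence only constant time, while success probability 1−δ > 0 is still required, which is impossible. *)

theory Defs
  imports "HOL-Probability.Probability" "HOL-Probability.SPMF"
    "HOL-Library.Disjoint_Sets" "HOL-Computational_Algebra.Polynomial"
begin

section \<open>Histograms\<close>

text \<open>A distribution on \<open>[n]\<close> is a \<^typ>\<open>nat pmf\<close> supported in \<open>{1..n}\<close>. The blocks of
  \<^const>\<open>partition_on\<close> are nonempty, so \<open>histograms n j\<close> is empty unless \<open>1 \<le> j \<le> n\<close>
  (for \<open>n \<ge> 1\<close>).\<close>

definition histograms :: "nat \<Rightarrow> nat \<Rightarrow> nat pmf set" where
  "histograms n j = {p. set_pmf p \<subseteq> {1..n} \<and>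
     (\<exists>P. partition_on {1..n} P \<and> card P = j \<and>
          (\<forall>I\<in>P. (\<exists>a b. I = {a..b}) \<and> pmf p constant_on I))}"

definition min_bins :: "nat \<Rightarrow> nat pmf \<Rightarrow> nat" where
  "min_bins n p = (LEAST j. p \<in> histograms n j)"

definition tv_dist :: "nat \<Rightarrow> nat pmf \<Rightarrow> nat pmf \<Rightarrow> real" where
  "tv_dist n p q = (1/2) * (\<Sum>i\<in>{1..n}. \<bar>pmf p i - pmf q i\<bar>)"


section \<open>Algorithms with sample access\<close>

text \<open>
  Programs for a randomized real RAM. The memory consists of named unbounded arrays of natural
  numbers and of real numbers (a scalar is cell 0 of an array). As usual for this model,

  \<^item> natural numbers admit only addition and truncated subtraction at unit cost (there is no
    unit-cost integer multiplication or division);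
  \<^item> real numbers admit the field operations and comparison, but there is no conversion from
    reals to natural numbers (no floor), and no real constants other than those obtained from
    natural numbers by \<open>Of_Nat\<close>, so no information can be hidden in a constant.

  \<open>Draw a e\<close> stores a fresh independent sample of the unknown distribution in \<open>a[e]\<close>, and
  \<open>Flip a e\<close> a fresh fair random bit; these are the only sources of randomness.
\<close>

type_synonym vname = string

datatype nexp =
    Const nat
  | Nat_At vname nexp
  | NAdd nexp nexp
  | NSub nexp nexp

datatype rexp =
    Real_At vname nexp
  | Of_Nat nexp
  | RAdd rexp rexp
  | RSub rexp rexp
  | RMul rexp rexp
  | RDiv rexp rexp

datatype bexp =
    NLess nexp nexp
  | RLess rexp rexp
  | BNot bexp
  | BAnd bexp bexp

datatype com =
    Skip
  | NAssign vname nexp nexp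
  | RAssign vname nexp rexp
  | Draw vname nexp
  | Flip vname nexp
  | Seq com com
  | Cond bexp com com
  | Loop bexp com

text \<open>\<open>steps\<close> and \<open>draws\<close> only measure the run; no expression can read them.\<close>

record state =
  nmem :: "vname \<Rightarrow> nat \<Rightarrow> nat"
  rmem :: "vname \<Rightarrow> nat \<Rightarrow> real"
  steps :: nat
  draws :: nat

primrec nval :: "nexp \<Rightarrow> state \<Rightarrow> nat" where
  "nval (Const m) s = m"
| "nval (Nat_At a e) s = nmem s a (nval e s)"
| "nval (NAdd e f) s = nval e s + nval f s"
| "nval (NSub e f) s = nval e s - nval f s"

primrec rval :: "rexp \<Rightarrow> state \<Rightarrow> real" where
  "rval (Real_At a e) s = rmem s a (nval e s)"
| "rval (Of_Nat e) s = real (nval e s)"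
| "rval (RAdd e f) s = rval e s + rval f s"
| "rval (RSub e f) s = rval e s - rval f s"
| "rval (RMul e f) s = rval e s * rval f s"
| "rval (RDiv e f) s = rval e s / rval f s"

primrec bval :: "bexp \<Rightarrow> state \<Rightarrow> bool" where
  "bval (NLess e f) s \<longleftrightarrow> nval e s < nval f s"
| "bval (RLess e f) s \<longleftrightarrow> rval e s < rval f s"
| "bval (BNot b) s \<longleftrightarrow> \<not> bval b s"
| "bval (BAnd b b') s \<longleftrightarrow> bval b s \<and> bval b' s"

definition tick :: "state \<Rightarrow> state" where
  "tick s = s\<lparr>steps := Suc (steps s)\<rparr>"

definition put_nat :: "vname \<Rightarrow> nat \<Rightarrow> nat \<Rightarrow> state \<Rightarrow> state" where
  "put_nat a i v s = s\<lparr>nmem := (nmem s)(a := (nmem s a)(i := v))\<rparr>"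

definition put_real :: "vname \<Rightarrow> nat \<Rightarrow> real \<Rightarrow> state \<Rightarrow> state" where
  "put_real a i v s = s\<lparr>rmem := (rmem s)(a := (rmem s a)(i := v))\<rparr>"

definition count_draw :: "state \<Rightarrow> state" where
  "count_draw s = s\<lparr>draws := Suc (draws s)\<rparr>"

text \<open>Least fixed point in the order of subprobability distributions: the mass missing from
  the result is the probability that the loop does not terminate.\<close>

partial_function (spmf) loop_spmf :: "('s \<Rightarrow> bool) \<Rightarrow> ('s \<Rightarrow> 's) \<Rightarrow> ('s \<Rightarrow> 's spmf) \<Rightarrow> 's \<Rightarrow> 's spmf"
where
  "loop_spmf b g f s =
     (if b s then bind_spmf (f (g s)) (loop_spmf b g f) else return_spmf (g s))"

text \<open>Every elementary command and every evaluation of a test costs one step. Expressions are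
  part of the fixed program text, hence have constant size, so charging for each of their
  operations would change the running time by at most a constant factor.\<close>

primrec exec :: "nat pmf \<Rightarrow> com \<Rightarrow> state \<Rightarrow> state spmf" where
  "exec p Skip s = return_spmf (tick s)"
| "exec p (NAssign a e f) s = return_spmf (tick (put_nat a (nval e s) (nval f s) s))"
| "exec p (RAssign a e f) s = return_spmf (tick (put_real a (nval e s) (rval f s) s))"
| "exec p (Draw a e) s =
     map_spmf (\<lambda>x. tick (count_draw (put_nat a (nval e s) x s))) (spmf_of_pmf p)"
| "exec p (Flip a e) s =
     map_spmf (\<lambda>x. tick (put_nat a (nval e s) (of_bool x) s)) coin_spmf"
| "exec p (Seq c d) s = bind_spmf (exec p c s) (exec p d)"
| "exec p (Cond b c d) s = (if bval b s then exec p c (tick s) else exec p d (tick s))"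
| "exec p (Loop b c) s = loop_spmf (bval b) tick (exec p c) s"

definition init_state :: "nat \<Rightarrow> real \<Rightarrow> real \<Rightarrow> state" where
  "init_state n \<epsilon> \<delta> =
     \<lparr>nmem = (\<lambda>_ _. 0)(''n'' := (\<lambda>_. 0)(0 := n)),
      rmem = (\<lambda>_ _. 0)(''eps'' := (\<lambda>_. 0)(0 := \<epsilon>), ''delta'' := (\<lambda>_. 0)(0 := \<delta>)),
      steps = 0, draws = 0\<rparr>"

definition run :: "com \<Rightarrow> nat pmf \<Rightarrow> nat \<Rightarrow> real \<Rightarrow> real \<Rightarrow> state spmf" where
  "run A p n \<epsilon> \<delta> = exec p A (init_state n \<epsilon> \<delta>)"

definition out_bins :: "state \<Rightarrow> nat" where
  "out_bins s = nmem s ''K'' 0"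


section \<open>Sample complexity\<close>

text \<open>The factor \<open>log (1/\<delta>)\<close> is read as \<open>max 1 (ln (1/\<delta>))\<close>, the usual convention for
  asymptotic bounds. The two agree for \<open>\<delta> \<le> 1/e\<close>, and up to a constant factor for \<open>\<delta>\<close> bounded
  away from 1; for \<open>\<delta>\<close> close to 1 the plain logarithm tends to 0 and would leave no samples
  at all.\<close>

definition sample_rate :: "nat \<Rightarrow> nat \<Rightarrow> real \<Rightarrow> real \<Rightarrow> real" where
  "sample_rate n k \<epsilon> \<delta> =
     (sqrt (real n) / \<epsilon>\<^sup>2 + real k / \<epsilon>\<^sup>2 + sqrt (real k * real n) / \<epsilon>) * max 1 (ln (1 / \<delta>))"

text \<open>\<open>soft_bound C c x\<close> is a bound of the form \<open>C \<cdot> x \<cdot> polylog x\<close>. It is used with the rate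
  above, which is at least 3, so that \<open>ln x > 1\<close>.\<close>

definition soft_bound :: "real \<Rightarrow> nat \<Rightarrow> real \<Rightarrow> real" where
  "soft_bound C c x = C * x * ln x ^ c"

end

theory Submission
  imports Defs
begin

text \<open>
  For a guess \<open>b\<close> of the number of bins, let \<open>M\<close> be of order
  \<open>sqrt n / \<epsilon>\<^sup>2 + b / \<epsilon>\<^sup>2 + sqrt (b n) / \<epsilon>\<close> and \<open>R\<close> of order \<open>ln (n / \<delta>)\<close>. From \<open>M R\<close> samples
  one partitions \<open>[n]\<close> greedily from left to right, extending the current interval as long as no
  subinterval has a sample count inconsistent with uniformity on the interval. True pieces look
  flat, so a greedy interval never stops strictly inside the piece in which it started: on a
  \<open>k\<close>-histogram at most \<open>k\<close> intervals arise. Flattening the empirical distribution on them gives a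
  hypothesis \<open>h\<close>. On each common refinement of a greedy interval with a true piece, the
  contribution to \<open>\<Sum>i. (p i - h i)\<^sup>2 / (h i + 1 / n)\<close> is of order \<open>1 / M + n / M\<^sup>2\<close>, which is at most
  \<open>\<epsilon>\<^sup>2 / b\<close>: the weight \<open>1 / n\<close> makes counts of intervals (rather than collisions) sufficient, and is
  where the term \<open>sqrt (b n) / \<epsilon>\<close> comes from. Fresh samples then test whether this weighted
  chi-square distance is below \<open>\<epsilon>\<^sup>2\<close> or above \<open>2 \<epsilon>\<^sup>2\<close>; the bilinear statistic in two independent
  batches of size \<open>M\<close> has small enough variance as soon as \<open>M\<close> exceeds \<open>sqrt n / \<epsilon>\<^sup>2\<close>, and a majority
  vote over \<open>R\<close> repetitions amplifies the confidence. By Cauchy-Schwarz a chi-square distance of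
  at most \<open>2 \<epsilon>\<^sup>2\<close> bounds the total variation distance by \<open>\<epsilon>\<close>. The guess \<open>b\<close> is doubled until the
  test accepts a hypothesis with at most \<open>b\<close> intervals.
\<close>


section \<open>Reasoning about sample-free programs\<close>

text \<open>The factor 2 in \<open>K \<le> 2 k\<close> is the overshoot of doubling: on the good
  event a rejected guess satisfies \<open>b < k\<close>, so every guess that is tried, and with it
  the number of intervals accepted, stays below \<open>2 k\<close>. Since \<open>k\<close> is never
  known, the sample bound is claimed on this event only. Termination,
  \<open>1 \<le> K \<le> n\<close> and the running time hold surely, because the guess reaches
  \<open>n\<close> whatever the tests answer. The running time has to be polynomial in the number of
  samples, not in \<open>n\<close>. This is possible because a single batch already has at least
  \<open>sqrt n\<close> samples. Inside a level, randomness enters through one block of independent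
  samples, and the code around it is deterministic. Programs are therefore treated by a Hoare logic
  without probability, and a level becomes a deterministic function of an i.i.d. list. All
  probability is then confined to statements about such lists.\<close>

primrec nat_writes :: "com \<Rightarrow> vname set" where
  "nat_writes Skip = {}"
| "nat_writes (NAssign a e f) = {a}"
| "nat_writes (RAssign a e f) = {}"
| "nat_writes (Draw a e) = {a}"
| "nat_writes (Flip a e) = {a}"
| "nat_writes (Seq c d) = nat_writes c \<union> nat_writes d"
| "nat_writes (Cond b c d) = nat_writes c \<union> nat_writes d"
| "nat_writes (Loop b c) = nat_writes c"

primrec real_writes :: "com \<Rightarrow> vname set" where
  "real_writes Skip = {}"
| "real_writes (NAssign a e f) = {}"
| "real_writes (RAssign a e f) = {a}"
| "real_writes (Draw a e) = {}"
| "real_writes (Flip a e) = {}"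
| "real_writes (Seq c d) = real_writes c \<union> real_writes d"
| "real_writes (Cond b c d) = real_writes c \<union> real_writes d"
| "real_writes (Loop b c) = real_writes c"

text \<open>Frame condition at the granularity of whole arrays: what is known about arrays that a
  program never assigns survives it without appearing in any invariant.\<close>

definition agree :: "com \<Rightarrow> state \<Rightarrow> state \<Rightarrow> bool" where
  "agree c s t \<longleftrightarrow> (\<forall>v. v \<notin> nat_writes c \<longrightarrow> nmem t v = nmem s v) \<and>
     (\<forall>v. v \<notin> real_writes c \<longrightarrow> rmem t v = rmem s v)"

text \<open>Sample-free code is deterministic, so its result is a point mass, and a
  total-correctness triple with a time bound can be stated without probability.\<close>

definition runs :: "nat pmf \<Rightarrow> com \<Rightarrow> state \<Rightarrow> nat \<Rightarrow> (state \<Rightarrow> bool) \<Rightarrow> bool" where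
  "runs p c s B Q \<longleftrightarrow> (\<exists>t. exec p c s = return_spmf t \<and> Q t \<and> agree c s t \<and>
     steps t \<le> steps s + B \<and> draws t = draws s)"

lemma state_sel [simp]:
  "nmem (tick s) = nmem s" "rmem (tick s) = rmem s" "draws (tick s) = draws s"
  "steps (tick s) = Suc (steps s)"
  "nmem (put_nat a i x s) = (nmem s)(a := (nmem s a)(i := x))" "rmem (put_nat a i x s) = rmem s"
  "draws (put_nat a i x s) = draws s" "steps (put_nat a i x s) = steps s"
  "rmem (put_real a i y s) = (rmem s)(a := (rmem s a)(i := y))" "nmem (put_real a i y s) = nmem s"
  "draws (put_real a i y s) = draws s" "steps (put_real a i y s) = steps s"
  "nmem (count_draw s) = nmem s" "rmem (count_draw s) = rmem s"
  "draws (count_draw s) = Suc (draws s)" "steps (count_draw s) = steps s"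
  by (simp_all add: tick_def put_nat_def put_real_def count_draw_def)

lemma nval_tick [simp]: "nval e (tick s) = nval e s"
  by (induction e) simp_all

lemma rval_tick [simp]: "rval e (tick s) = rval e s"
  by (induction e) simp_all

lemma bval_tick [simp]: "bval b (tick s) = bval b s"
  by (induction b) simp_all

primrec straight :: "com \<Rightarrow> bool" where
  "straight Skip = True"
| "straight (NAssign a e f) = True"
| "straight (RAssign a e f) = True"
| "straight (Draw a e) = False"
| "straight (Flip a e) = False"
| "straight (Seq c d) = (straight c \<and> straight d)"
| "straight (Cond b c d) = (straight c \<and> straight d)"
| "straight (Loop b c) = False"

text \<open>The values on \<open>Draw\<close>, \<open>Flip\<close> and \<open>Loop\<close> are junk: \<open>effect\<close> and \<open>cost\<close> are only used for
  straight-line code.\<close>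

primrec effect :: "com \<Rightarrow> state \<Rightarrow> state" where
  "effect Skip s = tick s"
| "effect (NAssign a e f) s = tick (put_nat a (nval e s) (nval f s) s)"
| "effect (RAssign a e f) s = tick (put_real a (nval e s) (rval f s) s)"
| "effect (Draw a e) s = s"
| "effect (Flip a e) s = s"
| "effect (Seq c d) s = effect d (effect c s)"
| "effect (Cond b c d) s = (if bval b s then effect c (tick s) else effect d (tick s))"
| "effect (Loop b c) s = s"

primrec cost :: "com \<Rightarrow> nat" where
  "cost Skip = 1"
| "cost (NAssign a e f) = 1"
| "cost (RAssign a e f) = 1"
| "cost (Draw a e) = 1"
| "cost (Flip a e) = 1"
| "cost (Seq c d) = cost c + cost d"
| "cost (Cond b c d) = 1 + cost c + cost d"
| "cost (Loop b c) = 1"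

lemma runs_straight:
  assumes "straight c" "Q (effect c s)"
  shows "runs p c s (cost c) Q"
proof -
  have "straight c \<Longrightarrow> exec p c s = return_spmf (effect c s) \<and> agree c s (effect c s) \<and>
    steps (effect c s) \<le> steps s + cost c \<and> draws (effect c s) = draws s"
  proof (induction c arbitrary: s)
    case (Seq c d)
    from Seq.IH(1)[of s] Seq.IH(2)[of "effect c s"] Seq.prems
    show ?case by (auto simp: agree_def)
  next
    case (Cond b c d)
    from Cond.IH(1)[of "tick s"] Cond.IH(2)[of "tick s"] Cond.prems
    show ?case by (auto simp: agree_def)
  qed (auto simp: agree_def)
  thus ?thesis using assms by (auto simp: runs_def)
qed

lemma runs_weaken:
  assumes "runs p c s B Q" "B \<le> B'" "\<And>t. Q t \<Longrightarrow> agree c s t \<Longrightarrow> Q' t"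
  shows "runs p c s B' Q'"
  using assms by (fastforce simp: runs_def)

lemma runs_Seq:
  assumes "runs p c s B (\<lambda>t. runs p d t B' Q)"
  shows "runs p (Seq c d) s (B + B') Q"
  using assms by (fastforce simp: runs_def agree_def)

lemma runs_Seq':
  assumes "runs p c s B R" "\<And>t. R t \<Longrightarrow> agree c s t \<Longrightarrow> runs p d t B' Q"
  shows "runs p (Seq c d) s (B + B') Q"
  using assms by (intro runs_Seq) (blast intro: runs_weaken)

lemma runs_Seq_straight:
  assumes "straight c" "runs p d (effect c s) B' Q"
  shows "runs p (Seq c d) s (cost c + B') Q"
  using assms by (intro runs_Seq runs_straight)

text \<open>The invariant is indexed by the round, and the exact number \<open>J\<close> of rounds
  is given in advance; termination and the time bound then follow by induction downward from
  \<open>J\<close>. The body starts in \<open>tick t\<close> because the test costs a step.\<close>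

lemma runs_Loop:
  assumes "I 0 s"
    and body: "\<And>j t. j < J \<Longrightarrow> I j t \<Longrightarrow> agree c s t \<Longrightarrow>
       bval b t \<and> runs p c (tick t) B (I (Suc j))"
    and stop: "\<And>t. I J t \<Longrightarrow> agree c s t \<Longrightarrow> \<not> bval b t \<and> Q (tick t)"
  shows "runs p (Loop b c) s (J * (B + 1) + 1) Q"
proof -
  have "runs p (Loop b c) t ((J - j) * (B + 1) + 1) Q"
    if "j \<le> J" "I j t" "agree c s t" for j t
    using that
  proof (induction j arbitrary: t rule: inc_induct)
    case base
    thus ?case using stop[of t] by (auto simp: runs_def loop_spmf.simps agree_def)
  next
    case (step j)
    from body[OF step.hyps(2) step.prems] obtain u where
      u: "bval b t" "exec p c (tick t) = return_spmf u" "I (Suc j) u" "agree c (tick t) u"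
      "steps u \<le> steps t + B + 1" "draws u = draws t"
      by (auto simp: runs_def)
    have "agree c s u" using u(4) step.prems(2) by (auto simp: agree_def)
    from step.IH[OF u(3) this] have
      "runs p (Loop b c) u ((J - Suc j) * (B + 1) + 1) Q" .
    moreover have "exec p (Loop b c) t = exec p (Loop b c) u"
      using u(1,2) by (simp add: loop_spmf.simps[of _ _ _ t])
    moreover have "J - j = Suc (J - Suc j)" using step.hyps by simp
    ultimately show ?case using u(4,5,6) by (auto simp: runs_def agree_def)
  qed
  from this[of 0 s] assms(1) show ?thesis by (simp add: agree_def)
qed

definition For :: "vname \<Rightarrow> nexp \<Rightarrow> com \<Rightarrow> com" where
  "For v e c = Seq (NAssign v (Const 0) (Const 0)) (Loop (NLess (Nat_At v (Const 0)) e)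
     (Seq c (NAssign v (Const 0) (NAdd (Nat_At v (Const 0)) (Const 1)))))"

lemma writes_For [simp]:
  "nat_writes (For v e c) = insert v (nat_writes c)" "real_writes (For v e c) = real_writes c"
  by (auto simp: For_def)

text \<open>The bound \<open>e\<close> is evaluated anew before every round, so its value must
  follow from the frame. The invariant is asserted after the counter has moved, so that
  \<open>body\<close> speaks of \<open>c\<close> alone; \<open>mem\<close> asks that it ignore the
  step counter.\<close>

lemma runs_For:
  assumes init: "I 0 (put_nat v 0 0 s)"
    and v: "v \<notin> nat_writes c"
    and bound: "\<And>t. agree (For v e c) s t \<Longrightarrow> nval e t = N"
    and body: "\<And>j t. j < N \<Longrightarrow> I j t \<Longrightarrow> nmem t v 0 = j \<Longrightarrow> agree (For v e c) s t \<Longrightarrow>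
       runs p c t B (\<lambda>u. I (Suc j) (put_nat v 0 (Suc j) u))"
    and mem: "\<And>j t. I j t \<Longrightarrow> I j (tick t)"
    and post: "\<And>t. I N t \<Longrightarrow> agree (For v e c) s t \<Longrightarrow> Q t"
  shows "runs p (For v e c) s (N * (B + 2) + 2) Q"
proof -
  let ?s = "tick (put_nat v 0 0 s)"
  let ?c = "Seq c (NAssign v (Const 0) (NAdd (Nat_At v (Const 0)) (Const 1)))"
  have ag: "agree (For v e c) s t" if "agree ?c ?s t" for t
    using that by (auto simp: agree_def)
  have "runs p (Loop (NLess (Nat_At v (Const 0)) e) ?c) ?s (N * ((B + 1) + 1) + 1) Q"
  proof (rule runs_Loop[where I = "\<lambda>j t. I j t \<and> nmem t v 0 = j"])
    show "I 0 ?s \<and> nmem ?s v 0 = 0" using mem[OF init] by simp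
  next
    fix j t assume j: "j < N" and t: "I j t \<and> nmem t v 0 = j" and a: "agree ?c ?s t"
    have a': "agree (For v e c) s (tick t)" using ag[OF a] by (simp add: agree_def)
    have "bval (NLess (Nat_At v (Const 0)) e) t" using j t bound[OF ag[OF a]] by simp
    moreover have "runs p ?c (tick t) (B + 1) (\<lambda>t. I (Suc j) t \<and> nmem t v 0 = Suc j)"
    proof (rule runs_Seq'[OF body[of j "tick t"]])
      fix u assume u: "I (Suc j) (put_nat v 0 (Suc j) u)" "agree c (tick t) u"
      hence "nmem u v 0 = j" using v t by (simp add: agree_def)
      thus "runs p (NAssign v (Const 0) (NAdd (Nat_At v (Const 0)) (Const 1))) u 1
        (\<lambda>t. I (Suc j) t \<and> nmem t v 0 = Suc j)"
        using mem[OF u(1)] by (simp add: runs_def agree_def)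
    qed (use j t mem a' in auto)
    ultimately show "bval (NLess (Nat_At v (Const 0)) e) t \<and>
      runs p ?c (tick t) (B + 1) (\<lambda>t. I (Suc j) t \<and> nmem t v 0 = Suc j)" by blast
  next
    fix t assume t: "I N t \<and> nmem t v 0 = N" and a: "agree ?c ?s t"
    have "agree (For v e c) s (tick t)" using ag[OF a] by (simp add: agree_def)
    thus "\<not> bval (NLess (Nat_At v (Const 0)) e) t \<and> Q (tick t)"
      using t bound[OF ag[OF a]] post mem by auto
  qed
  thus ?thesis unfolding For_def runs_def by (auto simp: agree_def)
qed

section \<open>Step bounds \<open>k * W ^ d\<close> for loops of nesting depth \<open>d\<close> with
  at most \<open>W\<close> rounds each\<close>

lemma runs_straight_pow:
  assumes "straight c" "cost c \<le> k" "1 \<le> W" "Q (effect c s)"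
  shows "runs p c s (k * W ^ d) Q"
proof -
  have "cost c * 1 \<le> k * W ^ d" using assms by (intro mult_mono) auto
  thus ?thesis using assms by (intro runs_weaken[OF runs_straight]) auto
qed

lemma runs_Seq_straight_pow:
  assumes "straight c" "runs p d (effect c s) (k * W ^ m) Q" "cost c + k \<le> k'" "1 \<le> W"
  shows "runs p (Seq c d) s (k' * W ^ m) Q"
proof -
  have "cost c * 1 + k * W ^ m \<le> cost c * W ^ m + k * W ^ m"
    using assms(4) by (intro add_mono mult_mono) auto
  also have "\<dots> \<le> k' * W ^ m"
    using assms(3) by (metis add_mult_distrib mult_le_mono1)
  finally show ?thesis using assms by (intro runs_weaken[OF runs_Seq_straight]) auto
qed

lemma runs_Seq_pow:
  assumes "runs p c s (ka * W ^ ma) R" "\<And>t. R t \<Longrightarrow> agree c s t \<Longrightarrow> runs p d t (kb * W ^ mb) Q"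
    and "ka + kb \<le> k'" "ma \<le> m" "mb \<le> m" "1 \<le> W"
  shows "runs p (Seq c d) s (k' * W ^ m) Q"
proof -
  have "ka * W ^ ma + kb * W ^ mb \<le> ka * W ^ m + kb * W ^ m"
    using assms(4-6) by (intro add_mono mult_mono power_increasing) auto
  also have "\<dots> \<le> k' * W ^ m"
    using assms(3) by (metis add_mult_distrib mult_le_mono1)
  finally show ?thesis using runs_weaken[OF runs_Seq'[OF assms(1,2)]] by blast
qed

text \<open>The 4 pays for the increment and the test in each round (2), and for the initial
  assignment and the last test (2).\<close>

lemma runs_For_pow:
  assumes "I 0 (put_nat v 0 0 s)" "v \<notin> nat_writes c"
    and "\<And>t. agree (For v e c) s t \<Longrightarrow> nval e t = N"
    and "\<And>j t. j < N \<Longrightarrow> I j t \<Longrightarrow> nmem t v 0 = j \<Longrightarrow> agree (For v e c) s t \<Longrightarrow>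
       runs p c t (k * W ^ d) (\<lambda>u. I (Suc j) (put_nat v 0 (Suc j) u))"
    and "\<And>j t. I j t \<Longrightarrow> I j (tick t)"
    and "\<And>t. I N t \<Longrightarrow> agree (For v e c) s t \<Longrightarrow> Q t"
    and "N \<le> W" "1 \<le> W" "k + 4 \<le> k'" "m = Suc d"
  shows "runs p (For v e c) s (k' * W ^ m) Q"
proof -
  have "N * (k * W ^ d + 2) + 2 \<le> W * (k * W ^ d + 2 * W ^ d) + 2 * W ^ m"
    using assms(7,8) by (intro add_mono mult_mono) auto
  also have "\<dots> = (k + 4) * W ^ m" by (simp add: assms(10) algebra_simps)
  also have "\<dots> \<le> k' * W ^ m" using assms(9) mult_le_mono1 by blast
  finally show ?thesis
    using runs_weaken[OF runs_For[of I v s c e N p "k * W ^ d" Q, OF assms(1-6)]] by blast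
qed

text \<open>For loops in the first half of a \<open>Seq\<close>, where no postcondition is given in
  advance: the invariant serves as one.\<close>

lemma runs_For_inv:
  assumes "I 0 (put_nat v 0 0 s)" "v \<notin> nat_writes c"
    and "\<And>t. agree (For v e c) s t \<Longrightarrow> nval e t = N"
    and "\<And>j t. j < N \<Longrightarrow> I j t \<Longrightarrow> nmem t v 0 = j \<Longrightarrow> agree (For v e c) s t \<Longrightarrow>
       runs p c t (k * W ^ d) (\<lambda>u. I (Suc j) (put_nat v 0 (Suc j) u))"
    and "\<And>j t. I j t \<Longrightarrow> I j (tick t)"
    and "N \<le> W" "1 \<le> W" "k + 4 \<le> k'" "m = Suc d"
  shows "runs p (For v e c) s (k' * W ^ m) (I N)"
  by (rule runs_For_pow[where I = I and N = N, OF assms(1-5) _ assms(6-9)])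

abbreviation "NV v \<equiv> Nat_At v (Const 0)"
abbreviation "RV v \<equiv> Real_At v (Const 0)"
abbreviation "NSet v \<equiv> NAssign v (Const 0)"
abbreviation "RSet v \<equiv> RAssign v (Const 0)"
abbreviation "NEq e f \<equiv> BAnd (BNot (NLess e f)) (BNot (NLess f e))"

section \<open>The test run at one level\<close>

definition hits :: "nat list \<Rightarrow> nat \<Rightarrow> nat \<Rightarrow> nat" where
  "hits xs a b = length (filter (\<lambda>x. a \<le> x \<and> x \<le> b) xs)"

text \<open>For a true distribution that is flat on \<open>{a..b}\<close> with expected count \<open>\<nu>\<close> on \<open>{c..d}\<close>, typical counts satisfy
  \<open>(hits - y)\<^sup>2 \<le> 16 R (\<nu> + R)\<close> and \<open>\<nu> \<le> 2 y + 5 R\<close>; this is the origin of the constant 96.\<close>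

definition cell_ok :: "nat \<Rightarrow> nat list \<Rightarrow> nat \<Rightarrow> nat \<Rightarrow> nat \<Rightarrow> nat \<Rightarrow> bool" where
  "cell_ok R xs a b c d \<longleftrightarrow> (let y = real (hits xs a b) * real (d + 1 - c) / real (b + 1 - a)
     in (real (hits xs c d) - y)\<^sup>2 \<le> 96 * real R * (y + real R))"

definition looks_flat :: "nat \<Rightarrow> nat list \<Rightarrow> nat \<Rightarrow> nat \<Rightarrow> bool" where
  "looks_flat R xs a b \<longleftrightarrow> (\<forall>c d. a \<le> c \<and> c \<le> d \<and> d \<le> b \<longrightarrow> cell_ok R xs a b c d)"

text \<open>\<open>lead ok i\<close> is the left end of the greedy interval containing \<open>i\<close>; 0 means that no interval has
  been opened yet.\<close>

primrec lead :: "(nat \<Rightarrow> nat \<Rightarrow> bool) \<Rightarrow> nat \<Rightarrow> nat" where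
  "lead ok 0 = 0"
| "lead ok (Suc i) = (if 0 < lead ok i \<and> ok (lead ok i) (Suc i) then lead ok i else Suc i)"

definition leaders :: "(nat \<Rightarrow> nat \<Rightarrow> bool) \<Rightarrow> nat \<Rightarrow> nat set" where
  "leaders ok n = {i \<in> {1..n}. lead ok i = i}"

definition bin :: "(nat \<Rightarrow> nat \<Rightarrow> bool) \<Rightarrow> nat \<Rightarrow> nat \<Rightarrow> nat set" where
  "bin ok n i = {j \<in> {1..n}. lead ok j = lead ok i}"

definition hyp :: "(nat \<Rightarrow> nat \<Rightarrow> bool) \<Rightarrow> nat \<Rightarrow> nat list \<Rightarrow> nat \<Rightarrow> real" where
  "hyp ok n xs i = real (\<Sum>j\<in>bin ok n i. hits xs j j) / (real (length xs) * real (card (bin ok n i)))"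

text \<open>The two factors come from independent batches, so the expectation is exactly
  \<open>M\<^sup>2 * chisq n p h\<close>; squaring the deviation within one batch would add a
  variance term.\<close>

definition zstat :: "nat \<Rightarrow> nat \<Rightarrow> (nat \<Rightarrow> real) \<Rightarrow> nat list \<Rightarrow> nat list \<Rightarrow> real" where
  "zstat n M h us vs = (\<Sum>i\<in>{1..n}. (real (hits us i i) - real M * h i) *
      (real (hits vs i i) - real M * h i) / (h i + 1 / real n))"

definition votes :: "(nat list \<Rightarrow> nat list \<Rightarrow> bool) \<Rightarrow> nat \<Rightarrow> nat \<Rightarrow> nat list \<Rightarrow> nat" where
  "votes T M R xs = (\<Sum>r<R. of_bool (T (take M (drop (r * (M + M)) xs)) (take M (drop (r * (M + M) + M) xs))))"

text \<open>The constant 2048 serves two purposes: \<open>2 b\<close> cells contribute at most \<open>2 b \<cdot> 464 (1 / M + n / M\<^sup>2) \<le> \<epsilon>\<^sup>2\<close>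
  to the chi-square distance, and Chebyshev's inequality at a quarter of the larger of that distance and \<open>\<epsilon>\<^sup>2\<close>
  yields failure probability \<open>16 \<cdot> 8 / 2048 = 1 / 16\<close>.\<close>

definition big_enough :: "nat \<Rightarrow> nat \<Rightarrow> real \<Rightarrow> nat \<Rightarrow> bool" where
  "big_enough n b \<epsilon> M \<longleftrightarrow> 2048 * real b \<le> real M * \<epsilon>\<^sup>2 \<and> 2048 * real n * real b \<le> (real M * \<epsilon>)\<^sup>2 \<and>
     2048\<^sup>2 * real n \<le> (real M * \<epsilon>\<^sup>2)\<^sup>2"

text \<open>A power of two because the program searches by doubling; this loses at most a factor
  2.\<close>

definition batch :: "nat \<Rightarrow> nat \<Rightarrow> real \<Rightarrow> nat" where
  "batch n b \<epsilon> = 2 ^ (LEAST j. big_enough n b \<epsilon> (2 ^ j))"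

text \<open>At one level each of at most \<open>n\<^sup>2\<close> interval counts is atypical with
  probability at most \<open>2 / 2 ^ R\<close>, and the vote is wrong with probability at most
  \<open>1 / 2 ^ R\<close>. The total is at most \<open>4 * n\<^sup>2 / 2 ^ R\<close>, which this
  choice makes at most \<open>\<delta> / n\<close>.\<close>

definition reps :: "nat \<Rightarrow> real \<Rightarrow> nat" where
  "reps n \<delta> = (LEAST j. 4 * real n ^ 3 / \<delta> \<le> 2 ^ j)"

text \<open>The threshold is halfway between the values for chi-square distance
  \<open>\<epsilon>\<^sup>2\<close> and \<open>2 * \<epsilon>\<^sup>2\<close>.\<close>

definition zsmall :: "nat \<Rightarrow> nat \<Rightarrow> real \<Rightarrow> (nat \<Rightarrow> real) \<Rightarrow> nat list \<Rightarrow> nat list \<Rightarrow> bool" where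
  "zsmall n M \<epsilon> h us vs \<longleftrightarrow> 2 * zstat n M h us vs \<le> 3 * (real M * \<epsilon>)\<^sup>2"

lemma reps_ex: "\<exists>j. 4 * real n ^ 3 / \<delta> \<le> 2 ^ j"
  using real_arch_pow[of 2 "4 * real n ^ 3 / \<delta>"] by (auto intro: less_imp_le)

lemma batch_ex:
  assumes "0 < \<epsilon>" "\<epsilon> \<le> 1" "1 \<le> n" "1 \<le> b"
  shows "\<exists>j. big_enough n b \<epsilon> (2 ^ j)"
proof -
  \<comment> \<open>With \<open>x = 2 ^ j * \<epsilon>\<^sup>2\<close>, the left sides of all three
    conditions are at most \<open>T \<le> x\<close>, and the right sides are at least
    \<open>x\<close>, because \<open>1 \<le> x\<close> and
    \<open>x \<le> 2 ^ j * \<epsilon>\<close>.\<close>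
  obtain j where j: "2048\<^sup>2 * real n * real b / \<epsilon>\<^sup>2 < 2 ^ j" using real_arch_pow[of 2] by auto
  define T where "T = 2048\<^sup>2 * real n * real b"
  define x where "x = 2 ^ j * \<epsilon>\<^sup>2"
  have nb: "1 \<le> real n" "1 \<le> real b" "real n * 1 \<le> real n * real b" "1 * real b \<le> real n * real b"
    using assms by (auto intro!: mult_mono)
  have T: "T \<le> x" using j assms by (simp add: T_def x_def field_simps)
  have "1 * 1 \<le> real n * real b" using nb by (intro mult_mono) auto
  moreover have "T = 4194304 * (real n * real b)" "2048 * real n * real b = 2048 * (real n * real b)"
    "2048\<^sup>2 * real n = 4194304 * real n" by (simp_all add: T_def)
  ultimately have T1: "1 \<le> T" "2048 * real b \<le> T" "2048 * real n * real b \<le> T" "2048\<^sup>2 * real n \<le> T"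
    using nb by linarith+
  have x1: "x \<le> x\<^sup>2" using T T1(1) by (simp add: power2_eq_square)
  have "x \<le> 2 ^ j * \<epsilon>" using assms by (simp add: x_def power2_eq_square mult_le_one)
  hence "x\<^sup>2 \<le> (2 ^ j * \<epsilon>)\<^sup>2" using T T1(1) by (intro power_mono) auto
  thus ?thesis using T T1 x1 unfolding big_enough_def
    by (intro exI[of _ j]) (auto simp flip: x_def)
qed

lemma batch_big_enough:
  assumes "0 < \<epsilon>" "\<epsilon> \<le> 1" "1 \<le> n" "1 \<le> b"
  shows "big_enough n b \<epsilon> (batch n b \<epsilon>)"
  unfolding batch_def using LeastI_ex[OF batch_ex[OF assms]] by simp

section \<open>The program\<close>

text \<open>Memory layout: \<open>x\<close> holds the samples of the current level, \<open>F[i]\<close> the number of first-stage samples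
  that are at most \<open>i\<close>, \<open>st[i]\<close> the left end of the greedy interval of \<open>i\<close>, \<open>h\<close> the hypothesis and \<open>b\<close> the
  guess. Since an accepting level sets \<open>b\<close> to \<open>n\<close>, the search needs no separate exit flag, and since \<open>K\<close>
  starts as \<open>n\<close>, an exhausted search falls back to the trivial partition.\<close>

definition "reps_com = Seq (NSet ''R'' (Const 0)) (Seq (RSet ''r'' (Of_Nat (Const 1)))
  (Loop (RLess (RV ''r'') (RDiv (RMul (Of_Nat (Const 4)) (RMul (Of_Nat (NV ''n''))
      (RMul (Of_Nat (NV ''n'')) (Of_Nat (NV ''n''))))) (RV ''delta'')))
    (Seq (RSet ''r'' (RAdd (RV ''r'') (RV ''r''))) (NSet ''R'' (NAdd (NV ''R'') (Const 1))))))"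

definition "batch_com = (let
    n = Of_Nat (NV ''n''); b = Of_Nat (NV ''b''); w = Of_Nat (Const 2048); e = RV ''eps'';
    me = RMul (Of_Nat (NV ''M'')) e; mee = RMul me e in
  Seq (NSet ''M'' (Const 1)) (Loop (BNot (BAnd (BNot (RLess mee (RMul w b)))
      (BAnd (BNot (RLess (RMul me me) (RMul (RMul w n) b)))
            (BNot (RLess (RMul mee mee) (RMul (RMul w w) n))))))
    (NSet ''M'' (NAdd (NV ''M'') (NV ''M'')))))"

text \<open>Repeated addition replaces the multiplication that naturals do not have.\<close>

definition "alloc_com = Seq (NSet ''N'' (Const 0))
  (For ''j'' (NV ''R'') (NSet ''N'' (NAdd (NV ''N'') (NV ''M''))))"

definition "draw_com = For ''j'' (NAdd (NV ''N'') (NAdd (NV ''N'') (NV ''N''))) (Draw ''x'' (NV ''j''))"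

text \<open>Cell 0 is included so that \<open>F d - F (c - 1)\<close> counts \<open>{c..d}\<close>
  also for \<open>c = 1\<close>.\<close>

definition "count_com = For ''i'' (NAdd (NV ''n'') (Const 1)) (Seq (NAssign ''F'' (NV ''i'') (Const 0))
  (For ''j'' (NV ''N'') (Cond (NLess (Nat_At ''x'' (NV ''j'')) (NAdd (NV ''i'') (Const 1)))
    (NAssign ''F'' (NV ''i'') (NAdd (Nat_At ''F'' (NV ''i'')) (Const 1))) Skip)))"

text \<open>The loops scan all pairs up to \<open>n\<close> and guard against those outside
  \<open>{a..e}\<close>, so that the number of rounds does not depend on \<open>a\<close> and
  \<open>e\<close>.\<close>

definition "flat_com = (let
    a = NV ''a''; e = NV ''e''; c = NV ''c''; d = NV ''d''; r = Of_Nat (NV ''R'');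
    F = Nat_At ''F''; H = (\<lambda>u v. Of_Nat (NSub (F v) (F (NSub u (Const 1)))));
    L = (\<lambda>u v. Of_Nat (NSub (NAdd v (Const 1)) u));
    y = RDiv (RMul (H a e) (L c d)) (L a e); D = RSub (H c d) y in
  Seq (NSet ''bad'' (Const 0)) (For ''c'' (NAdd (NV ''n'') (Const 1)) (For ''d'' (NAdd (NV ''n'') (Const 1))
    (Cond (BAnd (BNot (NLess c a)) (BAnd (BNot (NLess d c)) (BAnd (BNot (NLess e d))
        (RLess (RMul (RMul (Of_Nat (Const 96)) r) (RAdd y r)) (RMul D D)))))
      (NSet ''bad'' (Const 1)) Skip))))"

definition "lead_com = Seq (Seq (NSet ''a'' (Const 0)) (NSet ''k'' (Const 0)))
  (For ''i'' (NV ''n'') (Seq (NSet ''e'' (NAdd (NV ''i'') (Const 1))) (Seq flat_com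
    (Seq (Cond (BAnd (NLess (Const 0) (NV ''a'')) (NLess (NV ''bad'') (Const 1))) Skip
        (Seq (NSet ''a'' (NV ''e'')) (NSet ''k'' (NAdd (NV ''k'') (Const 1)))))
      (NAssign ''st'' (NV ''e'') (NV ''a''))))))"

definition "hyp_com = (let i = NAdd (NV ''i'') (Const 1); j = NAdd (NV ''j'') (Const 1) in
  For ''i'' (NV ''n'') (Seq (Seq (NSet ''l'' (Const 0)) (NSet ''m'' (Const 0)))
    (Seq (For ''j'' (NV ''n'') (Cond (NEq (Nat_At ''st'' j) (Nat_At ''st'' i))
        (Seq (NSet ''l'' (NAdd (NV ''l'') (Const 1)))
             (NSet ''m'' (NAdd (NV ''m'') (NSub (Nat_At ''F'' j) (Nat_At ''F'' (NV ''j''))))))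
        Skip))
      (RAssign ''h'' i (RDiv (Of_Nat (NV ''m'')) (RMul (Of_Nat (NV ''N'')) (Of_Nat (NV ''l'')))))))) "

definition "zstat_com = (let i = NAdd (NV ''i'') (Const 1);
    h = Real_At ''h'' i; mh = RMul (Of_Nat (NV ''M'')) h in
  Seq (RSet ''z'' (Of_Nat (Const 0))) (For ''i'' (NV ''n'')
   (Seq (Seq (NSet ''u'' (Const 0)) (NSet ''v'' (Const 0)))
   (Seq (For ''j'' (NV ''M'') (Seq
        (Cond (NEq (Nat_At ''x'' (NAdd (NV ''pos'') (NV ''j''))) i) (NSet ''u'' (NAdd (NV ''u'') (Const 1))) Skip)
        (Cond (NEq (Nat_At ''x'' (NAdd (NAdd (NV ''pos'') (NV ''M'')) (NV ''j''))) i)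
           (NSet ''v'' (NAdd (NV ''v'') (Const 1))) Skip)))
     (RSet ''z'' (RAdd (RV ''z'') (RDiv (RMul (RSub (Of_Nat (NV ''u'')) mh) (RSub (Of_Nat (NV ''v'')) mh))
        (RAdd h (RDiv (Of_Nat (Const 1)) (Of_Nat (NV ''n''))))))))))) "

definition "vote_com = (let me = RMul (Of_Nat (NV ''M'')) (RV ''eps'') in
  Seq (Seq (NSet ''g'' (Const 0)) (NSet ''pos'' (NV ''N'')))
  (For ''q'' (NV ''R'') (Seq zstat_com
    (Seq (NSet ''pos'' (NAdd (NV ''pos'') (NAdd (NV ''M'') (NV ''M''))))
      (Cond (RLess (RMul (Of_Nat (Const 3)) (RMul me me)) (RMul (Of_Nat (Const 2)) (RV ''z''))) Skip
         (NSet ''g'' (NAdd (NV ''g'') (Const 1))))))))"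

definition "decide_com = Cond (BAnd (NLess (NV ''R'') (NAdd (NV ''g'') (NV ''g'')))
     (BNot (NLess (NV ''b'') (NV ''k''))))
   (Seq (NSet ''K'' (NV ''k'')) (NSet ''b'' (NV ''n'')))
   (NSet ''b'' (NAdd (NV ''b'') (NV ''b'')))"

definition "plan_com = Seq reps_com (Seq batch_com alloc_com)"
definition "test_com = Seq count_com (Seq lead_com (Seq hyp_com (Seq vote_com decide_com)))"
definition "level_com = Seq plan_com (Seq draw_com test_com)"
definition "search_com = Loop (NLess (NV ''b'') (NV ''n'')) level_com"
definition "histogram_com = Seq (Seq (NSet ''K'' (NV ''n'')) (NSet ''b'' (Const 1))) search_com"

section \<open>Correctness and running time of the program\<close>

text \<open>The loop makes exactly \<open>reps n \<delta>\<close> rounds: before that, minimality of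
  the \<open>LEAST\<close> keeps the test true; then its defining property makes the test false. The
  argument for \<open>batch_com\<close> is the same.\<close>

lemma runs_reps_com:
  assumes s: "nmem s ''n'' 0 = n" "rmem s ''delta'' 0 = \<delta>" and W: "reps n \<delta> \<le> W" "1 \<le> W"
  shows "runs p reps_com s (8 * W ^ 1) (\<lambda>t. nmem t ''R'' 0 = reps n \<delta>)"
proof -
  let ?J = "reps n \<delta>"
  let ?b = "RLess (RV ''r'') (RDiv (RMul (Of_Nat (Const 4)) (RMul (Of_Nat (NV ''n''))
      (RMul (Of_Nat (NV ''n'')) (Of_Nat (NV ''n''))))) (RV ''delta''))"
  let ?c = "Seq (RSet ''r'' (RAdd (RV ''r'') (RV ''r''))) (NSet ''R'' (NAdd (NV ''R'') (Const 1)))"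
  have *: "runs p (Loop ?b ?c) (effect (RSet ''r'' (Of_Nat (Const 1))) (effect (NSet ''R'' (Const 0)) s))
     (?J * (2 + 1) + 1) (\<lambda>t. nmem t ''R'' 0 = ?J)"
  proof (rule runs_Loop[where I = "\<lambda>j t. nmem t ''R'' 0 = j \<and> rmem t ''r'' 0 = 2 ^ j"])
    fix j t assume j: "j < ?J" "nmem t ''R'' 0 = j \<and> rmem t ''r'' 0 = 2 ^ j"
      and "agree ?c (effect (RSet ''r'' (Of_Nat (Const 1))) (effect (NSet ''R'' (Const 0)) s)) t"
    hence "nmem t ''n'' 0 = n" "rmem t ''delta'' 0 = \<delta>" using s by (auto simp: agree_def)
    moreover from j(1) have "\<not> 4 * real n ^ 3 / \<delta> \<le> 2 ^ j" unfolding reps_def by (rule not_less_Least)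
    ultimately have "bval ?b t" using j by (simp add: power3_eq_cube)
    moreover have "runs p ?c (tick t) 2 (\<lambda>t. nmem t ''R'' 0 = Suc j \<and> rmem t ''r'' 0 = 2 ^ Suc j)"
      using j by (intro runs_weaken[OF runs_straight]) auto
    ultimately show "bval ?b t \<and> runs p ?c (tick t) 2 (\<lambda>t. nmem t ''R'' 0 = Suc j \<and> rmem t ''r'' 0 = 2 ^ Suc j)"
      by blast
  next
    fix t assume j: "nmem t ''R'' 0 = ?J \<and> rmem t ''r'' 0 = 2 ^ ?J"
      and "agree ?c (effect (RSet ''r'' (Of_Nat (Const 1))) (effect (NSet ''R'' (Const 0)) s)) t"
    hence "nmem t ''n'' 0 = n" "rmem t ''delta'' 0 = \<delta>" using s by (auto simp: agree_def)
    moreover have "4 * real n ^ 3 / \<delta> \<le> 2 ^ ?J" unfolding reps_def by (rule LeastI_ex[OF reps_ex])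
    ultimately show "\<not> bval ?b t \<and> nmem (tick t) ''R'' 0 = ?J" using j by (simp add: power3_eq_cube)
  qed auto
  show ?thesis unfolding reps_com_def
    by (rule runs_weaken[OF runs_Seq_straight[OF _ runs_Seq_straight[OF _ *]]]) (use W in auto)
qed

lemma runs_batch_com:
  assumes s: "nmem s ''n'' 0 = n" "nmem s ''b'' 0 = b" "rmem s ''eps'' 0 = \<epsilon>"
    and W: "batch n b \<epsilon> \<le> W" "1 \<le> W" and pos: "0 < \<epsilon>" "\<epsilon> \<le> 1" "1 \<le> n" "1 \<le> b"
  shows "runs p batch_com s (4 * W ^ 1) (\<lambda>t. nmem t ''M'' 0 = batch n b \<epsilon>)"
proof -
  define J where "J = (LEAST j. big_enough n b \<epsilon> (2 ^ j))"
  have M: "batch n b \<epsilon> = 2 ^ J" by (simp add: J_def batch_def)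
  \<comment> \<open>The number of doublings is smaller than the value they reach.\<close>
  have JW: "J < W" using less_le_trans[OF less_exp[of J]] W(1) M by auto
  have t: "nmem t ''n'' 0 = n" "nmem t ''b'' 0 = b" "rmem t ''eps'' 0 = \<epsilon>"
    if "agree (NSet ''M'' (NAdd (NV ''M'') (NV ''M''))) (effect (NSet ''M'' (Const 1)) s) t" for t
    using that s by (auto simp: agree_def)
  show ?thesis unfolding batch_com_def Let_def
  proof (rule runs_weaken[OF runs_Seq_straight[OF _ runs_Loop[where J = J and B = 1 and
       I = "\<lambda>j t. nmem t ''M'' 0 = 2 ^ j" and Q = "\<lambda>t. nmem t ''M'' 0 = 2 ^ J"]]], goal_cases)
    case (3 j t)
    have "\<not> big_enough n b \<epsilon> (2 ^ j)" using 3(1) unfolding J_def by (rule not_less_Least)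
    moreover have "runs p (NSet ''M'' (NAdd (NV ''M'') (NV ''M''))) (tick t) 1 (\<lambda>t. nmem t ''M'' 0 = 2 ^ Suc j)"
      using 3 by (intro runs_weaken[OF runs_straight]) auto
    ultimately show ?case using 3 t[OF 3(3)]
      by (auto simp: big_enough_def power2_eq_square algebra_simps)
  next
    case (4 t)
    have "big_enough n b \<epsilon> (2 ^ J)" unfolding J_def by (rule LeastI_ex[OF batch_ex[OF pos]])
    thus ?case using 4 t[OF 4(2)]
      by (auto simp: big_enough_def power2_eq_square algebra_simps)
  next
    case 5
    show ?case using JW by simp
  next
    case (6 t)
    thus ?case using M by simp
  qed auto
qed

lemma runs_alloc_com:
  assumes s: "nmem s ''R'' 0 = R" "nmem s ''M'' 0 = M" and W: "R \<le> W" "1 \<le> W"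
  shows "runs p alloc_com s (6 * W ^ 1) (\<lambda>t. nmem t ''N'' 0 = M * R)"
  unfolding alloc_com_def
proof (rule runs_Seq_straight_pow[where k = 5, OF _ runs_For_pow[where
      I = "\<lambda>j t. nmem t ''N'' 0 = M * j" and N = R and k = 1 and d = 0]], goal_cases)
  case (5 j t)
  thus ?case using s W by (intro runs_straight_pow) (auto simp: agree_def)
qed (use s W in \<open>auto simp: agree_def\<close>)

lemma runs_plan_com:
  assumes s: "nmem s ''n'' 0 = n" "nmem s ''b'' 0 = b" "rmem s ''eps'' 0 = \<epsilon>" "rmem s ''delta'' 0 = \<delta>"
    and W: "batch n b \<epsilon> \<le> W" "reps n \<delta> \<le> W" "1 \<le> W" and pos: "0 < \<epsilon>" "\<epsilon> \<le> 1" "1 \<le> n" "1 \<le> b"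
  shows "runs p plan_com s (18 * W ^ 1) (\<lambda>t. nmem t ''R'' 0 = reps n \<delta> \<and>
     nmem t ''M'' 0 = batch n b \<epsilon> \<and> nmem t ''N'' 0 = batch n b \<epsilon> * reps n \<delta>)"
proof -
  have 2: "runs p alloc_com u (6 * W ^ 1) (\<lambda>t. nmem t ''R'' 0 = reps n \<delta> \<and>
     nmem t ''M'' 0 = batch n b \<epsilon> \<and> nmem t ''N'' 0 = batch n b \<epsilon> * reps n \<delta>)"
    if "nmem u ''R'' 0 = reps n \<delta>" "nmem u ''M'' 0 = batch n b \<epsilon>" for u
    by (rule runs_weaken[OF runs_alloc_com[OF that W(2,3)]])
       (use that W in \<open>auto simp: agree_def alloc_com_def\<close>)
  have 1: "runs p (Seq batch_com alloc_com) u (10 * W ^ 1) (\<lambda>t. nmem t ''R'' 0 = reps n \<delta> \<and>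
     nmem t ''M'' 0 = batch n b \<epsilon> \<and> nmem t ''N'' 0 = batch n b \<epsilon> * reps n \<delta>)"
    if "nmem u ''R'' 0 = reps n \<delta>" "agree reps_com s u" for u
    by (rule runs_Seq_pow[OF runs_batch_com[OF _ _ _ W(1,3) pos] 2])
       (use that s W in \<open>auto simp: agree_def reps_com_def batch_com_def Let_def\<close>)
  show ?thesis unfolding plan_com_def
    by (rule runs_Seq_pow[OF runs_reps_com[OF s(1,4) W(2,3)] 1]) (use W in auto)
qed

lemma hits_take_Suc:
  "j < length xs \<Longrightarrow> hits (take (Suc j) xs) a b = hits (take j xs) a b + of_bool (a \<le> xs ! j \<and> xs ! j \<le> b)"
  by (simp add: hits_def take_Suc_conv_app_nth)

lemma hits_0 [simp]: "hits [] a b = 0"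
  by (simp add: hits_def)

lemma hits_diff:
  assumes "1 \<le> c" "c \<le> d"
  shows "hits xs 0 d - hits xs 0 (c - 1) = hits xs c d" "hits xs 0 (c - 1) \<le> hits xs 0 d"
proof -
  have "hits xs 0 d = hits xs 0 (c - 1) + hits xs c d"
    unfolding hits_def using assms by (induction xs) auto
  thus "hits xs 0 d - hits xs 0 (c - 1) = hits xs c d" "hits xs 0 (c - 1) \<le> hits xs 0 d" by auto
qed

lemma runs_count_com:
  assumes s: "nmem s ''n'' 0 = n" "nmem s ''N'' 0 = length ys" "\<And>j. j < length ys \<Longrightarrow> nmem s ''x'' j = ys ! j"
    and W: "n + 1 \<le> W" "length ys \<le> W"
  shows "runs p count_com s (12 * W ^ 2) (\<lambda>t. \<forall>i\<le>n. nmem t ''F'' i = hits ys 0 i)"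
  unfolding count_com_def
proof (rule runs_For_pow[where I = "\<lambda>j t. \<forall>i<j. nmem t ''F'' i = hits ys 0 i" and N = "n + 1" and k = 8 and d = 1], goal_cases)
  case (4 i t)
  show ?case
  proof (rule runs_Seq_straight_pow[where k = 7, OF _ runs_For_pow[where N = "length ys" and k = 3 and d = 0 and
       I = "\<lambda>j u. (\<forall>k<i. nmem u ''F'' k = hits ys 0 k) \<and> nmem u ''F'' i = hits (take j ys) 0 i"]], goal_cases)
    case (5 j u)
    have "nmem u ''x'' j = ys ! j" "nmem u ''i'' 0 = i" using 4 5 s by (auto simp: agree_def)
    thus ?case using 5 W
      by (intro runs_straight_pow) (auto simp: hits_take_Suc)
  next
    case (7 u)
    thus ?case using less_Suc_eq by auto
  qed (use 4 s W in \<open>auto simp: agree_def\<close>)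
qed (use s W in \<open>auto simp: agree_def\<close>)

lemma runs_flat_com:
  assumes s: "nmem s ''n'' 0 = n" "nmem s ''R'' 0 = R" "nmem s ''a'' 0 = a" "nmem s ''e'' 0 = e"
      "\<And>i. i \<le> n \<Longrightarrow> nmem s ''F'' i = hits ys 0 i"
    and a: "1 \<le> a" "a \<le> e" "e \<le> n" and W: "n + 1 \<le> W"
  shows "runs p flat_com s (20 * W ^ 2) (\<lambda>t. nmem t ''bad'' 0 = 0 \<longleftrightarrow> looks_flat R ys a e)"
proof -
  define G where "G c d \<longleftrightarrow> (a \<le> c \<and> c \<le> d \<and> d \<le> e \<longrightarrow> cell_ok R ys a e c d)" for c d
  show ?thesis
    unfolding flat_com_def Let_def
  proof (rule runs_Seq_straight_pow[where k = 19, OF _ runs_For_pow[where N = "n + 1" and k = 15 and d = 1 and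
        I = "\<lambda>c t. nmem t ''bad'' 0 = 0 \<longleftrightarrow> (\<forall>c'<c. \<forall>d\<le>n. G c' d)"]], goal_cases)
    case (5 c t)
    show ?case
    proof (rule runs_For_pow[where N = "n + 1" and k = 11 and d = 0 and
        I = "\<lambda>d t. nmem t ''bad'' 0 = 0 \<longleftrightarrow> (\<forall>c'<c. \<forall>d\<le>n. G c' d) \<and> (\<forall>d'<d. G c d')"], goal_cases)
      case (4 d u)
      have u: "nmem u ''c'' 0 = c" "nmem u ''d'' 0 = d" "nmem u ''a'' 0 = a" "nmem u ''e'' 0 = e"
        "nmem u ''R'' 0 = R" "nmem u ''n'' 0 = n" and F: "\<And>i. i \<le> n \<Longrightarrow> nmem u ''F'' i = hits ys 0 i"
        using 4 5 s by (auto simp: agree_def)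
      have X: "real (nmem u ''F'' e' - nmem u ''F'' (c' - Suc 0)) = real (hits ys c' e')"
        if "1 \<le> c'" "c' \<le> e'" "e' \<le> n" for c' e'
        using that hits_diff[of c' e' ys] by (simp add: F)
      have G: "G c d \<longleftrightarrow> \<not> (\<not> c < a \<and> \<not> d < c \<and> \<not> e < d \<and>
         96 * real R * (real (hits ys a e) * real (Suc d - c) / real (Suc e - a) + real R)
         < (real (hits ys c d) - real (hits ys a e) * real (Suc d - c) / real (Suc e - a)) *
           (real (hits ys c d) - real (hits ys a e) * real (Suc d - c) / real (Suc e - a)))"
        by (auto simp: G_def cell_ok_def Let_def power2_eq_square)
      show ?case
      proof (cases "a \<le> c \<and> c \<le> d \<and> d \<le> e")
        case True
        hence "real (nmem u ''F'' d - nmem u ''F'' (c - Suc 0)) = real (hits ys c d)"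
          "real (nmem u ''F'' e - nmem u ''F'' (a - Suc 0)) = real (hits ys a e)"
          using X[of c d] X[of a e] a by auto
        thus ?thesis using 4(2) u W True
          by (intro runs_straight_pow) (auto simp: less_Suc_eq G simp del: of_nat_diff)
      next
        case False
        thus ?thesis using 4(2) u W by (intro runs_straight_pow) (auto simp: less_Suc_eq G)
      qed
    next
      case (6 u)
      have "(\<forall>d<n + 1. G c d) \<longleftrightarrow> (\<forall>d\<le>n. G c d)" by (metis Suc_eq_plus1 less_Suc_eq_le)
      moreover have "(\<forall>c'<Suc c. \<forall>d\<le>n. G c' d) \<longleftrightarrow> (\<forall>c'<c. \<forall>d\<le>n. G c' d) \<and> (\<forall>d\<le>n. G c d)"
        by (auto simp only: All_less_Suc)
      ultimately show ?case using 6(1) by simp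
    qed (use 5 s(1) W in \<open>simp_all add: agree_def\<close>)
  next
    case (7 t)
    have "looks_flat R ys a e \<longleftrightarrow> (\<forall>c<n + 1. \<forall>d\<le>n. G c d)"
    proof (intro iffI allI impI)
      fix c d assume "looks_flat R ys a e" "c < n + 1" "d \<le> n"
      thus "G c d" by (simp add: looks_flat_def G_def)
    next
      assume G: "\<forall>c<n + 1. \<forall>d\<le>n. G c d"
      have "cell_ok R ys a e c d" if "a \<le> c \<and> c \<le> d \<and> d \<le> e" for c d
      proof -
        have "c < n + 1" "d \<le> n" using that a by auto
        with G have "G c d" by blast
        thus ?thesis using that by (simp add: G_def)
      qed
      thus "looks_flat R ys a e" by (simp add: looks_flat_def)
    qed
    thus ?case using 7(1) by simp
  qed (use s(1) W in \<open>simp_all add: agree_def\<close>)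
qed

text \<open>At the first element no interval is open, \<open>a\<close> is 0 and the verdict in
  \<open>bad\<close> is ignored; only termination and time matter then.\<close>

lemma runs_flat_com_total:
  assumes s: "nmem s ''n'' 0 = n" and W: "n + 1 \<le> W"
  shows "runs p flat_com s (20 * W ^ 2) (\<lambda>t. True)"
  unfolding flat_com_def Let_def
proof (rule runs_Seq_straight_pow[where k = 19, OF _ runs_For_pow[where N = "n + 1" and k = 15 and d = 1 and
      I = "\<lambda>c t. True"]], goal_cases)
  case (5 c t)
  show ?case
  proof (rule runs_For_pow[where N = "n + 1" and k = 11 and d = 0 and I = "\<lambda>d t. True"], goal_cases)
    case (4 d u)
    show ?case using W by (intro runs_straight_pow) auto
  qed (use 5 s W in \<open>auto simp: agree_def\<close>)
qed (use s W in \<open>auto simp: agree_def\<close>)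

lemma lead_le: "lead ok i \<le> i"
  by (induction i) auto

lemma lead_pos: "1 \<le> i \<Longrightarrow> 1 \<le> lead ok i"
  by (cases i) auto

lemma finite_leaders [simp]: "finite (leaders ok n)"
  by (simp add: leaders_def)

lemma leaders_0 [simp]: "leaders ok 0 = {}"
  by (simp add: leaders_def)

lemma leaders_Suc:
  "leaders ok (Suc n) = (if lead ok (Suc n) = Suc n then insert (Suc n) (leaders ok n) else leaders ok n)"
  by (auto simp: leaders_def le_Suc_eq simp del: lead.simps)

lemma card_leaders_Suc:
  "card (leaders ok (Suc n)) = card (leaders ok n) + of_bool (lead ok (Suc n) = Suc n)"
  using leaders_Suc[of ok n] by (auto simp: leaders_def simp del: lead.simps)

lemma runs_lead_com:
  assumes s: "nmem s ''n'' 0 = n" "nmem s ''R'' 0 = R" "\<And>i. i \<le> n \<Longrightarrow> nmem s ''F'' i = hits ys 0 i"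
    and W: "n + 1 \<le> W"
  defines "ok \<equiv> looks_flat R ys"
  shows "runs p lead_com s (40 * W ^ 3) (\<lambda>t. nmem t ''k'' 0 = card (leaders ok n) \<and>
     (\<forall>i. 1 \<le> i \<and> i \<le> n \<longrightarrow> nmem t ''st'' i = lead ok i))"
  unfolding lead_com_def
proof (rule runs_Seq_straight_pow[where k = 36, OF _ runs_For_pow[where N = n and k = 30 and d = 2 and
      I = "\<lambda>j t. nmem t ''a'' 0 = lead ok j \<and> nmem t ''k'' 0 = card (leaders ok j) \<and>
         (\<forall>i. 1 \<le> i \<and> i \<le> j \<longrightarrow> nmem t ''st'' i = lead ok i)"]], goal_cases)
  case (5 j t)
  let ?t = "effect (NSet ''e'' (NAdd (NV ''i'') (Const 1))) t"
  have wr: "nat_writes flat_com = {''bad'', ''c'', ''d''}" by (auto simp: flat_com_def Let_def)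
  have e: "nmem ?t ''n'' 0 = n" "nmem ?t ''R'' 0 = R" "nmem ?t ''a'' 0 = lead ok j"
    "nmem ?t ''e'' 0 = Suc j" "\<And>i. i \<le> n \<Longrightarrow> nmem ?t ''F'' i = hits ys 0 i"
    using 5 s by (auto simp: agree_def wr)
  have 1: "runs p flat_com ?t (20 * W ^ 2) (\<lambda>t. 0 < lead ok j \<longrightarrow> (nmem t ''bad'' 0 = 0 \<longleftrightarrow> ok (lead ok j) (Suc j)))"
  proof (cases "0 < lead ok j")
    case True
    show ?thesis
      by (rule runs_weaken[OF runs_flat_com[OF e _ _ _ W]])
         (use True 5(1) lead_le[of ok j] in \<open>auto simp: ok_def\<close>)
  next
    case False
    show ?thesis by (rule runs_weaken[OF runs_flat_com_total[OF e(1) W]]) (use False in auto)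
  qed
  show ?case
  proof (rule runs_Seq_straight_pow[where k = 29, OF _ runs_Seq_pow[OF 1, where kb = 9 and mb = 0]], goal_cases)
    case (2 u)
    have u: "nmem u ''a'' 0 = lead ok j" "nmem u ''e'' 0 = Suc j" "nmem u ''k'' 0 = card (leaders ok j)"
      "\<And>i. 1 \<le> i \<and> i \<le> j \<Longrightarrow> nmem u ''st'' i = lead ok i"
      using 2 5 by (auto simp: agree_def wr)
    have l: "lead ok j \<le> j" by (rule lead_le)
    show ?case
      by (rule runs_straight_pow)
         (use u l 2(1) W in \<open>auto simp: card_leaders_Suc le_Suc_eq\<close>)
  qed (use W in auto)
qed (use s W in \<open>auto simp: agree_def flat_com_def Let_def\<close>)

lemma runs_hyp_com:
  assumes s: "nmem s ''n'' 0 = n" "nmem s ''N'' 0 = length ys" "\<And>i. i \<le> n \<Longrightarrow> nmem s ''F'' i = hits ys 0 i"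
      "\<And>i. 1 \<le> i \<Longrightarrow> i \<le> n \<Longrightarrow> nmem s ''st'' i = lead ok i"
    and W: "n + 1 \<le> W"
  shows "runs p hyp_com s (20 * W ^ 2) (\<lambda>t. \<forall>i. 1 \<le> i \<and> i \<le> n \<longrightarrow> rmem t ''h'' i = hyp ok n ys i)"
  unfolding hyp_com_def Let_def
proof (rule runs_For_pow[where N = n and k = 15 and d = 1 and
      I = "\<lambda>j t. \<forall>i. 1 \<le> i \<and> i \<le> j \<longrightarrow> rmem t ''h'' i = hyp ok n ys i"], goal_cases)
  case (4 i t)
  define B where "B j = {j' \<in> {1..j}. lead ok j' = lead ok (Suc i)}" for j
  have B: "B 0 = {}" "finite (B j)" "B (Suc j) = (if lead ok (Suc j) = lead ok (Suc i) then insert (Suc j) (B j) else B j)"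
    "Suc j \<notin> B j" for j
    by (auto simp: B_def le_Suc_eq simp del: lead.simps)
  show ?case
  proof (rule runs_Seq_straight_pow[where k = 12, OF _ runs_Seq_pow[where ka = 9 and ma = 1 and kb = 1 and mb = 0, OF
      runs_For_inv[where N = n and k = 5 and d = 0 and
       I = "\<lambda>j u. (\<forall>i'. 1 \<le> i' \<and> i' \<le> i \<longrightarrow> rmem u ''h'' i' = hyp ok n ys i') \<and> nmem u ''l'' 0 = card (B j) \<and>
          nmem u ''m'' 0 = (\<Sum>j'\<in>B j. hits ys j' j')"]]], goal_cases)
    case (5 j u)
    have "nmem u ''F'' (Suc j) = hits ys 0 (Suc j)" "nmem u ''F'' j = hits ys 0 j"
      "nmem u ''st'' (Suc j) = lead ok (Suc j)" "nmem u ''st'' (Suc i) = lead ok (Suc i)"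
      "nmem u ''i'' 0 = i"
      using 5(1,4) 4 s(3)[of "Suc j"] s(3)[of j] s(4)[of "Suc j"] s(4)[of "Suc i"] by (auto simp: agree_def simp del: lead.simps)
    moreover have "hits ys 0 (Suc j) - hits ys 0 j = hits ys (Suc j) (Suc j)"
      using hits_diff[of "Suc j" "Suc j" ys] by simp
    ultimately show ?case using 5 W
      by (intro runs_straight_pow) (auto simp: B simp del: lead.simps)
  next
    case (11 u)
    have "nmem u ''N'' 0 = length ys" "nmem u ''i'' 0 = i"
      using 11(2) 4 s by (auto simp: agree_def)
    moreover have "B n = bin ok n (Suc i)" by (simp add: B_def bin_def del: lead.simps)
    ultimately show ?case
      using 11(1) W by (intro runs_straight_pow) (auto simp: hyp_def le_Suc_eq simp del: lead.simps)
  qed (use 4 s W in \<open>auto simp: agree_def B\<close>)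
qed (use s W in \<open>auto simp: agree_def\<close>)

lemma runs_zstat_com:
  assumes s: "nmem s ''n'' 0 = n" "nmem s ''M'' 0 = M" "nmem s ''pos'' 0 = k"
      "\<And>i. 1 \<le> i \<Longrightarrow> i \<le> n \<Longrightarrow> rmem s ''h'' i = h i"
      "\<And>j. j < length xs \<Longrightarrow> nmem s ''x'' j = xs ! j"
    and k: "k + (M + M) \<le> length xs" and W: "n + 1 \<le> W" "M \<le> W"
  shows "runs p zstat_com s (20 * W ^ 2) (\<lambda>t. rmem t ''z'' 0 = zstat n M h (take M (drop k xs)) (take M (drop (k + M) xs)))"
proof -
  define us where "us = take M (drop k xs)"
  define vs where "vs = take M (drop (k + M) xs)"
  have us: "length us = M" "\<And>j. j < M \<Longrightarrow> us ! j = xs ! (k + j)"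
    and vs: "length vs = M" "\<And>j. j < M \<Longrightarrow> vs ! j = xs ! (k + M + j)"
    using k by (auto simp: us_def vs_def)
  let ?f = "\<lambda>i. (real (hits us i i) - real M * h i) * (real (hits vs i i) - real M * h i) / (h i + 1 / real n)"
  have "runs p zstat_com s (20 * W ^ 2) (\<lambda>t. rmem t ''z'' 0 = zstat n M h us vs)"
    unfolding zstat_com_def Let_def
  proof (rule runs_Seq_straight_pow[where k = 19, OF _ runs_For_pow[where N = n and k = 15 and d = 1 and
      I = "\<lambda>j t. rmem t ''z'' 0 = (\<Sum>i<j. ?f (Suc i))"]], goal_cases)
    case (5 i t)
    note it = this
    show ?case
    proof (rule runs_Seq_straight_pow[where k = 13, OF _ runs_Seq_pow[where ka = 10 and ma = 1 and kb = 1 and mb = 0, OF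
        runs_For_inv[where N = M and k = 6 and d = 0 and
         I = "\<lambda>j u. rmem u ''z'' 0 = (\<Sum>i<i. ?f (Suc i)) \<and> nmem u ''u'' 0 = hits (take j us) (Suc i) (Suc i) \<and>
            nmem u ''v'' 0 = hits (take j vs) (Suc i) (Suc i)"]]], goal_cases)
      case (5 j u)
      have "nmem u ''x'' (k + j) = us ! j" "nmem u ''x'' (k + M + j) = vs ! j"
        "nmem u ''i'' 0 = i" "nmem u ''pos'' 0 = k" "nmem u ''M'' 0 = M"
        using 5(1,4) it(3,4) s k us(2)[of j] vs(2)[of j] by (auto simp: agree_def)
      thus ?case using 5(1-3) W us(1) vs(1)
        by (intro runs_straight_pow) (auto simp: hits_take_Suc)
    next
      case (11 u)
      have "nmem u ''n'' 0 = n" "nmem u ''M'' 0 = M" "nmem u ''i'' 0 = i" "rmem u ''h'' (Suc i) = h (Suc i)"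
        using 11(2) it s(1,2) s(4)[of "Suc i"] by (auto simp: agree_def)
      thus ?case
        using 11(1) W us(1) vs(1) by (intro runs_straight_pow) auto
    qed (use 5 s W in \<open>auto simp: agree_def\<close>)
  next
    case (7 t)
    have "zstat n M h us vs = (\<Sum>i<n. ?f (Suc i))"
      unfolding zstat_def One_nat_def by (rule sum.atLeast1_atMost_eq)
    thus ?case using 7 by simp
  qed (use s W in \<open>auto simp: agree_def\<close>)
  thus ?thesis by (simp add: us_def vs_def)
qed

lemma runs_vote_com:
  assumes s: "nmem s ''n'' 0 = n" "nmem s ''M'' 0 = M" "nmem s ''R'' 0 = R" "nmem s ''N'' 0 = M * R" "rmem s ''eps'' 0 = \<epsilon>"
      "\<And>i. 1 \<le> i \<Longrightarrow> i \<le> n \<Longrightarrow> rmem s ''h'' i = h i"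
      "\<And>j. j < length xs \<Longrightarrow> nmem s ''x'' j = xs ! j"
    and len: "length xs = 3 * (M * R)" and W: "n + 1 \<le> W" "M \<le> W" "R \<le> W"
  shows "runs p vote_com s (40 * W ^ 3) (\<lambda>t. nmem t ''g'' 0 = votes (zsmall n M \<epsilon> h) M R (drop (M * R) xs))"
  unfolding vote_com_def Let_def
proof (rule runs_Seq_straight_pow[where k = 38, OF _ runs_For_pow[where N = R and k = 25 and d = 2 and
      I = "\<lambda>r t. nmem t ''pos'' 0 = M * R + r * (M + M) \<and> nmem t ''g'' 0 = votes (zsmall n M \<epsilon> h) M r (drop (M * R) xs)"]], goal_cases)
  case (5 r t)
  have wr: "nat_writes zstat_com = {''i'', ''u'', ''v'', ''j''}" "real_writes zstat_com = {''z''}"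
    by (auto simp: zstat_com_def Let_def)
  let ?k = "M * R + r * (M + M)"
  have t: "nmem t ''n'' 0 = n" "nmem t ''M'' 0 = M" "nmem t ''pos'' 0 = ?k" "rmem t ''eps'' 0 = \<epsilon>"
    "\<And>i. 1 \<le> i \<Longrightarrow> i \<le> n \<Longrightarrow> rmem t ''h'' i = h i" "\<And>j. j < length xs \<Longrightarrow> nmem t ''x'' j = xs ! j"
    using 5 s by (auto simp: agree_def wr)
  have "Suc r * (M + M) \<le> R * (M + M)" using 5(1) by (intro mult_right_mono) auto
  hence "?k + (M + M) \<le> length xs" using len by (simp add: algebra_simps)
  hence z: "runs p zstat_com t (20 * W ^ 2) (\<lambda>u. rmem u ''z'' 0 =
      zstat n M h (take M (drop ?k xs)) (take M (drop (?k + M) xs)))"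
    using t W by (intro runs_zstat_com)
  show ?case
  proof (rule runs_Seq_pow[OF z, where kb = 5 and mb = 0], goal_cases)
    case (1 u)
    have "nmem u ''M'' 0 = M" "nmem u ''pos'' 0 = ?k" "rmem u ''eps'' 0 = \<epsilon>"
      "nmem u ''g'' 0 = votes (zsmall n M \<epsilon> h) M r (drop (M * R) xs)"
      using 1(2) t 5(2) by (auto simp: agree_def wr)
    thus ?case using 1(1) W
      by (intro runs_straight_pow) (auto simp: votes_def zsmall_def power2_eq_square algebra_simps)
  qed (use W in auto)
qed (use s W in \<open>auto simp: agree_def zstat_com_def Let_def votes_def\<close>)

text \<open>The first third of the samples determines partition and hypothesis, the other two thirds
  feed the vote; only fresh samples ever test the hypothesis.\<close>

definition accepts :: "nat \<Rightarrow> nat \<Rightarrow> nat \<Rightarrow> nat \<Rightarrow> real \<Rightarrow> nat list \<Rightarrow> bool" where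
  "accepts n b M R \<epsilon> xs \<longleftrightarrow> (let ys = take (M * R) xs; ok = looks_flat R ys in
     card (leaders ok n) \<le> b \<and>
     R < 2 * votes (zsmall n M \<epsilon> (hyp ok n ys)) M R (drop (M * R) xs))"

lemma runs_test_com:
  assumes s: "nmem s ''n'' 0 = n" "nmem s ''M'' 0 = M" "nmem s ''R'' 0 = R" "nmem s ''N'' 0 = M * R" "rmem s ''eps'' 0 = \<epsilon>"
      "nmem s ''b'' 0 = b" "nmem s ''K'' 0 = K"
      "\<And>j. j < length xs \<Longrightarrow> nmem s ''x'' j = xs ! j"
    and len: "length xs = 3 * (M * R)" and W: "n + 1 \<le> W" "M \<le> W" "R \<le> W" "M * R \<le> W"
  shows "runs p test_com s (200 * W ^ 3) (\<lambda>t.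
     if accepts n b M R \<epsilon> xs then nmem t ''b'' 0 = n \<and> nmem t ''K'' 0 = card (leaders (looks_flat R (take (M * R) xs)) n)
     else nmem t ''b'' 0 = b + b \<and> nmem t ''K'' 0 = K)"
proof -
  define ys where "ys = take (M * R) xs"
  define ok where "ok = looks_flat R ys"
  have ys: "length ys = M * R" "\<And>j. j < length ys \<Longrightarrow> ys ! j = xs ! j" using len by (auto simp: ys_def)
  have wr: "nat_writes count_com = {''i'', ''F'', ''j''}" "real_writes count_com = {}"
    "nat_writes lead_com = {''a'', ''k'', ''i'', ''e'', ''bad'', ''c'', ''d'', ''st''}" "real_writes lead_com = {}"
    "nat_writes hyp_com = {''i'', ''l'', ''m'', ''j''}" "real_writes hyp_com = {''h''}"
    "nat_writes vote_com = {''g'', ''pos'', ''q'', ''i'', ''u'', ''v'', ''j''}" "real_writes vote_com = {''z''}"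
    by (auto simp: count_com_def lead_com_def hyp_com_def vote_com_def flat_com_def zstat_com_def Let_def)
  show ?thesis unfolding test_com_def
  proof (rule runs_Seq_pow[where kb = 110 and mb = 3, OF runs_count_com[where ys = ys and W = W, OF s(1)]], goal_cases)
    case (5 t1)
    note t1 = this
    show ?case
    proof (rule runs_Seq_pow[where kb = 70 and mb = 3, OF runs_lead_com[where ys = ys and n = n and R = R and W = W]], goal_cases)
      case (5 t2)
      note t2 = this
      show ?case
      proof (rule runs_Seq_pow[where kb = 50 and mb = 3, OF runs_hyp_com[where ys = ys and n = n and W = W and ok = ok]], goal_cases)
        case (6 t3)
        show ?case
        proof (rule runs_Seq_pow[where kb = 10 and mb = 0, OF runs_vote_com[where M = M and R = R and xs = xs and n = n and W = W and \<epsilon> = \<epsilon> and h = "hyp ok n ys"]], goal_cases)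
          case (12 t4)
          have "nmem t4 ''b'' 0 = b" "nmem t4 ''K'' 0 = K" "nmem t4 ''R'' 0 = R" "nmem t4 ''n'' 0 = n"
            "nmem t4 ''k'' 0 = card (leaders ok n)"
            using s t1(2) t2 6(2) 12(2) by (auto simp: agree_def wr ok_def)
          thus ?case using 12(1) W unfolding decide_com_def
            by (intro runs_straight_pow) (auto simp: accepts_def Let_def ys_def[symmetric] ok_def[symmetric])
        qed (use s t1 t2 6 W len in \<open>auto simp: agree_def wr ok_def\<close>)
      qed (use s t1 t2 W ys in \<open>auto simp: agree_def wr ok_def\<close>)
    qed (use s t1 W in \<open>auto simp: agree_def wr\<close>)
  qed (use s W ys len in \<open>auto simp: agree_def wr\<close>)
qed

text \<open>What the drawing loop does to the memory once the samples are known, with the same ticks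
  as the loop itself.\<close>

primrec fill :: "state \<Rightarrow> nat list \<Rightarrow> state" where
  "fill s [] = tick s"
| "fill s (x # xs) = fill (tick (put_nat ''j'' 0 (Suc (nmem s ''j'' 0))
     (tick (count_draw (put_nat ''x'' (nmem s ''j'' 0) x (tick s)))))) xs"

lemma fill_simps:
  "steps (fill s xs) = steps s + 3 * length xs + 1"
  "draws (fill s xs) = draws s + length xs"
  "rmem (fill s xs) = rmem s"
  "v \<noteq> ''x'' \<Longrightarrow> v \<noteq> ''j'' \<Longrightarrow> nmem (fill s xs) v = nmem s v"
  by (induction xs arbitrary: s) auto

lemma fill_x:
  "nmem (fill s xs) ''x'' i = (if nmem s ''j'' 0 \<le> i \<and> i < nmem s ''j'' 0 + length xs
     then xs ! (i - nmem s ''j'' 0) else nmem s ''x'' i)"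
  by (induction xs arbitrary: s) (auto simp: nth_Cons' less_Suc_eq Suc_diff_le)

text \<open>The loop test never looks at the samples, so all draws can be moved to the front as one
  i.i.d. list. Each sample costs three steps (test, draw, increment); the 2 in
  \<open>9 * N + 2\<close> is for the initial assignment and the last test.\<close>

lemma exec_draw_com:
  assumes N: "nmem s ''N'' 0 = N"
  shows "\<exists>f. exec p draw_com s = bind_pmf (replicate_pmf (3 * N) p) (\<lambda>xs. return_spmf (f xs)) \<and>
    (\<forall>xs. length xs = 3 * N \<longrightarrow> (\<forall>j<3 * N. nmem (f xs) ''x'' j = xs ! j) \<and> agree draw_com s (f xs) \<and>
       steps (f xs) \<le> steps s + 9 * N + 2 \<and> draws (f xs) = draws s + 3 * N)"
proof -
  let ?b = "NLess (NV ''j'') (NAdd (NV ''N'') (NAdd (NV ''N'') (NV ''N'')))"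
  let ?c = "Seq (Draw ''x'' (NV ''j'')) (NSet ''j'' (NAdd (NV ''j'') (Const 1)))"
  have exec_Loop: "exec p (Loop ?b ?c) = loop_spmf (bval ?b) tick (exec p ?c)"
    by (rule ext) simp
  have loop: "exec p (Loop ?b ?c) t = bind_pmf (replicate_pmf m p) (\<lambda>xs. return_spmf (fill t xs))"
    if "nmem t ''j'' 0 + m = 3 * N" "nmem t ''N'' 0 = N" for t m
    using that
  proof (induction m arbitrary: t)
    case 0
    thus ?case by (simp add: loop_spmf.simps[of _ _ _ t] bind_return_pmf)
  next
    case (Suc m)
    have b: "bval ?b t" using Suc.prems by simp
    have "exec p (Loop ?b ?c) t = bind_spmf (exec p ?c (tick t)) (exec p (Loop ?b ?c))"
      using b exec_Loop by (simp add: loop_spmf.simps[of _ _ _ t])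
    also have "exec p ?c (tick t) = bind_pmf p (\<lambda>x. return_spmf (tick (put_nat ''j'' 0 (Suc (nmem t ''j'' 0))
      (tick (count_draw (put_nat ''x'' (nmem t ''j'' 0) x (tick t)))))))" (is "_ = bind_pmf p (\<lambda>x. return_spmf (?g x))")
      by (simp add: bind_spmf_of_pmf map_pmf_def bind_assoc_pmf bind_return_pmf del: bind_spmf_of_pmf)
         (simp add: bind_map_pmf map_spmf_of_pmf spmf_of_pmf_def map_pmf_def bind_spmf_def bind_assoc_pmf bind_return_pmf)
    also have "bind_spmf (bind_pmf p (\<lambda>x. return_spmf (?g x))) (exec p (Loop ?b ?c)) =
       bind_pmf p (\<lambda>x. exec p (Loop ?b ?c) (?g x))"
      by (simp add: bind_spmf_def bind_assoc_pmf bind_return_pmf)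
    also have "\<dots> = bind_pmf p (\<lambda>x. bind_pmf (replicate_pmf m p) (\<lambda>xs. return_spmf (fill (?g x) xs)))"
      using Suc.prems by (intro bind_pmf_cong refl Suc.IH) auto
    also have "\<dots> = bind_pmf (replicate_pmf (Suc m) p) (\<lambda>xs. return_spmf (fill t xs))"
      by (simp add: bind_assoc_pmf bind_return_pmf)
    finally show ?case .
  qed
  define t where "t = tick (put_nat ''j'' 0 0 s)"
  have "exec p draw_com s = exec p (Loop ?b ?c) t"
    by (simp add: draw_com_def For_def t_def)
  also have "\<dots> = bind_pmf (replicate_pmf (3 * N) p) (\<lambda>xs. return_spmf (fill t xs))"
    by (rule loop) (use N in \<open>auto simp: t_def\<close>)
  finally show ?thesis
    by (intro exI[of _ "fill t"]) (auto simp: fill_simps fill_x t_def agree_def draw_com_def)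
qed

lemma reps_pos:
  assumes "1 \<le> n" "0 < \<delta>" "\<delta> \<le> 1"
  shows "1 \<le> reps n \<delta>" "4 * real n ^ 3 / \<delta> \<le> 2 ^ reps n \<delta>"
proof -
  show *: "4 * real n ^ 3 / \<delta> \<le> 2 ^ reps n \<delta>" unfolding reps_def by (rule LeastI_ex[OF reps_ex])
  have "1 \<le> real n ^ 3" using assms by simp
  hence "\<delta> < 4 * real n ^ 3" using assms(3) by linarith
  hence "1 < 4 * real n ^ 3 / \<delta>" using assms by (simp add: field_simps)
  hence "reps n \<delta> \<noteq> 0" using * by (intro notI) simp
  thus "1 \<le> reps n \<delta>" by simp
qed

lemma batch_pos: "1 \<le> batch n b \<epsilon>"
  by (simp add: batch_def)

text \<open>This turns a running time polynomial in \<open>n\<close> into one polynomial in the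
  number of samples.\<close>

lemma batch_ge:
  assumes "0 < \<epsilon>" "\<epsilon> \<le> 1" "1 \<le> n" "1 \<le> b"
  shows "n \<le> (batch n b \<epsilon>)\<^sup>2"
proof -
  have "real n \<le> 2048\<^sup>2 * real n" by simp
  also have "\<dots> \<le> (real (batch n b \<epsilon>) * \<epsilon>\<^sup>2)\<^sup>2"
    using batch_big_enough[OF assms] by (simp add: big_enough_def)
  also have "\<dots> \<le> (real (batch n b \<epsilon>) * 1)\<^sup>2"
    using assms by (intro power_mono mult_left_mono power_le_one) auto
  finally show ?thesis by (metis mult.right_neutral of_nat_le_iff of_nat_power)
qed

definition draws_at :: "nat \<Rightarrow> real \<Rightarrow> real \<Rightarrow> nat \<Rightarrow> nat" where
  "draws_at n \<epsilon> \<delta> b = 3 * (batch n b \<epsilon> * reps n \<delta>)"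

text \<open>The work around the samples takes at most \<open>230 * W ^ 3\<close> steps. With
  \<open>W \<le> 3 * D\<^sup>2\<close> this is
  \<open>230 * 27 * D ^ 6 = 6210 * D ^ 6\<close>.\<close>

lemma exec_level_com:
  assumes s: "nmem s ''n'' 0 = n" "nmem s ''b'' 0 = b" "nmem s ''K'' 0 = K"
      "rmem s ''eps'' 0 = \<epsilon>" "rmem s ''delta'' 0 = \<delta>"
    and pos: "0 < \<epsilon>" "\<epsilon> \<le> 1" "1 \<le> n" "1 \<le> b" "0 < \<delta>" "\<delta> \<le> 1"
  defines "M \<equiv> batch n b \<epsilon>" and "R \<equiv> reps n \<delta>" and "D \<equiv> draws_at n \<epsilon> \<delta> b"
  shows "\<exists>f. exec p level_com s = bind_pmf (replicate_pmf D p) (\<lambda>xs. return_spmf (f xs)) \<and>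
    (\<forall>xs. length xs = D \<longrightarrow>
       nmem (f xs) ''n'' 0 = n \<and> rmem (f xs) ''eps'' 0 = \<epsilon> \<and> rmem (f xs) ''delta'' 0 = \<delta> \<and>
       draws (f xs) = draws s + D \<and> steps (f xs) \<le> steps s + 6500 * D ^ 6 \<and>
       (if accepts n b M R \<epsilon> xs
        then nmem (f xs) ''b'' 0 = n \<and> nmem (f xs) ''K'' 0 = card (leaders (looks_flat R (take (M * R) xs)) n)
        else nmem (f xs) ''b'' 0 = b + b \<and> nmem (f xs) ''K'' 0 = K))"
proof -
  define W where "W = n + 1 + M * R"
  have MR: "1 \<le> M" "1 \<le> R" "M \<le> M * R" "R \<le> M * R"
    using reps_pos[OF pos(3,5,6)] batch_pos[of n b \<epsilon>] by (auto simp: M_def R_def)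
  have W: "n + 1 \<le> W" "M \<le> W" "R \<le> W" "M * R \<le> W" "1 \<le> W" using MR unfolding W_def by linarith+
  have wr: "nat_writes plan_com = {''R'', ''M'', ''N'', ''j''}" "real_writes plan_com = {''r''}"
    "nat_writes draw_com = {''x'', ''j''}" "real_writes draw_com = {}"
    "''n'' \<notin> nat_writes test_com" "''eps'' \<notin> real_writes test_com" "''delta'' \<notin> real_writes test_com"
    by (auto simp: plan_com_def reps_com_def batch_com_def alloc_com_def draw_com_def test_com_def count_com_def
         lead_com_def hyp_com_def vote_com_def flat_com_def zstat_com_def decide_com_def Let_def)
  from runs_plan_com[OF s(1,2,4,5) W(2,3,5)[unfolded M_def R_def] pos(1-4), of p] obtain s1 where
    s1: "exec p plan_com s = return_spmf s1" "nmem s1 ''R'' 0 = R" "nmem s1 ''M'' 0 = M"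
      "nmem s1 ''N'' 0 = M * R" "agree plan_com s s1" "steps s1 \<le> steps s + 18 * W" "draws s1 = draws s"
    by (auto simp: runs_def M_def R_def)
  obtain g where g: "exec p draw_com s1 = bind_pmf (replicate_pmf D p) (\<lambda>xs. return_spmf (g xs))"
    "\<And>xs. length xs = D \<Longrightarrow> (\<forall>j<D. nmem (g xs) ''x'' j = xs ! j) \<and> agree draw_com s1 (g xs) \<and>
       steps (g xs) \<le> steps s1 + 9 * (M * R) + 2 \<and> draws (g xs) = draws s1 + D"
    using exec_draw_com[OF s1(4), of p] by (auto simp: D_def draws_at_def M_def R_def)
  have "\<exists>t. exec p test_com (g xs) = return_spmf t \<and> (if accepts n b M R \<epsilon> xs
        then nmem t ''b'' 0 = n \<and> nmem t ''K'' 0 = card (leaders (looks_flat R (take (M * R) xs)) n)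
        else nmem t ''b'' 0 = b + b \<and> nmem t ''K'' 0 = K) \<and> agree test_com (g xs) t \<and>
        steps t \<le> steps (g xs) + 200 * W ^ 3 \<and> draws t = draws (g xs)" if "length xs = D" for xs
  proof -
    have "runs p test_com (g xs) (200 * W ^ 3) (\<lambda>t.
     if accepts n b M R \<epsilon> xs then nmem t ''b'' 0 = n \<and> nmem t ''K'' 0 = card (leaders (looks_flat R (take (M * R) xs)) n)
     else nmem t ''b'' 0 = b + b \<and> nmem t ''K'' 0 = K)"
      by (rule runs_test_com) (use g(2)[OF that] s1 s W that in \<open>auto simp: agree_def wr D_def draws_at_def M_def R_def\<close>)
    thus ?thesis by (simp add: runs_def)
  qed
  then obtain h where h: "\<And>xs. length xs = D \<Longrightarrow> exec p test_com (g xs) = return_spmf (h xs) \<and> (if accepts n b M R \<epsilon> xs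
        then nmem (h xs) ''b'' 0 = n \<and> nmem (h xs) ''K'' 0 = card (leaders (looks_flat R (take (M * R) xs)) n)
        else nmem (h xs) ''b'' 0 = b + b \<and> nmem (h xs) ''K'' 0 = K) \<and> agree test_com (g xs) (h xs) \<and>
        steps (h xs) \<le> steps (g xs) + 200 * W ^ 3 \<and> draws (h xs) = draws (g xs)"
    by metis
  have "exec p level_com s = bind_spmf (bind_pmf (replicate_pmf D p) (\<lambda>xs. return_spmf (g xs))) (exec p test_com)"
    by (simp add: level_com_def s1(1) g(1))
  also have "\<dots> = bind_pmf (replicate_pmf D p) (\<lambda>xs. exec p test_com (g xs))"
    by (simp add: bind_spmf_def bind_assoc_pmf bind_return_pmf)
  also have "\<dots> = bind_pmf (replicate_pmf D p) (\<lambda>xs. return_spmf (h xs))"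
    by (intro bind_pmf_cong refl) (use h in \<open>auto simp: set_replicate_pmf\<close>)
  finally have E: "exec p level_com s = bind_pmf (replicate_pmf D p) (\<lambda>xs. return_spmf (h xs))" .
  have "steps (h xs) \<le> steps s + 6500 * D ^ 6" if "length xs = D" for xs
  proof -
    have D: "D = 3 * (M * R)" "1 \<le> D" "M \<le> D" using MR by (simp_all add: D_def draws_at_def M_def R_def)
    have "n \<le> M\<^sup>2" using batch_ge[OF pos(1-4)] by (simp add: M_def)
    also have "\<dots> \<le> D\<^sup>2" using D(3) by (rule power_mono) simp
    finally have "n \<le> D\<^sup>2" .
    moreover have "1 \<le> D\<^sup>2" "D \<le> D\<^sup>2" using D(2) by (simp_all add: power2_eq_square)
    ultimately have WD: "W \<le> 3 * D\<^sup>2" unfolding W_def using D(1) by linarith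
    have "W \<le> W ^ 3" using W(5) by (rule self_le_power) simp
    have "1 \<le> W ^ 3" using W(5) by simp
    have "steps (h xs) \<le> steps s + 18 * W + 9 * (M * R) + 2 + 200 * W ^ 3"
      using h[OF that] g(2)[OF that] s1(6) by linarith
    also have "\<dots> \<le> steps s + 230 * W ^ 3"
      using \<open>W \<le> W ^ 3\<close> W(4) \<open>1 \<le> W ^ 3\<close> by linarith
    also have "\<dots> \<le> steps s + 230 * (3 * D\<^sup>2) ^ 3"
      using WD by (intro add_mono mult_mono power_mono) auto
    also have "230 * (3 * D\<^sup>2) ^ 3 = 6210 * D ^ 6" by (simp add: power_mult_distrib flip: power_mult)
    finally show ?thesis by (rule order.trans) simp
  qed
  moreover have "nmem (h xs) ''n'' 0 = n \<and> rmem (h xs) ''eps'' 0 = \<epsilon> \<and> rmem (h xs) ''delta'' 0 = \<delta> \<and>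
       draws (h xs) = draws s + D" if "length xs = D" for xs
    using h[OF that] g(2)[OF that] s1 s by (auto simp: agree_def wr)
  ultimately show ?thesis using E h by (intro exI[of _ h]) blast
qed

section \<open>Concentration\<close>

abbreviation E :: "'a pmf \<Rightarrow> ('a \<Rightarrow> real) \<Rightarrow> real" where
  "E p f \<equiv> measure_pmf.expectation p f"

lemma E_bind:
  assumes "finite (set_pmf p)" "\<And>x. x \<in> set_pmf p \<Longrightarrow> finite (set_pmf (f x))"
  shows "E (bind_pmf p f) h = E p (\<lambda>x. E (f x) h)"
  using assms by (subst pmf_expectation_bind[of "set_pmf p"])
    (auto simp: integral_measure_pmf[of "set_pmf p"])

lemma E_mono:
  assumes "finite (set_pmf p)" "\<And>x. x \<in> set_pmf p \<Longrightarrow> f x \<le> g x"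
  shows "E p f \<le> E p g"
  using assms by (intro integral_mono_AE integrable_measure_pmf_finite) (auto simp: AE_measure_pmf_iff)

lemma E_add: "finite (set_pmf p) \<Longrightarrow> E p (\<lambda>x. f x + g x) = E p f + E p g"
  by (simp add: integrable_measure_pmf_finite)

lemma E_diff: "finite (set_pmf p) \<Longrightarrow> E p (\<lambda>x. f x - g x) = E p f - E p g"
  by (simp add: integrable_measure_pmf_finite)

lemma E_cong: "(\<And>x. x \<in> set_pmf p \<Longrightarrow> f x = g x) \<Longrightarrow> E p f = E p g"
  by (intro integral_cong_AE) (auto simp: AE_measure_pmf_iff)

lemma E_sum: "finite (set_pmf p) \<Longrightarrow> E p (\<lambda>x. \<Sum>i\<in>A. f i x) = (\<Sum>i\<in>A. E p (f i))"
  by (rule Bochner_Integration.integral_sum) (auto simp: integrable_measure_pmf_finite)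

lemma prob_le_E:
  assumes "finite (set_pmf p)" "\<And>x. x \<in> set_pmf p \<Longrightarrow> 0 \<le> f x" "\<And>x. x \<in> set_pmf p \<Longrightarrow> x \<in> A \<Longrightarrow> 1 \<le> f x"
  shows "measure_pmf.prob p A \<le> E p f"
proof -
  have "measure_pmf.prob p A = E p (indicator A)" by simp
  also have "\<dots> \<le> E p f" using assms by (intro E_mono) (auto simp: indicator_def)
  finally show ?thesis .
qed

lemma finite_replicate_pmf [simp]: "finite (set_pmf p) \<Longrightarrow> finite (set_pmf (replicate_pmf n p))"
  by (rule finite_subset[OF _ finite_lists_length_eq[of "set_pmf p" n]])
     (auto simp: set_replicate_pmf)

lemma E_replicate_Suc:
  assumes "finite (set_pmf p)"
  shows "E (replicate_pmf (Suc n) p) f = E p (\<lambda>x. E (replicate_pmf n p) (\<lambda>xs. f (x # xs)))"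
  using assms by (simp add: E_bind)

lemma E_replicate_add:
  assumes "finite (set_pmf p)"
  shows "E (replicate_pmf (m + n) p) f = E (replicate_pmf m p) (\<lambda>xs. E (replicate_pmf n p) (\<lambda>ys. f (xs @ ys)))"
  using assms by (simp add: E_bind replicate_pmf_distrib)

text \<open>Squared mean plus variance of a sum of independent terms. The shift \<open>a\<close>
  carries the induction, because it absorbs the first sample.\<close>

lemma second_moment:
  fixes g :: "'a \<Rightarrow> real"
  assumes [simp]: "finite (set_pmf p)"
  shows "E (replicate_pmf M p) (\<lambda>xs. (sum_list (map g xs) + a)\<^sup>2) =
    (real M * E p g + a)\<^sup>2 + real M * (E p (\<lambda>x. (g x)\<^sup>2) - (E p g)\<^sup>2)"
proof (induction M arbitrary: a)
  case (Suc M)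
  define m where "m = real M * E p g + a"
  define V where "V = E p (\<lambda>x. (g x)\<^sup>2) - (E p g)\<^sup>2"
  have "E (replicate_pmf (Suc M) p) (\<lambda>xs. (sum_list (map g xs) + a)\<^sup>2) =
     E p (\<lambda>x. E (replicate_pmf M p) (\<lambda>xs. (sum_list (map g xs) + (a + g x))\<^sup>2))"
    by (simp only: E_replicate_Suc assms) (simp add: algebra_simps)
  also have "\<dots> = E p (\<lambda>x. (m + g x)\<^sup>2 + real M * V)"
    by (simp only: Suc.IH) (simp add: m_def V_def algebra_simps)
  also have "\<dots> = E p (\<lambda>x. (m\<^sup>2 + real M * V) + (2 * m) * g x + (g x)\<^sup>2)"
    by (simp add: power2_eq_square algebra_simps)
  also have "\<dots> = m\<^sup>2 + real M * V + 2 * m * E p g + E p (\<lambda>x. (g x)\<^sup>2)"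
    by (simp add: E_add)
  also have "\<dots> = (real (Suc M) * E p g + a)\<^sup>2 + real (Suc M) * V"
    by (simp add: m_def V_def power2_eq_square algebra_simps)
  finally show ?case by (simp add: V_def)
qed simp

section \<open>Exponential tail bounds for interval counts\<close>

lemma hits_Cons: "hits (x # xs) a b = of_bool (a \<le> x \<and> x \<le> b) + hits xs a b"
  by (simp add: hits_def)

text \<open>The generating function of a binomial count; with \<open>c = exp \<theta>\<close> it
  becomes the moment generating function.\<close>

lemma E_power_hits:
  assumes [simp]: "finite (set_pmf p)"
  shows "E (replicate_pmf N p) (\<lambda>xs. c ^ hits xs a b) = (1 + (c - 1) * measure_pmf.prob p {a..b}) ^ N"
proof (induction N)
  case (Suc N)
  let ?\<mu> = "measure_pmf.prob p {a..b}"
  have "E (replicate_pmf (Suc N) p) (\<lambda>xs. c ^ hits xs a b) =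
     E p (\<lambda>x. E (replicate_pmf N p) (\<lambda>xs. c ^ of_bool (a \<le> x \<and> x \<le> b) * c ^ hits xs a b))"
    by (simp only: E_replicate_Suc assms hits_Cons power_add)
  also have "\<dots> = E p (\<lambda>x. c ^ of_bool (a \<le> x \<and> x \<le> b) * (1 + (c - 1) * ?\<mu>) ^ N)"
    by (simp only: integral_mult_right_zero Suc.IH)
  also have "\<dots> = (1 + (c - 1) * ?\<mu>) ^ N * E p (\<lambda>x. 1 + (c - 1) * indicator {a..b} x)"
    by (subst integral_mult_right_zero[symmetric], rule E_cong) (auto simp: indicator_def)
  also have "\<dots> = (1 + (c - 1) * ?\<mu>) ^ Suc N"
    by (simp add: E_add)
  finally show ?case .
qed (simp add: hits_def)

text \<open>For \<open>x = - y < 0\<close> the claim reads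
  \<open>1 \<le> (1 - y + y\<^sup>2) * exp y\<close>, and this already holds with the quadratic
  Taylor polynomial in place of \<open>exp y\<close>.\<close>

lemma exp_le_quadratic:
  fixes x :: real
  assumes "\<bar>x\<bar> \<le> 1"
  shows "exp x \<le> 1 + x + x\<^sup>2"
proof (cases "0 \<le> x")
  case True
  thus ?thesis using assms exp_bound[of x] by simp
next
  case False
  define y where "y = - x"
  have y: "0 < y" using False by (simp add: y_def)
  have "1 \<le> (1 - y + y\<^sup>2) * (1 + y + y\<^sup>2 / 2)"
  proof -
    have "(1 - y + y\<^sup>2) * (1 + y + y\<^sup>2 / 2) = 1 + (y\<^sup>2 + y ^ 3 + y ^ 4) / 2"
      by (simp add: field_simps power2_eq_square power3_eq_cube power4_eq_xxxx)
    thus ?thesis using y by simp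
  qed
  also have "\<dots> \<le> (1 - y + y\<^sup>2) * exp y"
  proof (intro mult_left_mono exp_lower_Taylor_quadratic)
    have "0 \<le> (y - 1/2)\<^sup>2 + 3/4" by simp
    thus "0 \<le> 1 - y + y\<^sup>2" by (simp add: power2_eq_square algebra_simps)
  qed (use y in auto)
  finally have "exp (- y) \<le> 1 - y + y\<^sup>2" by (simp add: exp_minus field_simps)
  thus ?thesis by (simp add: y_def)
qed

text \<open>Markov's inequality for \<open>exp (\<theta> * hits)\<close>. The sign of \<theta>
  selects the tail, so that one lemma covers both.\<close>

lemma hits_tail:
  fixes \<theta> :: real and a b N :: nat
  assumes fin: "finite (set_pmf p)" and \<theta>: "\<bar>\<theta>\<bar> \<le> 1"
  defines "\<nu> \<equiv> real N * measure_pmf.prob p {a..b}"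
  shows "measure_pmf.prob (replicate_pmf N p) {xs. \<theta> * (real (hits xs a b) - \<nu>) \<ge> t} \<le> exp (\<theta>\<^sup>2 * \<nu> - t)"
proof -
  let ?\<mu> = "measure_pmf.prob p {a..b}"
  have "measure_pmf.prob (replicate_pmf N p) {xs. \<theta> * (real (hits xs a b) - \<nu>) \<ge> t} \<le>
    E (replicate_pmf N p) (\<lambda>xs. exp (- t - \<theta> * \<nu>) * exp \<theta> ^ hits xs a b)"
  proof (rule prob_le_E)
    fix xs assume "xs \<in> {xs. \<theta> * (real (hits xs a b) - \<nu>) \<ge> t}"
    hence "0 \<le> (- t - \<theta> * \<nu>) + real (hits xs a b) * \<theta>" by (simp add: algebra_simps)
    hence "1 \<le> exp ((- t - \<theta> * \<nu>) + real (hits xs a b) * \<theta>)" by simp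
    thus "1 \<le> exp (- t - \<theta> * \<nu>) * exp \<theta> ^ hits xs a b" by (simp only: exp_add exp_of_nat_mult)
  qed (use fin in auto)
  also have "\<dots> = exp (- t - \<theta> * \<nu>) * (1 + (exp \<theta> - 1) * ?\<mu>) ^ N"
    by (simp only: integral_mult_right_zero E_power_hits[OF fin])
  also have "\<dots> \<le> exp (- t - \<theta> * \<nu>) * exp ((\<theta> + \<theta>\<^sup>2) * ?\<mu>) ^ N"
  proof (intro mult_left_mono power_mono)
    have "1 + (exp \<theta> - 1) * ?\<mu> \<le> 1 + (\<theta> + \<theta>\<^sup>2) * ?\<mu>"
      using exp_le_quadratic[OF \<theta>] by (intro add_left_mono mult_right_mono) auto
    also have "\<dots> \<le> exp ((\<theta> + \<theta>\<^sup>2) * ?\<mu>)" by (rule exp_ge_add_one_self)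
    finally show "1 + (exp \<theta> - 1) * ?\<mu> \<le> exp ((\<theta> + \<theta>\<^sup>2) * ?\<mu>)" .
    have "1 + (exp \<theta> - 1) * ?\<mu> = (1 - ?\<mu>) + exp \<theta> * ?\<mu>" by (simp add: algebra_simps)
    also have "\<dots> \<ge> 0" by (intro add_nonneg_nonneg) auto
    finally show "0 \<le> 1 + (exp \<theta> - 1) * ?\<mu>" .
  qed auto
  also have "\<dots> = exp (\<theta>\<^sup>2 * \<nu> - t)"
    by (simp flip: exp_of_nat_mult exp_add add: \<nu>_def algebra_simps)
  finally show ?thesis .
qed

text \<open>Chernoff's bound with \<open>\<theta> = sqrt (R / (\<nu> + R))\<close>, which is at most 1 and balances \<open>\<theta>\<^sup>2 \<nu>\<close> against the
  threshold.\<close>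

lemma hits_concentration:
  fixes a b N R :: nat
  assumes fin: "finite (set_pmf p)" and R: "1 \<le> R"
  defines "\<nu> \<equiv> real N * measure_pmf.prob p {a..b}"
  shows "measure_pmf.prob (replicate_pmf N p)
     {xs. (real (hits xs a b) - \<nu>)\<^sup>2 > 4 * real R * (\<nu> + real R)} \<le> 2 / 2 ^ R"
proof -
  define \<theta> where "\<theta> = sqrt (real R / (\<nu> + real R))"
  have \<nu>: "0 \<le> \<nu>" by (simp add: \<nu>_def)
  have pos: "0 < \<nu> + real R" using \<nu> R by simp
  have \<theta>: "0 < \<theta>" "\<theta> \<le> 1" "\<theta>\<^sup>2 = real R / (\<nu> + real R)"
    using \<nu> R by (auto simp: \<theta>_def)
  have e: "\<theta>\<^sup>2 * \<nu> - 2 * real R \<le> - real R"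
  proof -
    have "\<theta>\<^sup>2 * \<nu> \<le> \<theta>\<^sup>2 * (\<nu> + real R)" by (intro mult_left_mono) auto
    also have "\<dots> = real R" using \<theta>(3) pos by simp
    finally show ?thesis by simp
  qed
  have b: "exp (- real R) \<le> 1 / 2 ^ R"
  proof -
    have "(2::real) ^ R \<le> exp 1 ^ R" using exp_ge_add_one_self[of 1] by (intro power_mono) auto
    also have "\<dots> = exp (real R)" by (simp flip: exp_of_nat_mult)
    finally show ?thesis by (simp add: exp_minus field_simps)
  qed
  let ?P = "measure_pmf.prob (replicate_pmf N p)"
  let ?X = "\<lambda>xs. real (hits xs a b) - \<nu>"
  have "?P {xs. (?X xs)\<^sup>2 > 4 * real R * (\<nu> + real R)} \<le> ?P ({xs. \<theta> * ?X xs \<ge> 2 * real R} \<union> {xs. (- \<theta>) * ?X xs \<ge> 2 * real R})"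
  proof (intro measure_pmf.finite_measure_mono subsetI)
    fix xs assume "xs \<in> {xs. (?X xs)\<^sup>2 > 4 * real R * (\<nu> + real R)}"
    hence "\<theta>\<^sup>2 * (4 * real R * (\<nu> + real R)) \<le> \<theta>\<^sup>2 * (?X xs)\<^sup>2" by (intro mult_left_mono) auto
    moreover have "\<theta>\<^sup>2 * (4 * real R * (\<nu> + real R)) = 4 * real R * (\<theta>\<^sup>2 * (\<nu> + real R))"
      by (simp only: mult_ac)
    moreover have "\<theta>\<^sup>2 * (\<nu> + real R) = real R" using pos by (simp add: \<theta>(3))
    moreover have "4 * real R * real R = (2 * real R)\<^sup>2" by (simp add: power2_eq_square)
    ultimately have "(2 * real R)\<^sup>2 \<le> (\<theta> * ?X xs)\<^sup>2"
      by (simp only: power_mult_distrib[of \<theta>])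
    hence "\<bar>2 * real R\<bar> \<le> \<bar>\<theta> * ?X xs\<bar>" using abs_le_square_iff by blast
    hence "2 * real R \<le> \<bar>\<theta> * ?X xs\<bar>" by simp
    thus "xs \<in> {xs. \<theta> * ?X xs \<ge> 2 * real R} \<union> {xs. (- \<theta>) * ?X xs \<ge> 2 * real R}" by (auto simp: abs_if split: if_splits)
  qed simp
  also have "\<dots> \<le> ?P {xs. \<theta> * ?X xs \<ge> 2 * real R} + ?P {xs. (- \<theta>) * ?X xs \<ge> 2 * real R}"
    by (rule measure_Un_le) auto
  also have "\<dots> \<le> exp (\<theta>\<^sup>2 * \<nu> - 2 * real R) + exp ((- \<theta>)\<^sup>2 * \<nu> - 2 * real R)"
    unfolding \<nu>_def using \<theta> by (intro add_mono hits_tail fin) auto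
  also have "\<dots> \<le> 1 / 2 ^ R + 1 / 2 ^ R"
    using e by (intro add_mono order.trans[OF _ b]) auto
  finally show ?thesis by simp
qed

subsection \<open>Majority votes\<close>

lemma votes_Suc:
  "votes T M (Suc R) xs = of_bool (T (take M xs) (take M (drop M xs))) + votes T M R (drop (M + M) xs)"
  unfolding votes_def by (subst sum.lessThan_Suc_shift) (simp add: algebra_simps)

lemma votes_append:
  assumes "length us = M" "length vs = M"
  shows "votes T M (Suc R) ((us @ vs) @ xs) = of_bool (T us vs) + votes T M R xs"
  using assms by (simp add: votes_Suc)

text \<open>Base 16 matches the error \<open>1 / 16\<close> of one round: a round contributes the
  factor \<open>1 + 15 * (1 / 16) < 2\<close> to the expectation.\<close>

lemma E_power_votes:
  assumes [simp]: "finite (set_pmf p)"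
    and T: "E (replicate_pmf M p) (\<lambda>us. E (replicate_pmf M p) (\<lambda>vs. of_bool (T us vs))) \<le> 1 / 16"
  shows "E (replicate_pmf (R * (M + M)) p) (\<lambda>xs. 16 ^ votes T M R xs) \<le> 2 ^ R"
proof (induction R)
  case (Suc R)
  let ?Q = "replicate_pmf M p" and ?S = "replicate_pmf (R * (M + M)) p"
  let ?t = "\<lambda>us vs. of_bool (T us vs) :: real"
  have "E (replicate_pmf (Suc R * (M + M)) p) (\<lambda>xs. 16 ^ votes T M (Suc R) xs) =
    E ?Q (\<lambda>us. E ?Q (\<lambda>vs. E ?S (\<lambda>xs. 16 ^ votes T M (Suc R) ((us @ vs) @ xs))))"
    by (simp only: mult_Suc E_replicate_add assms(1))
  also have "\<dots> = E ?Q (\<lambda>us. E ?Q (\<lambda>vs. (1 + 15 * ?t us vs) * E ?S (\<lambda>xs. 16 ^ votes T M R xs)))"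
    by (intro E_cong) (auto simp: set_replicate_pmf votes_append power_add simp del: append_assoc simp flip: integral_mult_right_zero)
  also have "\<dots> = (1 + 15 * E ?Q (\<lambda>us. E ?Q (?t us))) * E ?S (\<lambda>xs. 16 ^ votes T M R xs)"
    by (simp add: E_add)
  also have "\<dots> \<le> 2 * 2 ^ R"
    using T Suc.IH by (intro mult_mono) auto
  finally show ?case by simp
qed (simp add: votes_def)

text \<open>Markov's inequality for \<open>16 ^ votes\<close>: at half of the votes the power is
  \<open>4 ^ R\<close>, while its expectation is at most \<open>2 ^ R\<close>.\<close>

lemma majority:
  assumes fin: "finite (set_pmf p)"
    and T: "E (replicate_pmf M p) (\<lambda>us. E (replicate_pmf M p) (\<lambda>vs. of_bool (T us vs))) \<le> 1 / 16"
  shows "measure_pmf.prob (replicate_pmf (R * (M + M)) p) {xs. R \<le> 2 * votes T M R xs} \<le> 1 / 2 ^ R"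
proof -
  have "measure_pmf.prob (replicate_pmf (R * (M + M)) p) {xs. R \<le> 2 * votes T M R xs} \<le>
     E (replicate_pmf (R * (M + M)) p) (\<lambda>xs. (1 / 4 ^ R) * 16 ^ votes T M R xs)"
  proof (rule prob_le_E)
    fix xs assume "xs \<in> {xs. R \<le> 2 * votes T M R xs}"
    hence "(4::real) ^ R \<le> 4 ^ (2 * votes T M R xs)" by (intro power_increasing) auto
    thus "1 \<le> (1 / 4 ^ R) * (16 :: real) ^ votes T M R xs" by (simp add: power_mult)
  qed (use fin in auto)
  also have "\<dots> = (1 / 4 ^ R) * E (replicate_pmf (R * (M + M)) p) (\<lambda>xs. 16 ^ votes T M R xs)"
    by (rule integral_mult_right_zero)
  also have "\<dots> \<le> (1 / 4 ^ R) * 2 ^ R"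
    using E_power_votes[OF assms] by (intro mult_left_mono) auto
  also have "\<dots> = 1 / 2 ^ R"
  proof -
    have "(4::real) ^ R = 2 ^ R * 2 ^ R" by (simp flip: power_mult_distrib)
    thus ?thesis by simp
  qed
  finally show ?thesis .
qed

lemma votes_compl: "votes T M R xs + votes (\<lambda>us vs. \<not> T us vs) M R xs = R"
  by (induction R) (auto simp: votes_def)

lemma votes_mono: "(\<And>us vs. T us vs \<Longrightarrow> T' us vs) \<Longrightarrow> votes T M R xs \<le> votes T' M R xs"
  unfolding votes_def by (intro sum_mono) auto

section \<open>The chi-square statistic\<close>

text \<open>Pearson's chi-square divergence, smoothed by the uniform distribution: the denominators
  stay positive where \<open>h\<close> vanishes, and they sum to 2 when \<open>h\<close> sums to
  1.\<close>

definition chisq :: "nat \<Rightarrow> nat pmf \<Rightarrow> (nat \<Rightarrow> real) \<Rightarrow> real" where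
  "chisq n p h = (\<Sum>i\<in>{1..n}. (pmf p i - h i)\<^sup>2 / (h i + 1 / real n))"

lemma E_support:
  fixes p :: "nat pmf"
  assumes "set_pmf p \<subseteq> {1..n}"
  shows "E p f = (\<Sum>i\<in>{1..n}. pmf p i * f i)"
  using assms by (subst integral_measure_pmf_real[of "{1..n}"]) (auto simp: mult.commute)

lemma sum_hits:
  fixes c :: "nat \<Rightarrow> real"
  assumes "set xs \<subseteq> {1..n}"
  shows "(\<Sum>i\<in>{1..n}. c i * real (hits xs i i)) = sum_list (map c xs)"
  using assms
proof (induction xs)
  case (Cons x xs)
  have "(\<Sum>i\<in>{1..n}. c i * real (hits (x # xs) i i)) =
     (\<Sum>i\<in>{1..n}. (if i = x then c i else 0) + c i * real (hits xs i i))"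
    by (intro sum.cong refl) (auto simp: hits_Cons algebra_simps)
  also have "\<dots> = c x + (\<Sum>i\<in>{1..n}. c i * real (hits xs i i))"
    using Cons.prems by (simp add: sum.distrib)
  finally show ?case using Cons by simp
qed (simp add: hits_def)

text \<open>Up to a constant, the statistic is the sum of \<open>c x\<close> over the samples. The
  inequality comes from bounding the variance of \<open>c\<close> by its second moment.\<close>

lemma second_moment_hits:
  assumes p: "set_pmf p \<subseteq> {1..n}"
  shows "E (replicate_pmf M p) (\<lambda>xs. ((\<Sum>i\<in>{1..n}. c i * (real (hits xs i i) - real M * h i)) + a)\<^sup>2)
     \<le> (real M * (\<Sum>i\<in>{1..n}. c i * (pmf p i - h i)) + a)\<^sup>2 + real M * (\<Sum>i\<in>{1..n}. pmf p i * (c i)\<^sup>2)"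
proof -
  have fin: "finite (set_pmf p)" using p finite_subset by blast
  define b where "b = a - real M * (\<Sum>i\<in>{1..n}. c i * h i)"
  have "E (replicate_pmf M p) (\<lambda>xs. ((\<Sum>i\<in>{1..n}. c i * (real (hits xs i i) - real M * h i)) + a)\<^sup>2) =
    E (replicate_pmf M p) (\<lambda>xs. (sum_list (map c xs) + b)\<^sup>2)"
  proof (rule E_cong)
    fix xs assume "xs \<in> set_pmf (replicate_pmf M p)"
    hence xs: "set xs \<subseteq> {1..n}" using p by (auto simp: set_replicate_pmf)
    have "(\<Sum>i\<in>{1..n}. c i * (real (hits xs i i) - real M * h i)) = sum_list (map c xs) - real M * (\<Sum>i\<in>{1..n}. c i * h i)"
      by (simp add: sum_hits[OF xs, symmetric] right_diff_distrib sum_subtractf sum_distrib_left mult_ac)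
    thus "((\<Sum>i\<in>{1..n}. c i * (real (hits xs i i) - real M * h i)) + a)\<^sup>2 = (sum_list (map c xs) + b)\<^sup>2"
      by (simp only: b_def) (simp add: algebra_simps)
  qed
  also have "\<dots> = (real M * E p c + b)\<^sup>2 + real M * (E p (\<lambda>x. (c x)\<^sup>2) - (E p c)\<^sup>2)"
    by (rule second_moment[OF fin])
  also have "\<dots> \<le> (real M * E p c + b)\<^sup>2 + real M * E p (\<lambda>x. (c x)\<^sup>2)"
    by (intro add_left_mono mult_left_mono) auto
  also have "real M * E p c + b = real M * (\<Sum>i\<in>{1..n}. c i * (pmf p i - h i)) + a"
    by (simp add: E_support[OF p] b_def right_diff_distrib sum_subtractf mult_ac)
  finally show ?thesis by (simp add: E_support[OF p])
qed

text \<open>For fixed \<open>us\<close> the statistic is linear in the counts of \<open>vs\<close>, and vice versa; hence two applications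
  of the second moment of a linear statistic suffice.\<close>

lemma zstat_variance:
  fixes h :: "nat \<Rightarrow> real" and n M :: nat
  assumes p: "set_pmf p \<subseteq> {1..n}"
  defines "w \<equiv> \<lambda>i. h i + 1 / real n"
  defines "V1 \<equiv> \<Sum>i\<in>{1..n}. pmf p i * ((pmf p i - h i) / w i)\<^sup>2" and "V2 \<equiv> \<Sum>i\<in>{1..n}. (pmf p i / w i)\<^sup>2"
  shows "E (replicate_pmf M p) (\<lambda>us. E (replicate_pmf M p) (\<lambda>vs. (zstat n M h us vs - (real M)\<^sup>2 * chisq n p h)\<^sup>2))
     \<le> 2 * real M ^ 3 * V1 + (real M)\<^sup>2 * V2"
proof -
  have fin: "finite (set_pmf p)" using p finite_subset by blast
  let ?Q = "replicate_pmf M p"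
  let ?I = "{1..n}"
  define \<Delta> where "\<Delta> = chisq n p h"
  define d where "d i = pmf p i - h i" for i
  define c where "c us i = (real (hits us i i) - real M * h i) / w i" for us i
  have \<Delta>: "\<Delta> = (\<Sum>i\<in>?I. d i / w i * d i)"
    by (simp add: \<Delta>_def chisq_def d_def w_def power2_eq_square)
  have z: "zstat n M h us vs = (\<Sum>i\<in>?I. c us i * (real (hits vs i i) - real M * h i))" for us vs
    by (simp add: zstat_def c_def w_def)
  have "E ?Q (\<lambda>vs. (zstat n M h us vs - (real M)\<^sup>2 * \<Delta>)\<^sup>2) \<le>
      (real M)\<^sup>2 * ((\<Sum>i\<in>?I. c us i * d i) - real M * \<Delta>)\<^sup>2 + real M * (\<Sum>i\<in>?I. pmf p i * (c us i)\<^sup>2)" for us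
  proof -
    have "E ?Q (\<lambda>vs. (zstat n M h us vs - (real M)\<^sup>2 * \<Delta>)\<^sup>2) \<le>
      (real M * (\<Sum>i\<in>?I. c us i * d i) - (real M)\<^sup>2 * \<Delta>)\<^sup>2 + real M * (\<Sum>i\<in>?I. pmf p i * (c us i)\<^sup>2)"
      using second_moment_hits[OF p, of M "c us" h "- (real M)\<^sup>2 * \<Delta>"] by (simp add: z d_def)
    also have "real M * (\<Sum>i\<in>?I. c us i * d i) - (real M)\<^sup>2 * \<Delta> = real M * ((\<Sum>i\<in>?I. c us i * d i) - real M * \<Delta>)"
      by (simp add: power2_eq_square algebra_simps)
    finally show ?thesis by (simp add: power_mult_distrib)
  qed
  hence "E ?Q (\<lambda>us. E ?Q (\<lambda>vs. (zstat n M h us vs - (real M)\<^sup>2 * \<Delta>)\<^sup>2)) \<le>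
    E ?Q (\<lambda>us. (real M)\<^sup>2 * ((\<Sum>i\<in>?I. c us i * d i) - real M * \<Delta>)\<^sup>2 + real M * (\<Sum>i\<in>?I. pmf p i * (c us i)\<^sup>2))"
    using fin by (intro E_mono) auto
  also have "\<dots> = (real M)\<^sup>2 * E ?Q (\<lambda>us. ((\<Sum>i\<in>?I. c us i * d i) - real M * \<Delta>)\<^sup>2) +
     real M * (\<Sum>i\<in>?I. pmf p i * E ?Q (\<lambda>us. (c us i)\<^sup>2))"
    using fin by (simp add: E_add E_sum)
  also have "\<dots> \<le> (real M)\<^sup>2 * (real M * V1) + real M * (\<Sum>i\<in>?I. pmf p i * (((real M)\<^sup>2 * (d i)\<^sup>2 + real M * pmf p i) / (w i)\<^sup>2))"
  proof (intro add_mono mult_left_mono sum_mono)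
    have "E ?Q (\<lambda>us. ((\<Sum>i\<in>?I. c us i * d i) - real M * \<Delta>)\<^sup>2) =
      E ?Q (\<lambda>us. ((\<Sum>i\<in>?I. d i / w i * (real (hits us i i) - real M * h i)) + - real M * \<Delta>)\<^sup>2)"
      by (simp add: c_def mult_ac)
    also have "\<dots> \<le> (real M * (\<Sum>i\<in>?I. d i / w i * d i) + - real M * \<Delta>)\<^sup>2 + real M * (\<Sum>i\<in>?I. pmf p i * (d i / w i)\<^sup>2)"
      unfolding d_def by (rule second_moment_hits[OF p])
    also have "\<dots> = real M * V1" unfolding \<Delta>[symmetric] by (simp add: V1_def d_def)
    finally show "E ?Q (\<lambda>us. ((\<Sum>i\<in>?I. c us i * d i) - real M * \<Delta>)\<^sup>2) \<le> real M * V1" .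
  next
    fix i assume i: "i \<in> ?I"
    \<comment> \<open>A single deviation \<open>c us i\<close> is the linear statistic with one
      nonzero coefficient.\<close>
    have eq: "(\<Sum>j\<in>?I. (if j = i then 1 / w i else 0) * f j) = f i / w i" for f :: "nat \<Rightarrow> real"
    proof -
      have "(\<Sum>j\<in>?I. (if j = i then 1 / w i else 0) * f j) = (\<Sum>j\<in>?I. if j = i then f i / w i else 0)"
        by (intro sum.cong) auto
      thus ?thesis using i by simp
    qed
    have eq2: "(\<Sum>j\<in>?I. pmf p j * (if j = i then 1 / w i else 0)\<^sup>2) = pmf p i / (w i)\<^sup>2"
    proof -
      have "(\<Sum>j\<in>?I. pmf p j * (if j = i then 1 / w i else 0)\<^sup>2) = (\<Sum>j\<in>?I. if j = i then pmf p i / (w i)\<^sup>2 else 0)"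
        by (intro sum.cong) (auto simp: power_divide)
      thus ?thesis using i by simp
    qed
    have "E ?Q (\<lambda>us. (c us i)\<^sup>2) \<le> (real M * (d i / w i))\<^sup>2 + real M * (pmf p i / (w i)\<^sup>2)"
      using second_moment_hits[OF p, of M "\<lambda>j. if j = i then 1 / w i else 0" h 0]
      unfolding eq eq2 by (simp add: c_def d_def)
    also have "\<dots> = ((real M)\<^sup>2 * (d i)\<^sup>2 + real M * pmf p i) / (w i)\<^sup>2"
      by (simp add: power_divide power_mult_distrib add_divide_distrib)
    finally show "E ?Q (\<lambda>us. (c us i)\<^sup>2) \<le> \<dots>" .
  qed auto
  also have "real M * (\<Sum>i\<in>?I. pmf p i * (((real M)\<^sup>2 * (d i)\<^sup>2 + real M * pmf p i) / (w i)\<^sup>2)) =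
      real M ^ 3 * V1 + (real M)\<^sup>2 * V2"
    unfolding V1_def V2_def sum_distrib_left sum.distrib[symmetric] d_def[symmetric]
    by (intro sum.cong refl) (simp add: power_divide add_divide_distrib distrib_left power2_eq_square power3_eq_cube mult_ac)
  also have "(real M)\<^sup>2 * (real M * V1) + (real M ^ 3 * V1 + (real M)\<^sup>2 * V2) = 2 * real M ^ 3 * V1 + (real M)\<^sup>2 * V2"
    by (simp add: power2_eq_square power3_eq_cube)
  finally show ?thesis by (simp add: \<Delta>_def)
qed

lemma chisq_nonneg:
  assumes "\<And>i. 0 \<le> h i"
  shows "0 \<le> chisq n p h"
  unfolding chisq_def using assms by (intro sum_nonneg divide_nonneg_nonneg add_nonneg_nonneg) auto

text \<open>Both bounds split \<open>p = h + (p - h)\<close>. The first part is controlled by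
  \<open>h \<le> w\<close>; for the second, \<open>1 / w \<le> n\<close> bounds
  \<open>((p - h) / w)\<^sup>2\<close> by \<open>n\<close> times a summand of \<Delta>.\<close>

lemma variance_proxies:
  fixes h :: "nat \<Rightarrow> real" and n :: nat and p :: "nat pmf"
  assumes n: "1 \<le> n" and h: "\<And>i. 0 \<le> h i"
  defines "w \<equiv> \<lambda>i. h i + 1 / real n" and "\<Delta> \<equiv> chisq n p h"
  shows "(\<Sum>i\<in>{1..n}. pmf p i * ((pmf p i - h i) / w i)\<^sup>2) \<le> \<Delta> + sqrt (real n) * (\<Delta> * sqrt \<Delta>)"
    and "(\<Sum>i\<in>{1..n}. (pmf p i / w i)\<^sup>2) \<le> 2 * real n * (1 + \<Delta>)"
proof -
  have w: "1 / real n \<le> w i" "h i \<le> w i" "0 < w i" for i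
    using n h[of i] by (auto simp: w_def intro: add_nonneg_pos)
  have \<Delta>0: "0 \<le> \<Delta>" unfolding \<Delta>_def by (rule chisq_nonneg[OF h])
  have \<Delta>: "\<Delta> = (\<Sum>i\<in>{1..n}. (pmf p i - h i)\<^sup>2 / w i)" by (simp add: \<Delta>_def chisq_def w_def)
  have inv: "1 / w i \<le> real n" for i
    using w[of i] n by (simp add: field_simps)
  have le_total: "(pmf p i - h i)\<^sup>2 / w i \<le> \<Delta>" if "i \<in> {1..n}" for i
    unfolding \<Delta> by (intro member_le_sum divide_nonneg_pos zero_le_power2 w(3)) (use that in auto)
  have dw2: "((pmf p i - h i) / w i)\<^sup>2 \<le> real n * ((pmf p i - h i)\<^sup>2 / w i)" for i
  proof -
    have "((pmf p i - h i) / w i)\<^sup>2 = (1 / w i) * ((pmf p i - h i)\<^sup>2 / w i)"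
      by (simp add: power2_eq_square)
    also have "\<dots> \<le> real n * ((pmf p i - h i)\<^sup>2 / w i)"
      by (intro mult_right_mono inv divide_nonneg_pos zero_le_power2 w(3))
    finally show ?thesis .
  qed
  have dw: "\<bar>pmf p i - h i\<bar> / w i \<le> sqrt (real n) * sqrt \<Delta>" if "i \<in> {1..n}" for i
  proof -
    have "((pmf p i - h i) / w i)\<^sup>2 \<le> real n * \<Delta>"
      using dw2[of i] mult_left_mono[OF le_total[OF that], of "real n"] by linarith
    hence "\<bar>(pmf p i - h i) / w i\<bar> \<le> sqrt (real n * \<Delta>)" by (metis real_sqrt_abs real_sqrt_le_mono)
    thus ?thesis using w(3)[of i] by (simp add: real_sqrt_mult)
  qed
  have "(\<Sum>i\<in>{1..n}. pmf p i * ((pmf p i - h i) / w i)\<^sup>2) \<le>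
      (\<Sum>i\<in>{1..n}. (1 + sqrt (real n) * sqrt \<Delta>) * ((pmf p i - h i)\<^sup>2 / w i))"
  proof (rule sum_mono)
    fix i assume i: "i \<in> {1..n}"
    have "pmf p i / w i \<le> h i / w i + \<bar>pmf p i - h i\<bar> / w i"
      using w(3)[of i] by (simp add: field_simps)
    also have "\<dots> \<le> 1 + sqrt (real n) * sqrt \<Delta>"
      using dw[OF i] w[of i] by (intro add_mono) auto
    finally have "pmf p i / w i * ((pmf p i - h i)\<^sup>2 / w i) \<le> (1 + sqrt (real n) * sqrt \<Delta>) * ((pmf p i - h i)\<^sup>2 / w i)"
      using w(3)[of i] by (intro mult_right_mono) (auto intro: less_imp_le)
    thus "pmf p i * ((pmf p i - h i) / w i)\<^sup>2 \<le> (1 + sqrt (real n) * sqrt \<Delta>) * ((pmf p i - h i)\<^sup>2 / w i)"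
      by (simp add: power2_eq_square)
  qed
  also have "\<dots> = \<Delta> + sqrt (real n) * (\<Delta> * sqrt \<Delta>)"
    unfolding sum_distrib_left[symmetric] \<Delta>[symmetric] by (simp add: algebra_simps)
  finally show "(\<Sum>i\<in>{1..n}. pmf p i * ((pmf p i - h i) / w i)\<^sup>2) \<le> \<Delta> + sqrt (real n) * (\<Delta> * sqrt \<Delta>)" .
  have "(\<Sum>i\<in>{1..n}. (pmf p i / w i)\<^sup>2) \<le> (\<Sum>i\<in>{1..n}. 2 + 2 * real n * ((pmf p i - h i)\<^sup>2 / w i))"
  proof (rule sum_mono)
    fix i
    define a where "a = h i / w i"
    define b where "b = (pmf p i - h i) / w i"
    have "0 \<le> a" "a \<le> 1" using w[of i] h[of i] by (auto simp: a_def)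
    hence "a\<^sup>2 \<le> 1" by (simp add: power_le_one)
    moreover have "pmf p i / w i = a + b" by (simp add: a_def b_def diff_divide_distrib)
    moreover have "(a + b)\<^sup>2 \<le> 2 * a\<^sup>2 + 2 * b\<^sup>2"
      using zero_le_power2[of "a - b"] by (simp add: power2_eq_square algebra_simps)
    ultimately show "(pmf p i / w i)\<^sup>2 \<le> 2 + 2 * real n * ((pmf p i - h i)\<^sup>2 / w i)"
      using dw2[of i] by (simp add: b_def)
  qed
  also have "\<dots> = 2 * real n * (1 + \<Delta>)"
    unfolding sum.distrib sum_distrib_left[symmetric] \<Delta>[symmetric] by (simp add: algebra_simps)
  finally show "(\<Sum>i\<in>{1..n}. (pmf p i / w i)\<^sup>2) \<le> 2 * real n * (1 + \<Delta>)" .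
qed

text \<open>The maximum makes the tolerance relative for a large chi-square distance and absolute
  for a small one, so that a single event covers false acceptance and false rejection.\<close>

definition zoff :: "nat \<Rightarrow> nat pmf \<Rightarrow> real \<Rightarrow> nat \<Rightarrow> (nat \<Rightarrow> real) \<Rightarrow> nat list \<Rightarrow> nat list \<Rightarrow> bool" where
  "zoff n p \<epsilon> M h us vs \<longleftrightarrow>
     (real M)\<^sup>2 * max (chisq n p h) (\<epsilon>\<^sup>2) / 4 \<le> \<bar>zstat n M h us vs - (real M)\<^sup>2 * chisq n p h\<bar>"

text \<open>Chebyshev's inequality at \<open>T = M\<^sup>2 * g / 4\<close>. In units of
  \<open>M ^ 4 * g\<^sup>2 / 2048\<close> the three parts of the variance are at most 2 each, so 8
  units suffice; divided by \<open>T\<^sup>2\<close> they give \<open>16 * 8 / 2048\<close>.\<close>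

lemma zoff_rare:
  fixes h :: "nat \<Rightarrow> real" and n M :: nat
  assumes p: "set_pmf p \<subseteq> {1..n}" and n: "1 \<le> n" and h: "\<And>i. 0 \<le> h i"
    and \<epsilon>: "0 < \<epsilon>" "\<epsilon> \<le> 1" and M: "2048 * sqrt (real n) \<le> real M * \<epsilon>\<^sup>2"
  shows "E (replicate_pmf M p) (\<lambda>us. E (replicate_pmf M p) (\<lambda>vs. of_bool (zoff n p \<epsilon> M h us vs))) \<le> 1 / 16"
proof -
  have fin: "finite (set_pmf p)" using p finite_subset by blast
  let ?Q = "replicate_pmf M p"
  define \<Delta> where "\<Delta> = chisq n p h"
  define g where "g = max \<Delta> (\<epsilon>\<^sup>2)"
  define m where "m = real M"
  define r where "r = sqrt (real n)"
  define T where "T = m\<^sup>2 * g / 4"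
  have \<Delta>0: "0 \<le> \<Delta>" unfolding \<Delta>_def by (rule chisq_nonneg[OF h])
  have \<epsilon>2: "0 < \<epsilon>\<^sup>2" "\<epsilon>\<^sup>2 \<le> 1" using \<epsilon> by (auto simp: power_le_one)
  have g: "\<Delta> \<le> g" "\<epsilon>\<^sup>2 \<le> g" "0 < g" using less_le_trans[OF \<epsilon>2(1) max.cobounded2] by (auto simp: g_def)
  have r: "1 \<le> r" "r * r = real n" using n by (auto simp: r_def)
  have m\<epsilon>: "2048 * r \<le> m * \<epsilon>\<^sup>2" using M by (simp add: m_def r_def)
  have m: "0 < m" using m\<epsilon> r(1) \<epsilon>2 by (simp add: m_def) (metis mult_zero_left neq0_conv not_le of_nat_0 zero_less_one order_less_le_trans mult_pos_pos zero_less_numeral)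
  have T: "0 < T" using m g by (simp add: T_def)
  have rg: "2048 * r \<le> m * g"
    using m\<epsilon> mult_left_mono[OF g(2), of m] m by linarith
  have "E ?Q (\<lambda>us. E ?Q (\<lambda>vs. of_bool (zoff n p \<epsilon> M h us vs))) \<le>
     E ?Q (\<lambda>us. E ?Q (\<lambda>vs. (1 / T\<^sup>2) * (zstat n M h us vs - m\<^sup>2 * \<Delta>)\<^sup>2))"
  proof (intro E_mono)
    fix us vs
    show "of_bool (zoff n p \<epsilon> M h us vs) \<le> (1 / T\<^sup>2) * (zstat n M h us vs - m\<^sup>2 * \<Delta>)\<^sup>2"
    proof (cases "zoff n p \<epsilon> M h us vs")
      case True
      hence "T \<le> \<bar>zstat n M h us vs - m\<^sup>2 * \<Delta>\<bar>" by (simp add: zoff_def T_def g_def m_def \<Delta>_def)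
      hence "T\<^sup>2 \<le> (zstat n M h us vs - m\<^sup>2 * \<Delta>)\<^sup>2" using T by (metis abs_le_square_iff abs_of_pos)
      thus ?thesis using T by (simp add: field_simps)
    qed simp
  qed (use fin in auto)
  also have "\<dots> = (1 / T\<^sup>2) * E ?Q (\<lambda>us. E ?Q (\<lambda>vs. (zstat n M h us vs - m\<^sup>2 * \<Delta>)\<^sup>2))"
    by simp
  also have "\<dots> \<le> (1 / T\<^sup>2) * (2 * m ^ 3 * (\<Delta> + r * (\<Delta> * sqrt \<Delta>)) + m\<^sup>2 * (2 * real n * (1 + \<Delta>)))"
  proof (intro mult_left_mono order.trans[OF zstat_variance[OF p, of M h, folded m_def \<Delta>_def]] add_mono)
  qed (use variance_proxies[OF n h, of p] m in \<open>auto simp: \<Delta>_def r_def\<close>)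
  also have "\<dots> \<le> (1 / T\<^sup>2) * (m ^ 4 * g\<^sup>2 / 256)"
  proof (intro mult_left_mono)
    have m\<epsilon>': "2048 \<le> m * \<epsilon>\<^sup>2" using m\<epsilon> r(1) by linarith
    have mg: "2048 \<le> m * g" using rg r(1) by linarith
    have a: "m ^ 3 * \<Delta> \<le> m ^ 4 * g\<^sup>2 / 2048"
    proof -
      have "2048 * (m ^ 3 * \<Delta>) \<le> (m * g) * (m ^ 3 * g)"
        using mg g m \<Delta>0 by (intro mult_mono) auto
      thus ?thesis by (simp add: power2_eq_square power3_eq_cube power4_eq_xxxx algebra_simps)
    qed
    \<comment> \<open>Here \<open>\<epsilon>\<^sup>2\<close> has to pay for the half power of
      \<open>g\<close>: from \<open>\<epsilon>\<^sup>2 \<le> \<epsilon> \<le> sqrt g\<close> follows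
      \<open>\<epsilon>\<^sup>2 * sqrt g \<le> g\<close>.\<close>
    have b: "m ^ 3 * (r * (\<Delta> * sqrt \<Delta>)) \<le> m ^ 4 * g\<^sup>2 / 2048"
    proof -
      have eg: "\<epsilon> \<le> sqrt g" using g(2) \<epsilon> by (metis real_le_rsqrt)
      have "\<epsilon>\<^sup>2 * sqrt g \<le> sqrt g * sqrt g"
      proof (intro mult_right_mono)
        have "\<epsilon>\<^sup>2 \<le> \<epsilon>" using \<epsilon> by (simp add: power2_eq_square)
        thus "\<epsilon>\<^sup>2 \<le> sqrt g" using eg by linarith
      qed (use g in auto)
      hence e: "\<epsilon>\<^sup>2 * sqrt g \<le> g" using g by simp
      have "2048 * (r * (\<Delta> * sqrt \<Delta>)) = (2048 * r) * (\<Delta> * sqrt \<Delta>)" by simp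
      also have "\<dots> \<le> (m * \<epsilon>\<^sup>2) * (g * sqrt g)"
        by (rule mult_mono[OF m\<epsilon> mult_mono[OF g(1) real_sqrt_le_mono[OF g(1)]]])
           (use r(1) g \<Delta>0 m in auto)
      also have "\<dots> = m * g * (\<epsilon>\<^sup>2 * sqrt g)" by simp
      also have "\<dots> \<le> m * g * g" using e m g by (intro mult_left_mono) auto
      finally have "m ^ 3 * (2048 * (r * (\<Delta> * sqrt \<Delta>))) \<le> m ^ 3 * (m * g * g)"
        using m by (intro mult_left_mono) auto
      thus ?thesis by (simp add: power2_eq_square power3_eq_cube power4_eq_xxxx algebra_simps)
    qed
    have rr: "2048 * (2048 * real n) \<le> m\<^sup>2 * \<epsilon>\<^sup>2 * \<epsilon>\<^sup>2"
    proof -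
      have "(2048 * r) * (2048 * r) \<le> (m * \<epsilon>\<^sup>2) * (m * \<epsilon>\<^sup>2)"
        by (rule mult_mono[OF m\<epsilon> m\<epsilon>]) (use r(1) m in auto)
      thus ?thesis using r(2) by (simp add: power2_eq_square mult_ac)
    qed
    have c: "real n * (1 + \<Delta>) \<le> m\<^sup>2 * g\<^sup>2 / 2048"
    proof -
      have "\<epsilon>\<^sup>2 * (1 + \<Delta>) \<le> 2 * g"
        using g \<epsilon>2 mult_mono[of "\<epsilon>\<^sup>2" 1 \<Delta> g] \<Delta>0 by (simp add: distrib_left)
      hence "\<epsilon>\<^sup>2 * (\<epsilon>\<^sup>2 * (1 + \<Delta>)) \<le> g * (2 * g)"
        by (rule mult_mono[OF g(2)]) (use g \<epsilon>2 \<Delta>0 in auto)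
      hence "m\<^sup>2 * (\<epsilon>\<^sup>2 * (\<epsilon>\<^sup>2 * (1 + \<Delta>))) \<le> m\<^sup>2 * (g * (2 * g))"
        by (intro mult_left_mono) auto
      moreover have "2048 * (2048 * real n) * (1 + \<Delta>) \<le> m\<^sup>2 * \<epsilon>\<^sup>2 * \<epsilon>\<^sup>2 * (1 + \<Delta>)"
        using rr \<Delta>0 by (intro mult_right_mono) auto
      ultimately have "2048 * (2048 * (real n * (1 + \<Delta>))) \<le> 2 * (m\<^sup>2 * g\<^sup>2)"
        by (simp add: power2_eq_square mult_ac)
      moreover have "0 \<le> m\<^sup>2 * g\<^sup>2" by simp
      ultimately show ?thesis by linarith
    qed
    have c': "m\<^sup>2 * (2 * real n * (1 + \<Delta>)) \<le> 2 * (m ^ 4 * g\<^sup>2 / 2048)"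
      using mult_left_mono[OF c, of "m\<^sup>2"] by (simp add: power2_eq_square power4_eq_xxxx mult_ac)
    have "2 * m ^ 3 * (\<Delta> + r * (\<Delta> * sqrt \<Delta>)) = 2 * (m ^ 3 * \<Delta>) + 2 * (m ^ 3 * (r * (\<Delta> * sqrt \<Delta>)))"
      by (simp add: algebra_simps)
    moreover have "0 \<le> m ^ 4 * g\<^sup>2" by simp
    ultimately show "2 * m ^ 3 * (\<Delta> + r * (\<Delta> * sqrt \<Delta>)) + m\<^sup>2 * (2 * real n * (1 + \<Delta>)) \<le> m ^ 4 * g\<^sup>2 / 256"
      using a b c' by linarith
  qed simp
  also have "\<dots> = 1 / 16"
    using m g by (simp add: T_def power2_eq_square power4_eq_xxxx)
  finally show ?thesis .
qed

section \<open>The greedy partition\<close>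

lemma lead_mono: "i \<le> j \<Longrightarrow> lead ok i \<le> lead ok j"
proof (rule lift_Suc_mono_le[of "lead ok"])
  fix i show "lead ok i \<le> lead ok (Suc i)" using lead_le[of ok i] by simp
qed

text \<open>The reason why the classes of equal leader are intervals.\<close>

lemma lead_between: "lead ok i \<le> j \<Longrightarrow> j \<le> i \<Longrightarrow> lead ok j = lead ok i"
proof (induction i)
  case (Suc i)
  show ?case
  proof (cases "lead ok (Suc i) = Suc i \<or> j = Suc i")
    case True
    thus ?thesis using Suc.prems by auto
  next
    case False
    hence "lead ok (Suc i) = lead ok i" by (auto split: if_splits)
    thus ?thesis using Suc False by (simp del: lead.simps)
  qed
qed simp

lemma lead_idem [simp]: "lead ok (lead ok i) = lead ok i"
  by (rule lead_between) (auto simp: lead_le)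

lemma lead_ok: "lead ok i < i \<Longrightarrow> ok (lead ok i) i"
  by (cases i) (auto split: if_splits)

lemma bin_interval:
  assumes "i \<in> {1..n}"
  obtains e where "lead ok i \<le> i" "i \<le> e" "e \<le> n" "lead ok e = lead ok i" "bin ok n i = {lead ok i..e}"
proof -
  define e where "e = Max (bin ok n i)"
  have fin: "finite (bin ok n i)" and i: "i \<in> bin ok n i" using assms by (auto simp: bin_def)
  have e: "e \<in> bin ok n i" unfolding e_def using fin i by (intro Max_in) auto
  have "bin ok n i = {lead ok i..e}"
  proof (intro equalityI subsetI)
    fix j assume j: "j \<in> bin ok n i"
    hence "lead ok i \<le> j" using lead_le[of ok j] by (simp add: bin_def)
    moreover have "j \<le> e" unfolding e_def using fin j by (rule Max_ge)
    ultimately show "j \<in> {lead ok i..e}" by simp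
  next
    fix j assume j: "j \<in> {lead ok i..e}"
    hence "lead ok j = lead ok e" using e by (intro lead_between) (auto simp: bin_def)
    moreover have "1 \<le> j" using j lead_pos[of i ok] assms by auto
    ultimately show "j \<in> bin ok n i" using j e by (auto simp: bin_def)
  qed
  moreover have "i \<le> e" unfolding e_def using fin i by (rule Max_ge)
  moreover have "e \<le> n" "lead ok e = lead ok i" using e by (simp_all add: bin_def)
  ultimately show thesis using that[of e] lead_le[of ok i] by blast
qed

lemma bin_eq_iff: "i \<in> {1..n} \<Longrightarrow> j \<in> {1..n} \<Longrightarrow> bin ok n i = bin ok n j \<longleftrightarrow> lead ok i = lead ok j"
  by (auto simp: bin_def)

lemma bins_eq: "bin ok n ` {1..n} = bin ok n ` leaders ok n"
proof (intro equalityI subsetI)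
  fix B assume "B \<in> bin ok n ` {1..n}"
  then obtain i where i: "i \<in> {1..n}" "B = bin ok n i" by blast
  have "lead ok i \<in> leaders ok n"
    using lead_le[of ok i] lead_pos[of i ok] i(1) by (auto simp: leaders_def)
  moreover have "B = bin ok n (lead ok i)" by (simp add: i(2) bin_def)
  ultimately show "B \<in> bin ok n ` leaders ok n" by blast
qed (auto simp: leaders_def)

lemma card_bins: "card (bin ok n ` {1..n}) = card (leaders ok n)"
  unfolding bins_eq
proof (rule card_image, rule inj_onI)
  fix i j assume "i \<in> leaders ok n" "j \<in> leaders ok n" "bin ok n i = bin ok n j"
  thus "i = j" using bin_eq_iff[of i n j ok] by (auto simp: leaders_def)
qed

lemma partition_bins: "partition_on {1..n} (bin ok n ` {1..n})"
  by (rule partition_onI) (auto simp: bin_def disjnt_def)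

lemma card_leaders_bounds:
  assumes "1 \<le> n"
  shows "1 \<le> card (leaders ok n)" "card (leaders ok n) \<le> n"
proof -
  have "lead ok 1 = 1" using lead_le[of ok 1] lead_pos[of 1 ok] by simp
  hence "1 \<in> leaders ok n" using assms by (simp add: leaders_def)
  hence "card (leaders ok n) \<noteq> 0" by auto
  thus "1 \<le> card (leaders ok n)" by linarith
  show "card (leaders ok n) \<le> n"
    using card_mono[of "{1..n}" "leaders ok n"] by (simp add: leaders_def subset_eq)
qed

subsection \<open>The hypothesis\<close>

lemma hyp_nonneg: "0 \<le> hyp ok n ys i"
  by (simp add: hyp_def sum_nonneg)

lemma sum_hyp:
  assumes "set ys \<subseteq> {1..n}" "ys \<noteq> []"
  shows "(\<Sum>i\<in>{1..n}. hyp ok n ys i) = 1"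
proof -
  let ?N = "real (length ys)"
  have "(\<Sum>i\<in>{1..n}. hyp ok n ys i) =
    (\<Sum>i\<in>{1..n}. \<Sum>j\<in>{j \<in> {1..n}. lead ok j = lead ok i}. real (hits ys j j) / (?N * real (card (bin ok n i))))"
    by (simp add: hyp_def bin_def sum_divide_distrib)
  also have "\<dots> = (\<Sum>j\<in>{1..n}. \<Sum>i\<in>{i \<in> {1..n}. lead ok j = lead ok i}. real (hits ys j j) / (?N * real (card (bin ok n i))))"
    by (rule sum.swap_restrict) auto
  also have "\<dots> = (\<Sum>j\<in>{1..n}. real (hits ys j j) / ?N)"
  proof (rule sum.cong)
    fix j assume j: "j \<in> {1..n}"
    have "{i \<in> {1..n}. lead ok j = lead ok i} = bin ok n j" by (auto simp: bin_def)
    moreover have "bin ok n i = bin ok n j" if "i \<in> bin ok n j" for i using that by (auto simp: bin_def)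
    moreover have "card (bin ok n j) \<noteq> 0" using j by (auto simp: bin_def)
    ultimately show "(\<Sum>i\<in>{i \<in> {1..n}. lead ok j = lead ok i}. real (hits ys j j) / (?N * real (card (bin ok n i)))) =
      real (hits ys j j) / ?N" by (simp del: card_eq_0_iff)
  qed simp
  also have "\<dots> = 1"
    using sum_hits[OF assms(1), of "\<lambda>_. 1"] assms(2) by (simp flip: sum_divide_distrib add: sum_list_triv)
  finally show ?thesis .
qed

text \<open>In the Cauchy-Schwarz inequality the weights sum to 2, half from \<open>h\<close> and
  half from \<open>1 / n\<close>. The bound \<open>2 * \<epsilon>\<^sup>2\<close> thus becomes
  \<open>(2 * \<epsilon>)\<^sup>2\<close>, and total variation halves the root.\<close>

lemma tv_le_chisq:
  assumes n: "1 \<le> n" and h: "\<And>i. 0 \<le> h i" "(\<Sum>i\<in>{1..n}. h i) = 1"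
    and \<epsilon>: "0 \<le> \<epsilon>" "chisq n p h \<le> 2 * \<epsilon>\<^sup>2"
  shows "(1/2) * (\<Sum>i\<in>{1..n}. \<bar>pmf p i - h i\<bar>) \<le> \<epsilon>"
proof -
  define w where "w i = h i + 1 / real n" for i
  have w: "0 < w i" for i using n h(1)[of i] by (auto simp: w_def intro: add_nonneg_pos)
  have "(\<Sum>i\<in>{1..n}. \<bar>pmf p i - h i\<bar>)\<^sup>2 = (\<Sum>i\<in>{1..n}. (\<bar>pmf p i - h i\<bar> / sqrt (w i)) * sqrt (w i))\<^sup>2"
    using w by (intro arg_cong[where f = "\<lambda>x. x\<^sup>2"] sum.cong refl) (simp add: less_imp_neq[THEN not_sym])
  also have "\<dots> \<le> (\<Sum>i\<in>{1..n}. (\<bar>pmf p i - h i\<bar> / sqrt (w i))\<^sup>2) * (\<Sum>i\<in>{1..n}. (sqrt (w i))\<^sup>2)"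
    by (rule Cauchy_Schwarz_ineq_sum)
  also have "\<dots> = chisq n p h * 2"
  proof -
    have "(\<Sum>i\<in>{1..n}. (sqrt (w i))\<^sup>2) = (\<Sum>i\<in>{1..n}. w i)"
      using w by (intro sum.cong refl) (simp add: less_imp_le)
    also have "\<dots> = 2" using h(2) n by (simp add: w_def sum.distrib)
    finally show ?thesis using w by (simp add: chisq_def power_divide less_imp_le w_def[symmetric])
  qed
  also have "\<dots> \<le> (2 * \<epsilon>)\<^sup>2" using \<epsilon>(2) by (simp add: power_mult_distrib)
  finally have "(\<Sum>i\<in>{1..n}. \<bar>pmf p i - h i\<bar>) \<le> 2 * \<epsilon>"
    by (rule power2_le_imp_le) (use \<epsilon> in auto)
  thus ?thesis by simp
qed

lemma hypothesis_histogram: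
  assumes n: "1 \<le> n" and ys: "set ys \<subseteq> {1..n}" "ys \<noteq> []"
    and \<epsilon>: "0 \<le> \<epsilon>" "chisq n p (hyp ok n ys) \<le> 2 * \<epsilon>\<^sup>2"
  shows "\<exists>H\<in>histograms n (card (leaders ok n)). tv_dist n p H \<le> \<epsilon>"
proof -
  \<comment> \<open>\<open>lead\<close> continues beyond \<open>n\<close>, where \<open>hyp\<close>
    need not vanish; cutting it off yields a distribution on \<open>{1..n}\<close>.\<close>
  define f where "f i = (if i \<in> {1..n} then hyp ok n ys i else 0)" for i
  have f0: "0 \<le> f i" for i by (simp add: f_def hyp_nonneg)
  have "(\<integral>\<^sup>+ i. ennreal (f i) \<partial>count_space UNIV) = (\<Sum>i\<in>{1..n}. ennreal (f i))"
    by (rule nn_integral_count_space') (auto simp: f_def)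
  also have "\<dots> = ennreal (\<Sum>i\<in>{1..n}. f i)" using f0 by (intro sum_ennreal) auto
  also have "(\<Sum>i\<in>{1..n}. f i) = 1" using sum_hyp[OF ys, of ok] by (simp add: f_def)
  finally have "(\<integral>\<^sup>+ i. ennreal (f i) \<partial>count_space UNIV) = 1" by simp
  hence H: "pmf (embed_pmf f) i = f i" for i using f0 by (intro pmf_embed_pmf) auto
  have "embed_pmf f \<in> histograms n (card (leaders ok n))"
    unfolding histograms_def
  proof (intro CollectI conjI exI[of _ "bin ok n ` {1..n}"] ballI)
    show "set_pmf (embed_pmf f) \<subseteq> {1..n}" by (auto simp: set_pmf_iff H f_def split: if_splits)
    show "partition_on {1..n} (bin ok n ` {1..n})" by (rule partition_bins)
    show "card (bin ok n ` {1..n}) = card (leaders ok n)" by (rule card_bins)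
    fix I assume "I \<in> bin ok n ` {1..n}"
    then obtain i where i: "i \<in> {1..n}" "I = bin ok n i" by blast
    show "\<exists>a b. I = {a..b}" using i by (metis bin_interval)
    have "pmf (embed_pmf f) j = hyp ok n ys i" if "j \<in> I" for j
    proof -
      have "bin ok n j = bin ok n i" "j \<in> {1..n}" using that i by (auto simp: bin_def)
      thus ?thesis by (simp add: H f_def hyp_def)
    qed
    thus "pmf (embed_pmf f) constant_on I" by (auto simp: constant_on_def)
  qed
  moreover have "tv_dist n p (embed_pmf f) \<le> \<epsilon>"
    using tv_le_chisq[OF n hyp_nonneg sum_hyp[OF ys] \<epsilon>] by (simp add: tv_dist_def H f_def)
  ultimately show ?thesis by blast
qed

subsection \<open>Behaviour on histograms\<close>

text \<open>The probabilistic input from the first stage is collected in this event; the bounds on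
  the number of intervals and on the chi-square distance are deterministic consequences.\<close>

definition typical :: "nat \<Rightarrow> nat pmf \<Rightarrow> nat \<Rightarrow> nat list \<Rightarrow> bool" where
  "typical n p R ys \<longleftrightarrow> (\<forall>a b. 1 \<le> a \<and> a \<le> b \<and> b \<le> n \<longrightarrow>
     (let \<nu> = real (length ys) * measure_pmf.prob p {a..b}
      in (real (hits ys a b) - \<nu>)\<^sup>2 \<le> 4 * real R * (\<nu> + real R)))"

lemma prob_constant:
  assumes "\<And>i. i \<in> {c..d} \<Longrightarrow> pmf p i = x"
  shows "measure_pmf.prob p {c..d} = real (d + 1 - c) * x"
  using assms by (simp add: measure_measure_pmf_finite)

lemma sq_diff_le: "((x::real) - y)\<^sup>2 \<le> 2 * x\<^sup>2 + 2 * y\<^sup>2"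
  using zero_le_power2[of "x + y"] by (simp add: power2_eq_square algebra_simps)

text \<open>Where \<open>p\<close> is constant, expected counts scale with length, so the count of
  \<open>{c..d}\<close> and its share \<open>Y\<close> of the count of \<open>{a..b}\<close> both
  approximate the same \<open>\<nu>'\<close>.\<close>

lemma typical_looks_flat:
  assumes G: "typical n p R ys" and const: "\<And>i. i \<in> {a..b} \<Longrightarrow> pmf p i = x" and ab: "1 \<le> a" "a \<le> b" "b \<le> n"
  shows "looks_flat R ys a b"
  unfolding looks_flat_def
proof (intro allI impI)
  fix c d assume cd: "a \<le> c \<and> c \<le> d \<and> d \<le> b"
  define r where "r = real R"
  define N where "N = real (length ys)"
  define \<rho> where "\<rho> = real (d + 1 - c) / real (b + 1 - a)"
  define \<nu> where "\<nu> = N * measure_pmf.prob p {a..b}"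
  define \<nu>' where "\<nu>' = N * measure_pmf.prob p {c..d}"
  define X where "X = real (hits ys a b)"
  define X' where "X' = real (hits ys c d)"
  define Y where "Y = \<rho> * X"
  have \<rho>: "0 \<le> \<rho>" "\<rho> \<le> 1" using cd by (auto simp: \<rho>_def field_simps)
  have \<nu>\<rho>: "\<nu>' = \<rho> * \<nu>"
  proof -
    have "measure_pmf.prob p {a..b} = real (b + 1 - a) * x" by (rule prob_constant) (rule const)
    moreover have "measure_pmf.prob p {c..d} = real (d + 1 - c) * x"
      by (rule prob_constant) (use const cd in auto)
    ultimately show ?thesis using ab by (simp add: \<nu>_def \<nu>'_def \<rho>_def)
  qed
  have r: "0 \<le> r" by (simp add: r_def)
  have \<nu>0: "0 \<le> \<nu>" "0 \<le> \<nu>'" "0 \<le> X" "0 \<le> Y" using \<rho> by (auto simp: \<nu>_def \<nu>'_def N_def X_def Y_def)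
  have 1: "(X - \<nu>)\<^sup>2 \<le> 4 * r * (\<nu> + r)"
    using G ab by (auto simp: typical_def Let_def X_def \<nu>_def r_def N_def)
  have 2: "(X' - \<nu>')\<^sup>2 \<le> 4 * r * (\<nu>' + r)"
    using G ab cd by (auto simp: typical_def Let_def X'_def \<nu>'_def r_def N_def)
  have 3: "(Y - \<nu>')\<^sup>2 \<le> 4 * r * (\<nu>' + r)"
  proof -
    have "(Y - \<nu>')\<^sup>2 = \<rho> * (\<rho> * (X - \<nu>)\<^sup>2)" by (simp add: Y_def \<nu>\<rho> power2_eq_square algebra_simps)
    also have "\<dots> \<le> \<rho> * (1 * (4 * r * (\<nu> + r)))"
      using 1 \<rho> by (intro mult_left_mono mult_mono) auto
    also have "\<dots> = 4 * r * (\<nu>' + \<rho> * r)" by (simp add: \<nu>\<rho> algebra_simps)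
    also have "\<dots> \<le> 4 * r * (\<nu>' + r)"
      using mult_right_mono[OF \<rho>(2) r] r by (intro mult_left_mono add_left_mono) auto
    finally show ?thesis .
  qed
  \<comment> \<open>The algorithm sees \<open>Y\<close> and not \<open>\<nu>'\<close>, so the
    tolerance must be expressed by \<open>Y\<close>. With the constant 5, the contradiction with
    \<open>3\<close> becomes a negative square \<open>(\<nu>' - 3 * r)\<^sup>2\<close>.\<close>
  have 4: "\<nu>' \<le> 2 * Y + 5 * r"
  proof (rule ccontr)
    assume "\<not> \<nu>' \<le> 2 * Y + 5 * r"
    hence "(\<nu>' + 5 * r) / 2 < \<nu>' - Y" by simp
    hence "((\<nu>' + 5 * r) / 2)\<^sup>2 < (\<nu>' - Y)\<^sup>2" using \<nu>0 r by (intro power_strict_mono) auto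
    also have "\<dots> = (Y - \<nu>')\<^sup>2" by (rule power2_commute)
    also note 3
    finally have "(\<nu>' - 3 * r)\<^sup>2 < 0" by (simp add: power2_eq_square field_simps)
    thus False by (simp add: not_less[symmetric])
  qed
  have "(X' - Y)\<^sup>2 = ((X' - \<nu>') - (Y - \<nu>'))\<^sup>2" by simp
  also have "\<dots> \<le> 2 * (X' - \<nu>')\<^sup>2 + 2 * (Y - \<nu>')\<^sup>2" by (rule sq_diff_le)
  also have "\<dots> \<le> 16 * (r * (\<nu>' + r))" using 2 3 by linarith
  also have "\<dots> \<le> 16 * (r * (2 * Y + 5 * r + r))"
    using 4 r by (intro mult_left_mono) auto
  also have "\<dots> \<le> 96 * r * (Y + r)" using r \<nu>0 by (simp add: algebra_simps)
  finally show "cell_ok R ys a b c d"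
    by (simp add: cell_ok_def X'_def X_def Y_def \<rho>_def r_def Let_def mult.commute del: of_nat_diff)
qed

text \<open>Two greedy intervals cannot start in the same true piece: the first of them would have been extended
  to the start of the second.\<close>

lemma card_leaders_le:
  assumes G: "typical n p R ys" and Q: "partition_on {1..n} Q"
    and I: "\<And>I. I \<in> Q \<Longrightarrow> (\<exists>a b. I = {a..b}) \<and> pmf p constant_on I"
  defines "ok \<equiv> looks_flat R ys"
  shows "card (leaders ok n) \<le> card Q"
proof -
  have fin: "finite Q" using Q finite_elements by blast
  have "\<exists>T. T \<in> Q \<and> i \<in> T" if "i \<in> {1..n}" for i using that partition_onD1[OF Q] by blast
  then obtain T where T: "\<And>i. i \<in> {1..n} \<Longrightarrow> T i \<in> Q \<and> i \<in> T i" by metis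
  have no: False if i: "i \<in> leaders ok n" and j: "j \<in> leaders ok n" and ij: "i < j" and eq: "T i = T j" for i j
  proof -
    have i1: "i \<in> {1..n}" "lead ok i = i" and j1: "j \<in> {1..n}" "lead ok j = j"
      using i j by (auto simp: leaders_def)
    obtain u v where uv: "T j = {u..v}" using I[of "T j"] T[OF j1(1)] by auto
    have "pmf p constant_on {u..v}" using I[of "T j"] T[OF j1(1)] uv by simp
    then obtain x where x: "\<And>k. k \<in> {u..v} \<Longrightarrow> pmf p k = x" by (auto simp: constant_on_def)
    \<comment> \<open>The interval open just before \<open>j\<close> need not start at
      \<open>i\<close>, but its left end lies between \<open>i\<close> and \<open>j\<close>, hence
      in the same piece.\<close>
    define l where "l = lead ok (j - 1)"
    have l: "i \<le> l" "l \<le> j - 1" using lead_mono[of i "j - 1" ok] lead_le[of ok "j - 1"] i1 ij by (auto simp: l_def)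
    have "{l..j} \<subseteq> {u..v}" using l T[OF i1(1)] T[OF j1(1)] eq uv by auto
    hence "ok l j" unfolding ok_def
      using x l i1 j1 ij by (intro typical_looks_flat[OF G, where x = x]) auto
    moreover have "Suc (j - 1) = j" "0 < l" using ij l i1 by auto
    ultimately have "lead ok j = l" using lead.simps(2)[of ok "j - 1"] by (simp add: l_def)
    thus False using j1 l ij by auto
  qed
  have "inj_on T (leaders ok n)"
    by (rule inj_onI) (metis no linorder_neqE_nat)
  moreover have "T ` leaders ok n \<subseteq> Q" using T by (auto simp: leaders_def)
  ultimately show ?thesis using fin by (metis card_image card_mono)
qed

lemma hits_sum: "(\<Sum>j\<in>{a..b}. hits ys j j) = hits ys a b"
proof (induction ys)
  case (Cons y ys)
  have "(\<Sum>j\<in>{a..b}. hits (y # ys) j j) = (\<Sum>j\<in>{a..b}. (if j = y then 1 else 0) + hits ys j j)"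
    by (intro sum.cong refl) (auto simp: hits_Cons)
  thus ?case using Cons by (simp add: sum.distrib hits_Cons)
qed (simp add: hits_def)

text \<open>Covers greedy intervals of one element, which are opened without a check.\<close>

lemma looks_flat_refl: "looks_flat R ys a a"
  unfolding looks_flat_def
proof (intro allI impI)
  fix c d assume "a \<le> c \<and> c \<le> d \<and> d \<le> a"
  hence "c = a" "d = a" by auto
  thus "cell_ok R ys a a c d" by (simp add: cell_ok_def)
qed

text \<open>Typicality ties the count \<open>X'\<close> of the cell to its expectation \<nu>, and
  the greedy check ties it to the share \<open>Y\<close> that the flattened hypothesis assigns. So
  \<nu> and \<open>Y\<close> are close even if the greedy interval straddles several true
  pieces.\<close>

lemma cell_chisq:
  assumes G: "typical n p R ys" and N: "length ys = M * R" "1 \<le> M" "1 \<le> R" and n: "1 \<le> n"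
    and i: "i \<in> {1..n}" and cd: "c \<le> d" "{c..d} \<subseteq> bin (looks_flat R ys) n i" and const: "\<And>j. j \<in> {c..d} \<Longrightarrow> pmf p j = x"
  defines "h \<equiv> hyp (looks_flat R ys) n ys"
  shows "(\<Sum>j\<in>{c..d}. (pmf p j - h j)\<^sup>2 / (h j + 1 / real n)) \<le> 464 * (1 / real M + real n / (real M)\<^sup>2)"
proof -
  let ?ok = "looks_flat R ys"
  define a where "a = lead ?ok i"
  obtain e where e: "a \<le> i" "i \<le> e" "e \<le> n" "lead ?ok e = a" "bin ?ok n i = {a..e}"
    using bin_interval[OF i, of ?ok] unfolding a_def by metis
  have a1: "1 \<le> a" using i lead_pos[of i ?ok] by (simp add: a_def)
  have sub: "a \<le> c" "d \<le> e" using cd e(5) by auto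
  have "?ok a e"
  proof (cases "a = e")
    case False
    thus ?thesis using lead_ok[of ?ok e] e by simp
  qed (simp add: looks_flat_refl)
  hence cell: "cell_ok R ys a e c d" using sub cd by (simp add: looks_flat_def)
  define r where "r = real R"
  define m where "m = real M"
  define l where "l = real (d + 1 - c)"
  define L where "L = real (e + 1 - a)"
  define X where "X = real (hits ys a e)"
  define X' where "X' = real (hits ys c d)"
  define Y where "Y = X * l / L"
  define \<nu> where "\<nu> = m * r * (l * x)"
  have len: "real (length ys) = m * r" using N by (simp add: m_def r_def)
  have pos: "1 \<le> r" "1 \<le> m" "1 \<le> l" "1 \<le> L" "0 \<le> Y" "0 < m * r"
    using N cd e(1,2) by (auto simp: r_def m_def l_def L_def Y_def X_def)
  have x0: "0 \<le> x" using const[of c] cd by auto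
  have \<nu>0: "0 \<le> \<nu>" using pos x0 by (simp add: \<nu>_def)
  have pr: "real (length ys) * measure_pmf.prob p {c..d} = \<nu>"
    using prob_constant[of c d p x] const by (simp add: \<nu>_def l_def len)
  have 1: "(X' - \<nu>)\<^sup>2 \<le> 4 * r * (\<nu> + r)"
    using G sub a1 cd e(3) unfolding typical_def Let_def r_def X'_def pr[symmetric] by auto
  have 2: "(X' - Y)\<^sup>2 \<le> 96 * r * (Y + r)"
    using cell by (simp add: cell_ok_def Let_def X'_def X_def Y_def l_def L_def r_def del: of_nat_diff)
  \<comment> \<open>The two estimates give \<open>200 * (r * (Y + r)) + 8 * (r * t)\<close> for
    \<open>t\<^sup>2\<close>. The last term is at most
    \<open>t\<^sup>2 / 2 + 32 * r\<^sup>2\<close>; absorbing the half square doubles the rest, and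
    \<open>464 = 400 + 64\<close>.\<close>
  have 3: "(\<nu> - Y)\<^sup>2 \<le> 464 * (r * (Y + r))"
  proof -
    define t where "t = \<bar>\<nu> - Y\<bar>"
    have "(\<nu> - Y)\<^sup>2 = ((X' - Y) - (X' - \<nu>))\<^sup>2" by simp
    also have "\<dots> \<le> 2 * (X' - Y)\<^sup>2 + 2 * (X' - \<nu>)\<^sup>2" by (rule sq_diff_le)
    also have "\<dots> \<le> 192 * (r * (Y + r)) + 8 * (r * (\<nu> + r))" using 1 2 by linarith
    also have "r * (\<nu> + r) \<le> r * (Y + t + r)" using pos by (intro mult_left_mono) (auto simp: t_def)
    finally have "t\<^sup>2 \<le> 200 * (r * (Y + r)) + 8 * (r * t)" by (simp add: t_def algebra_simps)
    moreover have "0 \<le> (t - 8 * r)\<^sup>2" by simp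
    ultimately have "t\<^sup>2 \<le> 400 * (r * (Y + r)) + 64 * (r * r)" by (simp add: power2_eq_square algebra_simps)
    moreover have "0 \<le> r * Y" using pos by simp
    ultimately show ?thesis by (simp add: t_def algebra_simps)
  qed
  have h: "h j = Y / (m * r * l)" if "j \<in> {c..d}" for j
  proof -
    have "j \<in> bin ?ok n i" using that cd by blast
    hence B: "bin ?ok n j = {a..e}" using e(5) by (auto simp: bin_def)
    show ?thesis unfolding h_def hyp_def B hits_sum len using pos e(1,2)
      by (simp add: Y_def X_def L_def del: of_nat_diff)
  qed
  have p: "pmf p j = \<nu> / (m * r * l)" if "j \<in> {c..d}" for j
    using const[OF that] pos by (simp add: \<nu>_def)
  have "(\<Sum>j\<in>{c..d}. (pmf p j - h j)\<^sup>2 / (h j + 1 / real n)) =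
    (\<Sum>j\<in>{c..d}. (\<nu> / (m * r * l) - Y / (m * r * l))\<^sup>2 / (Y / (m * r * l) + 1 / real n))"
    by (intro sum.cong refl) (simp add: p h)
  also have "\<dots> = l * ((\<nu> / (m * r * l) - Y / (m * r * l))\<^sup>2 / (Y / (m * r * l) + 1 / real n))"
    using cd by (simp add: l_def)
  also have "\<dots> = (\<nu> - Y)\<^sup>2 / ((m * r)\<^sup>2 * (Y / (m * r) + l / real n))"
  proof -
    have "l * (((\<nu> - Y) / (q * l))\<^sup>2 / (Y / (q * l) + 1 / k)) = (\<nu> - Y)\<^sup>2 / (q\<^sup>2 * (Y / q + l / k))"
      if "0 < q" "0 < k" for q k :: real
    proof -
      have s: "0 < Y / (q * l) + 1 / k" using that pos by (intro add_nonneg_pos) auto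
      have "q\<^sup>2 * (Y / q + l / k) = q\<^sup>2 * l * (Y / (q * l) + 1 / k)" using that pos by (simp add: field_simps)
      thus ?thesis using s that pos by (auto simp: power2_eq_square divide_simps mult.commute)
    qed
    from this[of "m * r" "real n"] show ?thesis using pos n by (simp add: diff_divide_distrib)
  qed
  also have "\<dots> \<le> 464 * (1 / m + real n / m\<^sup>2)"
  proof -
    have s: "0 < (m * r)\<^sup>2 * (Y / (m * r) + l / real n)"
      using pos n by (intro mult_pos_pos add_nonneg_pos) auto
    have n': "0 < real n" using n by simp
    \<comment> \<open>In the expanded product, \<open>r * Y\<close> pairs \<open>1 / m\<close> with
      the hypothesis part of the denominator, and \<open>r * r * l\<close> pairs
      \<open>n / m\<^sup>2\<close> with the smoothing \<open>l / n\<close>.\<close>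
    have "464 * (r * (Y + r)) \<le> 464 * (r * Y + r * r * l + (m * r * l * r / real n + real n * Y * r / m))"
    proof -
      have "r * r * 1 \<le> r * r * l" using pos by (intro mult_left_mono) auto
      moreover have "0 \<le> m * r * l * r / real n" "0 \<le> real n * Y * r / m" using pos by auto
      ultimately show ?thesis unfolding distrib_left mult_1_right by linarith
    qed
    also have "\<dots> = 464 * (1 / m + real n / m\<^sup>2) * ((m * r)\<^sup>2 * (Y / (m * r) + l / real n))"
      using pos n' by (simp add: field_simps power2_eq_square)
    finally have "(\<nu> - Y)\<^sup>2 \<le> 464 * (1 / m + real n / m\<^sup>2) * ((m * r)\<^sup>2 * (Y / (m * r) + l / real n))"
      using 3 by simp
    thus ?thesis using s by (simp add: pos_divide_le_eq)
  qed
  finally show ?thesis by (simp add: m_def)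
qed

text \<open>The nonempty intersections of a true piece with a greedy interval are determined by their minima, each
  of which is the minimum of a true piece or of a greedy interval.\<close>

lemma chisq_small:
  assumes G: "typical n p R ys" and N: "length ys = M * R" "1 \<le> M" "1 \<le> R" and n: "1 \<le> n"
    and Q: "partition_on {1..n} Q"
    and I: "\<And>I. I \<in> Q \<Longrightarrow> (\<exists>a b. I = {a..b}) \<and> pmf p constant_on I"
  shows "chisq n p (hyp (looks_flat R ys) n ys) \<le> real (2 * card Q) * (464 * (1 / real M + real n / (real M)\<^sup>2))"
proof -
  let ?ok = "looks_flat R ys"
  let ?h = "hyp ?ok n ys"
  let ?f = "\<lambda>i. (pmf p i - ?h i)\<^sup>2 / (?h i + 1 / real n)"
  let ?\<kappa> = "464 * (1 / real M + real n / (real M)\<^sup>2)"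
  define P where "P = bin ?ok n ` {1..n}"
  define Z where "Z = {T \<inter> B |T B. T \<in> Q \<and> B \<in> P \<and> T \<inter> B \<noteq> {}}"
  define S where "S = Min ` Q \<union> Min ` P"
  have finQ: "finite Q" using Q finite_elements by blast
  have finP: "finite P" by (simp add: P_def)
  have finT: "finite T" if "T \<in> Q" for T using partition_onD1[OF Q] that by (metis Union_upper finite_atLeastAtMost finite_subset)
  have disjQ: "T = T'" if "T \<in> Q" "T' \<in> Q" "i \<in> T" "i \<in> T'" for T T' i
    using partition_onD2[OF Q] that by (auto simp: disjoint_def)
  have disjP: "B = B'" if "B \<in> P" "B' \<in> P" "i \<in> B" "i \<in> B'" for B B' i
    using that by (auto simp: P_def bin_def)
  have finZ: "finite Z"
    by (rule finite_subset[of _ "(\<lambda>(T, B). T \<inter> B) ` (Q \<times> P)"]) (use finQ finP in \<open>auto simp: Z_def\<close>)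
  have UZ: "\<Union>Z = {1..n}"
  proof (intro equalityI subsetI)
    fix i assume "i \<in> \<Union>Z" thus "i \<in> {1..n}" by (auto simp: Z_def P_def bin_def)
  next
    fix i assume i: "i \<in> {1..n}"
    then obtain T where "T \<in> Q" "i \<in> T" using partition_onD1[OF Q] by blast
    moreover have "bin ?ok n i \<in> P" "i \<in> bin ?ok n i" using i by (auto simp: P_def bin_def)
    ultimately show "i \<in> \<Union>Z" unfolding Z_def by blast
  qed
  have disjZ: "C = C'" if C: "C \<in> Z" "C' \<in> Z" "i \<in> C" "i \<in> C'" for C C' i
  proof -
    obtain T B T' B' where "T \<in> Q" "B \<in> P" "C = T \<inter> B" "T' \<in> Q" "B' \<in> P" "C' = T' \<inter> B'"
      using C(1,2) by (auto simp: Z_def)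
    thus ?thesis using C(3,4) disjQ disjP by (metis IntD1 IntD2)
  qed
  have cellZ: "\<exists>c d. C = {c..d} \<and> c \<le> d \<and> c \<in> S \<and> sum ?f C \<le> ?\<kappa>" if "C \<in> Z" for C
  proof -
    obtain T B where TB: "T \<in> Q" "B \<in> P" "C = T \<inter> B" "C \<noteq> {}" using \<open>C \<in> Z\<close> by (auto simp: Z_def)
    obtain u v where uv: "T = {u..v}" using I[OF TB(1)] by auto
    obtain x where x: "\<And>j. j \<in> T \<Longrightarrow> pmf p j = x" using I[OF TB(1)] by (auto simp: constant_on_def)
    obtain i where i: "i \<in> {1..n}" "B = bin ?ok n i" using TB(2) unfolding P_def by blast
    obtain e where e: "B = {lead ?ok i..e}" using bin_interval[OF i(1), of ?ok] i(2) by metis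
    define c where "c = max u (lead ?ok i)"
    define d where "d = min v e"
    have C: "C = {c..d}" using TB uv e by (auto simp: c_def d_def)
    hence cd: "c \<le> d" using TB(4) by auto
    have "u = Min T" "lead ?ok i = Min B"
      using cd by (auto simp: uv e c_def d_def intro!: Min_eqI[symmetric])
    hence "c \<in> S" using TB by (auto simp: S_def c_def max_def)
    moreover have "sum ?f C \<le> ?\<kappa>" unfolding C
    proof (rule cell_chisq[OF G N n i(1) cd, where x = x])
      show "{c..d} \<subseteq> bin ?ok n i" using C TB(3) i(2) by blast
      show "pmf p j = x" if "j \<in> {c..d}" for j using that x C TB(3) by blast
    qed
    ultimately show ?thesis using C cd by blast
  qed
  have Min_in_Z: "Min C \<in> C" if C: "C \<in> Z" for C
  proof -
    obtain c d where "C = {c..d}" "c \<le> d" using cellZ[OF C] by blast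
    thus ?thesis by (intro Min_in) auto
  qed
  have "inj_on Min Z"
  proof (rule inj_onI)
    fix C C' assume C: "C \<in> Z" "C' \<in> Z" "Min C = Min C'"
    thus "C = C'" using disjZ[OF C(1,2)] Min_in_Z[OF C(1)] Min_in_Z[OF C(2)] by metis
  qed
  moreover have "Min ` Z \<subseteq> S"
  proof
    fix s assume "s \<in> Min ` Z"
    then obtain C where C: "C \<in> Z" "s = Min C" by blast
    obtain c d where "C = {c..d}" "c \<le> d" "c \<in> S" using cellZ[OF C(1)] by blast
    moreover from this have "Min C = c" by (auto intro!: Min_eqI)
    ultimately show "s \<in> S" using C by simp
  qed
  ultimately have "card Z \<le> card S" using finQ finP by (metis S_def card_image card_mono finite_UnI finite_imageI)
  also have "card S \<le> card Q + card P"
    unfolding S_def by (rule order.trans[OF card_Un_le]) (intro add_mono card_image_le finQ finP)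
  also have "card P \<le> card Q"
    unfolding P_def card_bins by (rule card_leaders_le[OF G Q I])
  finally have cardZ: "card Z \<le> 2 * card Q" by simp
  have "chisq n p ?h = sum ?f (\<Union>Z)" by (simp add: chisq_def UZ)
  also have "\<dots> = (\<Sum>C\<in>Z. sum ?f C)"
    by (subst sum.Union_disjoint) (use cellZ disjZ in fastforce)+
  also have "\<dots> \<le> (\<Sum>C\<in>Z. ?\<kappa>)" using cellZ by (intro sum_mono) blast
  also have "\<dots> = real (card Z) * ?\<kappa>" by simp
  also have "\<dots> \<le> real (2 * card Q) * ?\<kappa>"
    using cardZ by (intro mult_right_mono) (auto simp del: of_nat_mult)
  finally show ?thesis .
qed

section \<open>Failure probability of one level\<close>

lemma E_of_bool: "E p (\<lambda>x. of_bool (P x)) = measure_pmf.prob p {x. P x}"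
proof -
  have "(\<lambda>x. of_bool (P x)) = (indicator {x. P x} :: _ \<Rightarrow> real)" by (auto simp: indicator_def)
  thus ?thesis by simp
qed

lemma typical_likely:
  assumes fin: "finite (set_pmf p)" and R: "1 \<le> R"
  shows "measure_pmf.prob (replicate_pmf N p) {ys. \<not> typical n p R ys} \<le> (real n)\<^sup>2 * (2 / 2 ^ R)"
proof -
  let ?P = "measure_pmf.prob (replicate_pmf N p)"
  define \<nu> where "\<nu> = (\<lambda>(a, b). real N * measure_pmf.prob p {a..b})"
  define A where "A ab = {ys. (real (hits ys (fst ab) (snd ab)) - \<nu> ab)\<^sup>2 > 4 * real R * (\<nu> ab + real R)}" for ab
  have "?P {ys. \<not> typical n p R ys} = ?P ({ys. \<not> typical n p R ys} \<inter> set_pmf (replicate_pmf N p))"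
    by (rule measure_Int_set_pmf[symmetric])
  also have "\<dots> \<le> ?P (\<Union>ab\<in>{1..n} \<times> {1..n}. A ab)"
  proof (intro measure_pmf.finite_measure_mono subsetI)
    fix ys assume ys: "ys \<in> {ys. \<not> typical n p R ys} \<inter> set_pmf (replicate_pmf N p)"
    hence "length ys = N" by (auto simp: set_replicate_pmf)
    with ys obtain a b where "1 \<le> a" "a \<le> b" "b \<le> n" "ys \<in> A (a, b)"
      by (auto simp: typical_def A_def \<nu>_def Let_def not_le)
    moreover from this have "(a, b) \<in> {1..n} \<times> {1..n}" by auto
    ultimately show "ys \<in> (\<Union>ab\<in>{1..n} \<times> {1..n}. A ab)" by blast
  qed simp
  also have "\<dots> \<le> (\<Sum>ab\<in>{1..n} \<times> {1..n}. ?P (A ab))"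
    by (rule measure_pmf.finite_measure_subadditive_finite) auto
  also have "\<dots> \<le> (\<Sum>ab\<in>{1..n} \<times> {1..n}. 2 / 2 ^ R)"
    by (intro sum_mono) (auto simp: A_def \<nu>_def intro: hits_concentration[OF fin R])
  also have "\<dots> = (real n)\<^sup>2 * (2 / 2 ^ R)" by (simp add: power2_eq_square)
  finally show ?thesis .
qed

text \<open>The second clause is applied in contrapositive form: a rejected guess is below every
  \<open>k\<close> for which \<open>p\<close> is a \<open>k\<close>-histogram.\<close>

definition sound_level :: "nat \<Rightarrow> nat pmf \<Rightarrow> real \<Rightarrow> nat \<Rightarrow> nat \<Rightarrow> nat \<Rightarrow> nat list \<Rightarrow> bool" where
  "sound_level n p \<epsilon> b M R xs \<longleftrightarrow>
     (accepts n b M R \<epsilon> xs \<longrightarrow>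
        (\<exists>H\<in>histograms n (card (leaders (looks_flat R (take (M * R) xs)) n)). tv_dist n p H \<le> \<epsilon>)) \<and>
     (\<forall>k\<le>b. p \<in> histograms n k \<longrightarrow> accepts n b M R \<epsilon> xs)"

text \<open>In both cases a wrong verdict of a single round is an instance of \<open>zoff\<close>,
  so the majority is right as soon as fewer than half of the rounds are off.\<close>

lemma sound_levelI:
  assumes n: "1 \<le> n" and \<epsilon>: "0 < \<epsilon>" and M: "1 \<le> M" "big_enough n b \<epsilon> M" and R: "1 \<le> R"
    and ys: "length ys = M * R" "set ys \<subseteq> {1..n}" and ty: "typical n p R ys"
  defines "h \<equiv> hyp (looks_flat R ys) n ys"
  assumes v: "2 * votes (zoff n p \<epsilon> M h) M R zs < R"
  shows "sound_level n p \<epsilon> b M R (ys @ zs)"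
proof -
  let ?ok = "looks_flat R ys"
  have acc: "accepts n b M R \<epsilon> (ys @ zs) \<longleftrightarrow> card (leaders ?ok n) \<le> b \<and> R < 2 * votes (zsmall n M \<epsilon> h) M R zs"
    by (simp add: accepts_def Let_def ys(1) h_def)
  have M2: "0 < (real M)\<^sup>2" using M by simp
  have "1 \<le> M * R" using M(1) R by simp
  hence ysne: "ys \<noteq> []" using ys(1) by auto
  have sound: "chisq n p h \<le> 2 * \<epsilon>\<^sup>2" if "accepts n b M R \<epsilon> (ys @ zs)"
  proof (rule ccontr)
    assume *: "\<not> chisq n p h \<le> 2 * \<epsilon>\<^sup>2"
    have "zoff n p \<epsilon> M h us vs" if z: "zsmall n M \<epsilon> h us vs" for us vs
    proof -
      have "\<epsilon>\<^sup>2 \<le> chisq n p h" using * zero_le_power2[of \<epsilon>] by linarith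
      hence mx: "max (chisq n p h) (\<epsilon>\<^sup>2) = chisq n p h" by simp
      have "(real M)\<^sup>2 * (2 * \<epsilon>\<^sup>2) \<le> (real M)\<^sup>2 * chisq n p h" using * by (intro mult_left_mono) auto
      moreover have "2 * zstat n M h us vs \<le> 3 * ((real M)\<^sup>2 * \<epsilon>\<^sup>2)"
        using z by (simp add: zsmall_def power_mult_distrib)
      ultimately show ?thesis unfolding zoff_def mx by linarith
    qed
    hence "votes (zsmall n M \<epsilon> h) M R zs \<le> votes (zoff n p \<epsilon> M h) M R zs" by (rule votes_mono)
    thus False using v that acc by linarith
  qed
  have complete: "accepts n b M R \<epsilon> (ys @ zs)" if k: "k \<le> b" "p \<in> histograms n k" for k
  proof -
    obtain Q where Q: "partition_on {1..n} Q" "card Q = k"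
      "\<And>I. I \<in> Q \<Longrightarrow> (\<exists>a b. I = {a..b}) \<and> pmf p constant_on I"
      using k(2) by (auto simp: histograms_def)
    have "chisq n p h \<le> real (2 * card Q) * (464 * (1 / real M + real n / (real M)\<^sup>2))"
      unfolding h_def by (rule chisq_small[OF ty ys(1) M(1) R n Q(1,3)])
    also have "\<dots> \<le> real (2 * b) * (464 * (1 / real M + real n / (real M)\<^sup>2))"
      using Q(2) k(1) by (intro mult_right_mono) (auto simp del: of_nat_mult)
    also have "\<dots> = 928 * (real b / real M + real n * real b / (real M)\<^sup>2)" by (simp add: algebra_simps)
    also have "\<dots> \<le> 928 * (\<epsilon>\<^sup>2 / 2048 + \<epsilon>\<^sup>2 / 2048)"
    proof (intro mult_left_mono add_mono)
      show "real b / real M \<le> \<epsilon>\<^sup>2 / 2048" using M by (simp add: big_enough_def field_simps)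
      show "real n * real b / (real M)\<^sup>2 \<le> \<epsilon>\<^sup>2 / 2048"
        using M M2 by (simp add: big_enough_def power_mult_distrib pos_divide_le_eq mult_ac)
    qed simp
    also have "\<dots> \<le> \<epsilon>\<^sup>2" by simp
    finally have chi: "chisq n p h \<le> \<epsilon>\<^sup>2" .
    have "zoff n p \<epsilon> M h us vs" if z: "\<not> zsmall n M \<epsilon> h us vs" for us vs
    proof -
      have mx: "max (chisq n p h) (\<epsilon>\<^sup>2) = \<epsilon>\<^sup>2" using chi by simp
      have "(real M)\<^sup>2 * chisq n p h \<le> (real M)\<^sup>2 * \<epsilon>\<^sup>2" using chi by (intro mult_left_mono) auto
      moreover have "3 * ((real M)\<^sup>2 * \<epsilon>\<^sup>2) < 2 * zstat n M h us vs"
        using z by (simp add: zsmall_def power_mult_distrib)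
      moreover have "0 \<le> (real M)\<^sup>2 * \<epsilon>\<^sup>2" by simp
      ultimately show ?thesis unfolding zoff_def mx by linarith
    qed
    hence "votes (\<lambda>us vs. \<not> zsmall n M \<epsilon> h us vs) M R zs \<le> votes (zoff n p \<epsilon> M h) M R zs" by (rule votes_mono)
    moreover have "card (leaders ?ok n) \<le> b" using card_leaders_le[OF ty Q(1,3)] Q(2) k(1) by simp
    ultimately show ?thesis
      using v votes_compl[of "zsmall n M \<epsilon> h" M R zs] unfolding acc by linarith
  qed
  show ?thesis unfolding sound_level_def
    using hypothesis_histogram[OF n ys(2) ysne _ sound[unfolded h_def]] \<epsilon> complete ys(1) by auto
qed

text \<open>Integrating over the second stage first keeps \<open>ys\<close> fixed, so the hypothesis
  is a constant there and \<open>zoff_rare\<close> and \<open>majority\<close> apply to the fresh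
  samples.\<close>

lemma level_failure:
  assumes p: "set_pmf p \<subseteq> {1..n}" and n: "1 \<le> n" and \<epsilon>: "0 < \<epsilon>" "\<epsilon> \<le> 1" and \<delta>: "0 < \<delta>" "\<delta> \<le> 1" and b: "1 \<le> b"
  defines "M \<equiv> batch n b \<epsilon>" and "R \<equiv> reps n \<delta>"
  shows "measure_pmf.prob (replicate_pmf (draws_at n \<epsilon> \<delta> b) p) {xs. \<not> sound_level n p \<epsilon> b M R xs} \<le> \<delta> / real n"
proof -
  have fin: "finite (set_pmf p)" using p finite_subset by blast
  have M: "1 \<le> M" "big_enough n b \<epsilon> M"
    using batch_pos[of n b \<epsilon>] batch_big_enough[OF \<epsilon> n b] by (auto simp: M_def)
  have R: "1 \<le> R" "4 * real n ^ 3 / \<delta> \<le> 2 ^ R" using reps_pos[OF n \<delta>] by (auto simp: R_def)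
  have M2: "2048 * sqrt (real n) \<le> real M * \<epsilon>\<^sup>2"
  proof -
    have "(2048 * sqrt (real n))\<^sup>2 \<le> (real M * \<epsilon>\<^sup>2)\<^sup>2" using M(2) by (simp add: big_enough_def power_mult_distrib)
    thus ?thesis by (rule power2_le_imp_le) simp
  qed
  define h where "h ys = hyp (looks_flat R ys) n ys" for ys
  let ?Q = "replicate_pmf (M * R) p" and ?S = "replicate_pmf (R * (M + M)) p"
  have D: "draws_at n \<epsilon> \<delta> b = M * R + R * (M + M)" by (simp add: draws_at_def M_def R_def algebra_simps)
  have "measure_pmf.prob (replicate_pmf (draws_at n \<epsilon> \<delta> b) p) {xs. \<not> sound_level n p \<epsilon> b M R xs} =
    E ?Q (\<lambda>ys. E ?S (\<lambda>zs. of_bool (\<not> sound_level n p \<epsilon> b M R (ys @ zs))))"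
    by (simp only: D E_of_bool[symmetric] E_replicate_add[OF fin])
  also have "\<dots> \<le> E ?Q (\<lambda>ys. of_bool (\<not> typical n p R ys) + 1 / 2 ^ R)"
  proof (rule E_mono)
    fix ys assume "ys \<in> set_pmf ?Q"
    hence ys: "length ys = M * R" "set ys \<subseteq> {1..n}" using p by (auto simp: set_replicate_pmf)
    have "E ?S (\<lambda>zs. of_bool (\<not> sound_level n p \<epsilon> b M R (ys @ zs))) \<le>
       E ?S (\<lambda>zs. of_bool (\<not> typical n p R ys) + of_bool (R \<le> 2 * votes (zoff n p \<epsilon> M (h ys)) M R zs))"
      using sound_levelI[OF n \<epsilon>(1) M R(1) ys, of p, folded h_def] fin
      by (intro E_mono) (auto simp: not_le[symmetric])
    also have "\<dots> = of_bool (\<not> typical n p R ys) + measure_pmf.prob ?S {zs. R \<le> 2 * votes (zoff n p \<epsilon> M (h ys)) M R zs}"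
      using fin by (simp add: E_add E_of_bool del: of_bool_eq_iff)
    also have "measure_pmf.prob ?S {zs. R \<le> 2 * votes (zoff n p \<epsilon> M (h ys)) M R zs} \<le> 1 / 2 ^ R"
      by (intro majority fin zoff_rare p n \<epsilon> M2) (simp add: h_def hyp_nonneg)
    finally show "E ?S (\<lambda>zs. of_bool (\<not> sound_level n p \<epsilon> b M R (ys @ zs))) \<le> of_bool (\<not> typical n p R ys) + 1 / 2 ^ R"
      by simp
  qed (use fin in auto)
  also have "\<dots> = measure_pmf.prob ?Q {ys. \<not> typical n p R ys} + 1 / 2 ^ R"
    using fin by (simp add: E_add E_of_bool)
  also have "\<dots> \<le> (real n)\<^sup>2 * (2 / 2 ^ R) + 1 / 2 ^ R"
    using typical_likely[OF fin R(1)] by simp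
  also have "\<dots> \<le> 4 * (real n)\<^sup>2 / 2 ^ R"
  proof -
    have "1 \<le> (real n)\<^sup>2" using n by simp
    hence "(real n)\<^sup>2 * 2 + 1 \<le> 4 * (real n)\<^sup>2" by linarith
    hence "((real n)\<^sup>2 * 2 + 1) / 2 ^ R \<le> 4 * (real n)\<^sup>2 / 2 ^ R" by (rule divide_right_mono) simp
    thus ?thesis by (simp add: add_divide_distrib)
  qed
  also have "\<dots> \<le> \<delta> / real n"
    using R(2) \<delta> n by (simp add: field_simps power2_eq_square power3_eq_cube)
  finally show ?thesis .
qed

section \<open>The minimal number of bins, and binds of subprobabilities\<close>

lemma histograms_full: "set_pmf p \<subseteq> {1..n} \<Longrightarrow> p \<in> histograms n n"
  unfolding histograms_def
proof (intro CollectI conjI exI[of _ "(\<lambda>i. {i}) ` {1..n}"] ballI)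
  show "partition_on {1..n} ((\<lambda>i. {i}) ` {1..n})" by (rule partition_onI) (auto simp: disjnt_def)
  show "card ((\<lambda>i. {i}) ` {1..n}) = n" by (subst card_image) auto
  fix I assume "I \<in> (\<lambda>i. {i}) ` {1..n}"
  then obtain i where "I = {i}" by blast
  hence "I = {i..i}" by simp
  thus "\<exists>a b. I = {a..b}" by blast
  show "pmf p constant_on I" using \<open>I = {i}\<close> by (simp add: constant_on_def)
qed

lemma histograms_pos: "1 \<le> n \<Longrightarrow> p \<in> histograms n k \<Longrightarrow> 1 \<le> k"
proof (rule ccontr)
  assume n: "1 \<le> n" and "p \<in> histograms n k" "\<not> 1 \<le> k"
  then obtain Q where Q: "partition_on {1..n} Q" "card Q = 0" by (auto simp: histograms_def)
  hence "Q = {}" using finite_elements by fastforce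
  thus False using partition_onD1[OF Q(1)] n by auto
qed

lemma min_bins_histogram:
  assumes "1 \<le> n" "set_pmf p \<subseteq> {1..n}"
  shows "p \<in> histograms n (min_bins n p)" "1 \<le> min_bins n p"
proof -
  show *: "p \<in> histograms n (min_bins n p)"
    unfolding min_bins_def by (rule LeastI[of _ n]) (rule histograms_full[OF assms(2)])
  show "1 \<le> min_bins n p" by (rule histograms_pos[OF assms(1) *])
qed

lemma measure_spmf_bind_pmf_eq:
  "measure (measure_spmf (bind_pmf q g)) A = E q (\<lambda>x. measure (measure_spmf (g x)) A)"
  unfolding measure_measure_spmf_conv_measure_pmf measure_pmf_bind
  by (subst measure_pmf.measure_bind[where N = "count_space UNIV"])
     (auto simp: measure_pmf_in_subprob_algebra)

lemma measure_return_spmf_mem: "x \<in> A \<Longrightarrow> measure (measure_spmf (return_spmf x)) A = 1"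
  by (simp add: measure_measure_spmf_conv_measure_pmf)

lemma set_spmf_bind_pmf: "set_spmf (bind_pmf q g) = (\<Union>x\<in>set_pmf q. set_spmf (g x))"
  by (auto simp: set_spmf_def bind_UNION)

lemma lossless_bind_pmf: "(\<And>x. x \<in> set_pmf q \<Longrightarrow> lossless_spmf (g x)) \<Longrightarrow> lossless_spmf (bind_pmf q g)"
  by (auto simp: lossless_iff_set_pmf_None)

section \<open>Sample complexity\<close>

text \<open>By minimality, half the batch violates one of the three conditions of
  \<open>big_enough\<close>, and each violation bounds it by one of the three summands. The constant
  is \<open>2 * 2048\<close>.\<close>

lemma batch_le:
  assumes \<epsilon>: "0 < \<epsilon>" "\<epsilon> \<le> 1" and n: "1 \<le> n" and b: "1 \<le> b"
  shows "real (batch n b \<epsilon>) \<le> 4096 * (sqrt (real n) / \<epsilon>\<^sup>2 + real b / \<epsilon>\<^sup>2 + sqrt (real b * real n) / \<epsilon>)"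
proof -
  define J where "J = (LEAST j. big_enough n b \<epsilon> (2 ^ j))"
  have M: "batch n b \<epsilon> = 2 ^ J" by (simp add: J_def batch_def)
  \<comment> \<open>Size 1 never suffices, so the batch can be halved.\<close>
  have "\<not> big_enough n b \<epsilon> (2 ^ 0)"
  proof -
    have "\<epsilon>\<^sup>2 \<le> 1" using \<epsilon> by (simp add: power_le_one)
    thus ?thesis using b by (simp add: big_enough_def)
  qed
  moreover have "big_enough n b \<epsilon> (2 ^ J)" using batch_big_enough[OF assms] by (simp add: M)
  ultimately have "J \<noteq> 0" by metis
  then obtain j where j: "J = Suc j" using not0_implies_Suc by blast
  have "\<not> big_enough n b \<epsilon> (2 ^ j)" by (rule not_less_Least) (simp add: J_def[symmetric] j)
  moreover define m :: real where "m = 2 ^ j"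
  have e2: "0 < \<epsilon>\<^sup>2" using \<epsilon> by simp
  ultimately consider "m * \<epsilon>\<^sup>2 < 2048 * real b" | "(m * \<epsilon>)\<^sup>2 < 2048 * real n * real b" | "(m * \<epsilon>\<^sup>2)\<^sup>2 < 2048\<^sup>2 * real n"
    by (auto simp: big_enough_def m_def not_le)
  hence "m \<le> 2048 * (sqrt (real n) / \<epsilon>\<^sup>2 + real b / \<epsilon>\<^sup>2 + sqrt (real b * real n) / \<epsilon>)"
  proof cases
    case 1
    hence "m \<le> 2048 * (real b / \<epsilon>\<^sup>2)" using e2 by (simp add: field_simps)
    moreover have "0 \<le> sqrt (real n) / \<epsilon>\<^sup>2" "0 \<le> sqrt (real b * real n) / \<epsilon>" using \<epsilon> by auto
    ultimately show ?thesis unfolding distrib_left by linarith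
  next
    case 2
    have "(m * \<epsilon>)\<^sup>2 \<le> (2048 * sqrt (real b * real n))\<^sup>2"
    proof -
      have "0 \<le> real b * real n" by simp
      moreover have "(2048 * sqrt (real b * real n))\<^sup>2 = 4194304 * (real b * real n)"
        by (simp add: power_mult_distrib)
      moreover have "2048 * real n * real b = 2048 * (real b * real n)" by simp
      ultimately show ?thesis using 2 by linarith
    qed
    hence "m * \<epsilon> \<le> 2048 * sqrt (real b * real n)" by (rule power2_le_imp_le) simp
    hence "m \<le> 2048 * (sqrt (real b * real n) / \<epsilon>)" using \<epsilon> by (simp add: field_simps)
    moreover have "0 \<le> sqrt (real n) / \<epsilon>\<^sup>2" "0 \<le> real b / \<epsilon>\<^sup>2" by auto
    ultimately show ?thesis unfolding distrib_left by linarith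
  next
    case 3
    have "(m * \<epsilon>\<^sup>2)\<^sup>2 \<le> (2048 * sqrt (real n))\<^sup>2"
      using 3 by (simp add: power_mult_distrib)
    hence "m * \<epsilon>\<^sup>2 \<le> 2048 * sqrt (real n)" by (rule power2_le_imp_le) simp
    hence "m \<le> 2048 * (sqrt (real n) / \<epsilon>\<^sup>2)" using e2 by (simp add: field_simps)
    moreover have "0 \<le> real b / \<epsilon>\<^sup>2" "0 \<le> sqrt (real b * real n) / \<epsilon>" using \<epsilon> by auto
    ultimately show ?thesis unfolding distrib_left by linarith
  qed
  thus ?thesis by (simp add: M j m_def)
qed

text \<open>Minimality gives \<open>2 ^ (R - 1) \<le> 4 * n ^ 3 / \<delta>\<close>. Taking
  logarithms with \<open>ln 2 \<ge> 1 / 2\<close> doubles the coefficients 3 and 1; the constant 3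
  consists of 2 for the factor 4 and 1 for the last doubling.\<close>

lemma reps_le:
  assumes n: "1 \<le> n" and \<delta>: "0 < \<delta>" "\<delta> \<le> 1"
  shows "real (reps n \<delta>) \<le> 3 + 6 * ln (real n) + 2 * ln (1 / \<delta>)"
proof -
  define J where "J = reps n \<delta>"
  have "J \<noteq> 0" using reps_pos(1)[OF assms] by (simp add: J_def)
  then obtain j where j: "J = Suc j" using not0_implies_Suc by blast
  have "\<not> 4 * real n ^ 3 / \<delta> \<le> 2 ^ j"
    using j unfolding J_def reps_def by (intro not_less_Least) simp
  hence "2 ^ j \<le> 4 * real n ^ 3 / \<delta>" by simp
  hence "ln (2 ^ j) \<le> ln (4 * real n ^ 3 / \<delta>)" by (subst ln_le_cancel_iff) (use n \<delta> in auto)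
  also have "\<dots> = ln (2 ^ 2) + ln (real n ^ 3) + ln (1 / \<delta>)"
    using n \<delta> by (simp add: ln_mult ln_div)
  also have "\<dots> = 2 * ln 2 + 3 * ln (real n) + ln (1 / \<delta>)"
    using n by (subst (1 2) ln_realpow) auto
  finally have "real j * ln 2 \<le> 2 * ln 2 + 3 * ln (real n) + ln (1 / \<delta>)" by (simp add: ln_realpow)
  hence *: "(real j - 2) * ln 2 \<le> 3 * ln (real n) + ln (1 / \<delta>)" by (simp add: algebra_simps)
  have ln2: "1 / 2 \<le> ln (2::real)" using ln2_ge_two_thirds by linarith
  have nn: "0 \<le> ln (real n)" "0 \<le> ln (1 / \<delta>)" using n \<delta> by auto
  have "real j - 2 \<le> 6 * ln (real n) + 2 * ln (1 / \<delta>)"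
  proof (cases "real j \<le> 2")
    case True
    thus ?thesis using nn by linarith
  next
    case False
    hence "(real j - 2) * (1 / 2) \<le> (real j - 2) * ln 2" using ln2 by (intro mult_left_mono) auto
    hence "(real j - 2) * (1 / 2) \<le> 3 * ln (real n) + ln (1 / \<delta>)" using * by (rule order.trans)
    thus ?thesis by simp
  qed
  thus ?thesis using j by (simp add: J_def)
qed

text \<open>Bounds the samples of one level whose guess is at most \<open>2 * k\<close>:
  \<open>24576 = 3 * 2 * 4096\<close>, with 3 for the three blocks of samples and 2 for
  \<open>b \<le> 2 * k\<close>.\<close>

definition budget :: "nat \<Rightarrow> nat \<Rightarrow> real \<Rightarrow> real \<Rightarrow> real" where
  "budget n k \<epsilon> \<delta> = 24576 * (sqrt (real n) / \<epsilon>\<^sup>2 + real k / \<epsilon>\<^sup>2 + sqrt (real k * real n) / \<epsilon>) *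
     (3 + 6 * ln (real n) + 2 * ln (1 / \<delta>))"

lemma draws_at_le:
  assumes \<epsilon>: "0 < \<epsilon>" "\<epsilon> \<le> 1" and n: "1 \<le> n" and b: "1 \<le> b" "b \<le> 2 * k" and \<delta>: "0 < \<delta>" "\<delta> \<le> 1"
  shows "real (draws_at n \<epsilon> \<delta> b) \<le> budget n k \<epsilon> \<delta>"
proof -
  have "real (draws_at n \<epsilon> \<delta> b) = 3 * (real (batch n b \<epsilon>) * real (reps n \<delta>))" by (simp add: draws_at_def)
  also have "\<dots> \<le> 3 * ((8192 * (sqrt (real n) / \<epsilon>\<^sup>2 + real k / \<epsilon>\<^sup>2 + sqrt (real k * real n) / \<epsilon>)) *
     (3 + 6 * ln (real n) + 2 * ln (1 / \<delta>)))"
  proof (intro mult_left_mono mult_mono reps_le[OF n \<delta>])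
    have 1: "real b / \<epsilon>\<^sup>2 \<le> 2 * (real k / \<epsilon>\<^sup>2)" using b \<epsilon> by (simp add: divide_right_mono)
    have "sqrt (real b * real n) \<le> sqrt (2\<^sup>2 * (real k * real n))"
    proof (intro real_sqrt_le_mono)
      have "real b * real n \<le> (2 * real k) * real n" using b by (intro mult_right_mono) auto
      also have "\<dots> \<le> 2\<^sup>2 * (real k * real n)" by (simp add: mult.assoc)
      finally show "real b * real n \<le> 2\<^sup>2 * (real k * real n)" .
    qed
    also have "\<dots> = 2 * sqrt (real k * real n)" by (simp only: real_sqrt_mult real_sqrt_abs)
    finally have 2: "sqrt (real b * real n) / \<epsilon> \<le> 2 * (sqrt (real k * real n) / \<epsilon>)"
      using \<epsilon> by (simp add: divide_right_mono)
    have "0 \<le> sqrt (real n) / \<epsilon>\<^sup>2" by simp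
    thus "real (batch n b \<epsilon>) \<le> 8192 * (sqrt (real n) / \<epsilon>\<^sup>2 + real k / \<epsilon>\<^sup>2 + sqrt (real k * real n) / \<epsilon>)"
      using batch_le[OF \<epsilon> n b(1)] 1 2 unfolding distrib_left by linarith
  qed (use \<epsilon> in auto)
  also have "\<dots> = budget n k \<epsilon> \<delta>" by (simp add: budget_def)
  finally show ?thesis .
qed

text \<open>The rate \<open>x\<close> is at least \<open>sqrt n\<close> and \<open>k\<close>, so
  \<open>ln n \<le> 2 * ln x\<close> and \<open>ln k \<le> ln x\<close>. The number of levels and
  the term \<open>ln n\<close> in the number of repetitions each cost one factor
  \<open>ln x\<close>, hence the exponent 2. The constants are \<open>17 = 3 + 12 + 2\<close> and
  \<open>4 * 24576 * 17 = 1671168\<close>.\<close>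

lemma budget_soft:
  assumes \<epsilon>: "0 < \<epsilon>" "\<epsilon> \<le> 1" and n: "1 \<le> n" and k: "1 \<le> k" and \<delta>: "0 < \<delta>" "\<delta> \<le> 1"
  shows "(2 + log 2 (real k)) * budget n k \<epsilon> \<delta> \<le> soft_bound 2000000 2 (sample_rate n k \<epsilon> \<delta>)"
    and "0 \<le> budget n k \<epsilon> \<delta>"
proof -
  define S where "S = sqrt (real n) / \<epsilon>\<^sup>2 + real k / \<epsilon>\<^sup>2 + sqrt (real k * real n) / \<epsilon>"
  define L where "L = max 1 (ln (1 / \<delta>))"
  define x where "x = sample_rate n k \<epsilon> \<delta>"
  define l where "l = ln x"
  have x: "x = S * L" by (simp add: x_def sample_rate_def S_def L_def)
  have e2: "0 < \<epsilon>\<^sup>2" "\<epsilon>\<^sup>2 \<le> 1" using \<epsilon> by (auto simp: power_le_one)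
  have nn: "1 \<le> sqrt (real n)" "1 \<le> real k" "1 \<le> sqrt (real k * real n)"
    using n k by (auto intro: order.trans[OF _ mult_mono[of 1 _ 1]])
  have a: "sqrt (real n) \<le> sqrt (real n) / \<epsilon>\<^sup>2" "real k \<le> real k / \<epsilon>\<^sup>2" "sqrt (real k * real n) \<le> sqrt (real k * real n) / \<epsilon>"
    using e2 \<epsilon> nn by (auto simp: pos_le_divide_eq intro!: mult_left_le)
  have S: "3 \<le> S" "sqrt (real n) \<le> S" "real k \<le> S" unfolding S_def using a nn by linarith+
  have L: "1 \<le> L" "ln (1 / \<delta>) \<le> L" by (auto simp: L_def)
  have Sx: "S \<le> x" using mult_left_mono[OF L(1), of S] S by (simp add: x)
  have l1: "1 \<le> l"
  proof -
    have "exp 1 \<le> x" using exp_le S(1) Sx by linarith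
    thus ?thesis unfolding l_def using S(1) Sx by (subst ln_ge_iff) auto
  qed
  have ln_k: "ln (real k) \<le> l" unfolding l_def using S Sx k by (subst ln_le_cancel_iff) auto
  have "ln (sqrt (real n)) \<le> l" unfolding l_def using S Sx n by (subst ln_le_cancel_iff) auto
  hence ln_n: "ln (real n) \<le> 2 * l" using n by (simp add: ln_sqrt)
  have nnl: "0 \<le> ln (real n)" "0 \<le> ln (1 / \<delta>)" "0 \<le> ln (real k)" using n k \<delta> by auto
  have "log 2 (real k) \<le> 2 * l"
  proof -
    have "ln (real k) \<le> (2 * l) * (1 / 2)" using ln_k by simp
    also have "\<dots> \<le> (2 * l) * ln 2" using l1 ln2_ge_two_thirds by (intro mult_left_mono) auto
    finally show ?thesis by (simp add: log_def pos_divide_le_eq)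
  qed
  hence f1: "2 + log 2 (real k) \<le> 4 * l" using l1 by linarith
  have lL: "l \<le> L * l" "L \<le> L * l" using L l1 by (auto simp: mult_le_cancel_right1 mult_le_cancel_left1)
  have f2: "3 + 6 * ln (real n) + 2 * ln (1 / \<delta>) \<le> 17 * (L * l)"
    using ln_n L(2) lL l1 by linarith
  have B: "budget n k \<epsilon> \<delta> = 24576 * S * (3 + 6 * ln (real n) + 2 * ln (1 / \<delta>))"
    by (simp add: budget_def S_def)
  show B0: "0 \<le> budget n k \<epsilon> \<delta>" unfolding B using S nnl by simp
  have "budget n k \<epsilon> \<delta> \<le> 24576 * S * (17 * (L * l))"
    unfolding B using f2 S by (intro mult_left_mono) auto
  hence "(2 + log 2 (real k)) * budget n k \<epsilon> \<delta> \<le> (4 * l) * (24576 * S * (17 * (L * l)))"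
    using f1 B0 l1 by (intro mult_mono) auto
  also have "\<dots> = 1671168 * (x * l\<^sup>2)" by (simp add: x power2_eq_square)
  also have "\<dots> \<le> 2000000 * (x * l\<^sup>2)" using Sx S by (intro mult_right_mono) auto
  finally show "(2 + log 2 (real k)) * budget n k \<epsilon> \<delta> \<le> soft_bound 2000000 2 (sample_rate n k \<epsilon> \<delta>)"
    by (simp add: soft_bound_def x_def l_def)
qed

section \<open>Doubling search\<close>

definition at_level :: "nat \<Rightarrow> real \<Rightarrow> real \<Rightarrow> nat \<Rightarrow> nat \<Rightarrow> state \<Rightarrow> bool" where
  "at_level n \<epsilon> \<delta> b K s \<longleftrightarrow> nmem s ''n'' 0 = n \<and> rmem s ''eps'' 0 = \<epsilon> \<and> rmem s ''delta'' 0 = \<delta> \<and>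
     nmem s ''b'' 0 = b \<and> nmem s ''K'' 0 = K"

lemma exec_search_stop:
  assumes "at_level n \<epsilon> \<delta> b K s" "n \<le> b"
  shows "exec p search_com s = return_spmf (tick s)"
  using assms by (simp add: search_com_def at_level_def loop_spmf.simps[of _ _ _ s])

lemma exec_search_step:
  assumes s: "at_level n \<epsilon> \<delta> b K s" "b < n"
    and pos: "0 < \<epsilon>" "\<epsilon> \<le> 1" "1 \<le> b" "0 < \<delta>" "\<delta> \<le> 1"
  defines "M \<equiv> batch n b \<epsilon>" and "R \<equiv> reps n \<delta>" and "D \<equiv> draws_at n \<epsilon> \<delta> b"
  shows "\<exists>f. exec p search_com s = bind_pmf (replicate_pmf D p) (\<lambda>xs. exec p search_com (f xs)) \<and>
    (\<forall>xs. length xs = D \<longrightarrow> draws (f xs) = draws s + D \<and> steps (f xs) \<le> steps s + 6501 * D ^ 6 \<and>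
      (accepts n b M R \<epsilon> xs \<longrightarrow>
         at_level n \<epsilon> \<delta> n (card (leaders (looks_flat R (take (M * R) xs)) n)) (f xs)) \<and>
      (\<not> accepts n b M R \<epsilon> xs \<longrightarrow> at_level n \<epsilon> \<delta> (b + b) K (f xs)))"
proof -
  have n: "1 \<le> n" using s(2) by simp
  have "\<exists>f. exec p level_com (tick s) = bind_pmf (replicate_pmf D p) (\<lambda>xs. return_spmf (f xs)) \<and>
    (\<forall>xs. length xs = D \<longrightarrow>
       nmem (f xs) ''n'' 0 = n \<and> rmem (f xs) ''eps'' 0 = \<epsilon> \<and> rmem (f xs) ''delta'' 0 = \<delta> \<and>
       draws (f xs) = draws (tick s) + D \<and> steps (f xs) \<le> steps (tick s) + 6500 * D ^ 6 \<and>
       (if accepts n b M R \<epsilon> xs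
        then nmem (f xs) ''b'' 0 = n \<and> nmem (f xs) ''K'' 0 = card (leaders (looks_flat R (take (M * R) xs)) n)
        else nmem (f xs) ''b'' 0 = b + b \<and> nmem (f xs) ''K'' 0 = K))"
    unfolding M_def R_def D_def
    by (rule exec_level_com) (use s pos n in \<open>auto simp: at_level_def\<close>)
  then obtain f where f: "exec p level_com (tick s) = bind_pmf (replicate_pmf D p) (\<lambda>xs. return_spmf (f xs))"
    "\<And>xs. length xs = D \<Longrightarrow>
       nmem (f xs) ''n'' 0 = n \<and> rmem (f xs) ''eps'' 0 = \<epsilon> \<and> rmem (f xs) ''delta'' 0 = \<delta> \<and>
       draws (f xs) = draws s + D \<and> steps (f xs) \<le> steps s + 1 + 6500 * D ^ 6 \<and>
       (if accepts n b M R \<epsilon> xs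
        then nmem (f xs) ''b'' 0 = n \<and> nmem (f xs) ''K'' 0 = card (leaders (looks_flat R (take (M * R) xs)) n)
        else nmem (f xs) ''b'' 0 = b + b \<and> nmem (f xs) ''K'' 0 = K)"
    by auto
  have "exec p search_com = loop_spmf (bval (NLess (NV ''b'') (NV ''n''))) tick (exec p level_com)"
    by (rule ext) (simp add: search_com_def)
  hence "exec p search_com s = bind_spmf (exec p level_com (tick s)) (exec p search_com)"
    using s by (simp add: at_level_def loop_spmf.simps[of _ _ _ s])
  hence 1: "exec p search_com s = bind_pmf (replicate_pmf D p) (\<lambda>xs. exec p search_com (f xs))"
    by (simp add: f(1) bind_spmf_def bind_assoc_pmf bind_return_pmf)
  have "1 \<le> D" using batch_pos[of n b \<epsilon>] reps_pos[OF n pos(4,5)] by (simp add: D_def draws_at_def)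
  \<comment> \<open>This pays for the loop test and turns 6500 into 6501.\<close>
  hence D: "1 \<le> D ^ 6" by simp
  have "steps (f xs) \<le> steps s + 6501 * D ^ 6" if "length xs = D" for xs
    using f(2)[OF that] D by linarith
  thus ?thesis
    using 1 f(2) by (intro exI[of _ f] conjI allI impI) (auto simp: at_level_def)
qed

text \<open>Lets the step bounds of the levels add up to a bound in the total number of
  samples.\<close>

lemma power6_superadditive: "(a::nat) ^ 6 + b ^ 6 \<le> (a + b) ^ 6"
proof -
  have "a ^ 6 + b ^ 6 = a * a ^ 5 + b * b ^ 5" by (simp add: eval_nat_numeral)
  also have "\<dots> \<le> a * (a + b) ^ 5 + b * (a + b) ^ 5"
    by (intro add_mono mult_left_mono power_mono) auto
  also have "\<dots> = (a + b) ^ 6" by (simp add: eval_nat_numeral algebra_simps)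
  finally show ?thesis .
qed

text \<open>Independent of what the tests answer: the guess doubles or jumps to \<open>n\<close>, so
  \<open>n - b\<close> decreases, and \<open>K\<close> is either kept or set to a number of greedy
  intervals.\<close>

lemma search_sure:
  assumes pos: "0 < \<epsilon>" "\<epsilon> \<le> 1" "0 < \<delta>" "\<delta> \<le> 1" "1 \<le> n"
    and "at_level n \<epsilon> \<delta> b K s" "1 \<le> b" "1 \<le> K" "K \<le> n" "steps s \<le> c + 6501 * draws s ^ 6"
  shows "lossless_spmf (exec p search_com s) \<and> (\<forall>t\<in>set_spmf (exec p search_com s).
     1 \<le> out_bins t \<and> out_bins t \<le> n \<and> steps t \<le> c + 1 + 6501 * draws t ^ 6)"
  using assms(6-)
proof (induction "n - b" arbitrary: b K s rule: less_induct)
  case less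
  show ?case
  proof (cases "b < n")
    case False
    hence "exec p search_com s = return_spmf (tick s)" using exec_search_stop[OF less.prems(1)] by simp
    thus ?thesis using less.prems by (simp add: out_bins_def at_level_def)
  next
    case True
    define D where "D = draws_at n \<epsilon> \<delta> b"
    define M where "M = batch n b \<epsilon>"
    define R where "R = reps n \<delta>"
    obtain f where f1: "exec p search_com s = bind_pmf (replicate_pmf D p) (\<lambda>xs. exec p search_com (f xs))"
      and f2: "\<forall>xs. length xs = D \<longrightarrow> draws (f xs) = draws s + D \<and> steps (f xs) \<le> steps s + 6501 * D ^ 6 \<and>
      (accepts n b M R \<epsilon> xs \<longrightarrow>
         at_level n \<epsilon> \<delta> n (card (leaders (looks_flat R (take (M * R) xs)) n)) (f xs)) \<and>
      (\<not> accepts n b M R \<epsilon> xs \<longrightarrow> at_level n \<epsilon> \<delta> (b + b) K (f xs))"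
      using exec_search_step[OF less.prems(1) True pos(1,2) less.prems(2) pos(3,4), of p,
        folded D_def M_def R_def] by blast
    have step: "lossless_spmf (exec p search_com (f xs)) \<and> (\<forall>t\<in>set_spmf (exec p search_com (f xs)).
      1 \<le> out_bins t \<and> out_bins t \<le> n \<and> steps t \<le> c + 1 + 6501 * draws t ^ 6)"
      if xs: "length xs = D" for xs
    proof -
      have "steps (f xs) \<le> c + 6501 * (draws s ^ 6 + D ^ 6)"
        using f2[rule_format, OF xs] less.prems(5) by (simp add: algebra_simps)
      also have "\<dots> \<le> c + 6501 * (draws s + D) ^ 6"
        by (intro add_left_mono mult_left_mono power6_superadditive) auto
      finally have st: "steps (f xs) \<le> c + 6501 * draws (f xs) ^ 6" using f2[rule_format, OF xs] by simp
      show ?thesis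
      proof (cases "accepts n b M R \<epsilon> xs")
        case acc: True
        show ?thesis
          by (rule less.hyps[OF _ _ pos(5) card_leaders_bounds[OF pos(5)] st]) (use True f2[rule_format, OF xs] acc in auto)
      next
        case False
        show ?thesis
          by (rule less.hyps[where b = "b + b", OF _ _ _ less.prems(3,4) st]) (use True less.prems f2[rule_format, OF xs] False in auto)
      qed
    qed
    show ?thesis unfolding f1
      using step by (auto simp: set_spmf_bind_pmf set_replicate_pmf intro!: lossless_bind_pmf)
  qed
qed

text \<open>\<open>2 + log 2 k\<close> bounds the number of levels, since the guesses are powers of
  2 below \<open>2 * k\<close>; \<open>B\<close> is the budget of one level.\<close>

definition good_output :: "nat \<Rightarrow> nat pmf \<Rightarrow> real \<Rightarrow> nat \<Rightarrow> real \<Rightarrow> state \<Rightarrow> bool" where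
  "good_output n p \<epsilon> k B t \<longleftrightarrow> real (draws t) \<le> (2 + log 2 (real k)) * B \<and> out_bins t \<le> 2 * k \<and>
     (\<exists>H\<in>histograms n (out_bins t). tv_dist n p H \<le> \<epsilon>)"

text \<open>Each level fails with probability at most \<open>\<delta> / n\<close>, and doubling the guess decreases \<open>n - b\<close> by at least 1.\<close>

lemma search_good:
  assumes p: "set_pmf p \<subseteq> {1..n}" and pos: "0 < \<epsilon>" "\<epsilon> \<le> 1" "0 < \<delta>" "\<delta> \<le> 1" "1 \<le> n"
    and k: "p \<in> histograms n k" "1 \<le> k"
    and B: "B = budget n k \<epsilon> \<delta>"
    and s: "at_level n \<epsilon> \<delta> b n s" "b = 2 ^ l" "b < 2 * k" "real (draws s) \<le> real l * B"
  shows "1 - real (n - b) * (\<delta> / real n) \<le> measure (measure_spmf (exec p search_com s)) {t. good_output n p \<epsilon> k B t}"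
  using s
proof (induction "n - b" arbitrary: b s l rule: less_induct)
  case less
  have fin: "finite (set_pmf p)" using p finite_subset by blast
  have B0: "0 \<le> B" unfolding B by (rule budget_soft(2)[OF pos(1,2,5) k(2) pos(3,4)])
  have "real l = log 2 (real b)" using less.prems(2) by (simp add: log_of_power_eq)
  also have "\<dots> \<le> log 2 (2 * real k)"
  proof -
    have "0 < real b" using less.prems(2) by simp
    moreover have "real b \<le> 2 * real k" using less.prems(3) by linarith
    ultimately show ?thesis by simp
  qed
  also have "\<dots> = 1 + log 2 (real k)" using k(2) by (simp add: log_mult)
  finally have l: "real l \<le> 1 + log 2 (real k)" .
  show ?case
  proof (cases "b < n")
    case False
    hence e: "exec p search_com s = return_spmf (tick s)" using exec_search_stop[OF less.prems(1)] by simp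
    have "real (draws s) \<le> (2 + log 2 (real k)) * B"
      using less.prems(4) mult_right_mono[OF l B0] B0 by (simp add: algebra_simps)
    \<comment> \<open>An exhausted search outputs \<open>n\<close>, for which \<open>p\<close>
      itself is the witness; \<open>n \<le> b < 2 * k\<close> bounds the output.\<close>
    moreover have "\<exists>H\<in>histograms n n. tv_dist n p H \<le> \<epsilon>"
      by (rule bexI[of _ p]) (use histograms_full[OF p] pos in \<open>auto simp: tv_dist_def\<close>)
    ultimately have "good_output n p \<epsilon> k B (tick s)"
      using less.prems False by (simp add: good_output_def out_bins_def at_level_def)
    thus ?thesis using False by (simp add: e measure_return_spmf_mem)
  next
    case True
    define D where "D = draws_at n \<epsilon> \<delta> b"
    define M where "M = batch n b \<epsilon>"
    define R where "R = reps n \<delta>"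
    define A where "A = {t. good_output n p \<epsilon> k B t}"
    define \<eta> where "\<eta> = \<delta> / real n"
    have \<eta>: "0 \<le> \<eta>" using pos by (simp add: \<eta>_def)
    have b1: "1 \<le> b" using less.prems(2) by simp
    obtain f where f1: "exec p search_com s = bind_pmf (replicate_pmf D p) (\<lambda>xs. exec p search_com (f xs))"
      and f2: "\<forall>xs. length xs = D \<longrightarrow> draws (f xs) = draws s + D \<and> steps (f xs) \<le> steps s + 6501 * D ^ 6 \<and>
      (accepts n b M R \<epsilon> xs \<longrightarrow>
         at_level n \<epsilon> \<delta> n (card (leaders (looks_flat R (take (M * R) xs)) n)) (f xs)) \<and>
      (\<not> accepts n b M R \<epsilon> xs \<longrightarrow> at_level n \<epsilon> \<delta> (b + b) n (f xs))"
      using exec_search_step[OF less.prems(1) True pos(1,2) b1 pos(3,4), of p,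
        folded D_def M_def R_def] by blast
    have D: "real D \<le> B"
      unfolding D_def B using less.prems(3) by (intro draws_at_le pos b1) simp
    have dr: "real (draws (f xs)) \<le> real (Suc l) * B" if "length xs = D" for xs
      using f2[rule_format, OF that] D less.prems(4) by (simp add: algebra_simps)
    have dr': "real (draws (f xs)) \<le> (2 + log 2 (real k)) * B" if "length xs = D" for xs
    proof -
      have "real (Suc l) * B \<le> (2 + log 2 (real k)) * B" using l B0 by (intro mult_right_mono) auto
      thus ?thesis using dr[OF that] by linarith
    qed
    have step: "1 - measure (measure_spmf (exec p search_com (f xs))) A \<le> real (n - b - 1) * \<eta>"
      if xs: "length xs = D" and sl: "sound_level n p \<epsilon> b M R xs" for xs
    proof (cases "accepts n b M R \<epsilon> xs")
      case acc: True
      let ?K = "card (leaders (looks_flat R (take (M * R) xs)) n)"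
      have e: "exec p search_com (f xs) = return_spmf (tick (f xs))"
        using f2[rule_format, OF xs] acc by (intro exec_search_stop) auto
      have "?K \<le> b" using acc by (simp add: accepts_def Let_def)
      hence "good_output n p \<epsilon> k B (tick (f xs))"
        using f2[rule_format, OF xs] less.prems(3) sl acc dr'[OF xs]
        by (auto simp: good_output_def out_bins_def at_level_def sound_level_def)
      thus ?thesis using \<eta> by (simp add: e A_def measure_return_spmf_mem)
    next
      case False
      have "b < k" using False sl k(1) by (auto simp: sound_level_def not_le[symmetric])
      moreover have "n - (b + b) < n - b" using True b1 by arith
      ultimately have "1 - real (n - (b + b)) * (\<delta> / real n) \<le> measure (measure_spmf (exec p search_com (f xs))) A"
        unfolding A_def using True b1 less.prems(2) dr[OF xs] f2[rule_format, OF xs] False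
        by (intro less.hyps[where b = "b + b" and l = "Suc l"]) auto
      moreover have "real (n - (b + b)) * \<eta> \<le> real (n - b - 1) * \<eta>"
        using b1 \<eta> by (intro mult_right_mono) auto
      ultimately show ?thesis by (simp add: \<eta>_def)
    qed
    have "1 - measure (measure_spmf (exec p search_com s)) A =
        E (replicate_pmf D p) (\<lambda>xs. 1 - measure (measure_spmf (exec p search_com (f xs))) A)"
      unfolding f1 measure_spmf_bind_pmf_eq using fin by (subst E_diff) auto
    also have "\<dots> \<le> E (replicate_pmf D p) (\<lambda>xs. real (n - b - 1) * \<eta> + of_bool (\<not> sound_level n p \<epsilon> b M R xs))"
    proof (rule E_mono)
      fix xs assume "xs \<in> set_pmf (replicate_pmf D p)"
      hence xs: "length xs = D" by (auto simp: set_replicate_pmf)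
      show "1 - measure (measure_spmf (exec p search_com (f xs))) A \<le>
        real (n - b - 1) * \<eta> + of_bool (\<not> sound_level n p \<epsilon> b M R xs)"
        using step[OF xs] \<eta> by (cases "sound_level n p \<epsilon> b M R xs") (auto simp: add_increasing)
    qed (use fin in auto)
    also have "\<dots> = real (n - b - 1) * \<eta> + measure_pmf.prob (replicate_pmf D p) {xs. \<not> sound_level n p \<epsilon> b M R xs}"
      using fin by (simp add: E_add E_of_bool)
    also have "\<dots> \<le> real (n - b - 1) * \<eta> + \<eta>"
      unfolding D_def M_def R_def \<eta>_def by (intro add_left_mono level_failure p pos b1)
    also have "\<dots> = real (n - b) * \<eta>" using True by (simp add: of_nat_diff algebra_simps)
    finally show ?thesis by (simp add: A_def \<eta>_def)
  qed
qed

theorem theoremC1: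
  "\<exists>(A :: com) (C :: real) (c :: nat) (q :: nat poly).
     \<forall>(n :: nat) (\<epsilon> :: real) (\<delta> :: real) (p :: nat pmf).
       1 \<le> n \<and> 0 < \<epsilon> \<and> \<epsilon> \<le> 1 \<and> 0 < \<delta> \<and> \<delta> \<le> 1 \<and> set_pmf p \<subseteq> {1..n} \<longrightarrow>
         lossless_spmf (run A p n \<epsilon> \<delta>) \<and>
         (\<forall>s \<in> set_spmf (run A p n \<epsilon> \<delta>).
            1 \<le> out_bins s \<and> out_bins s \<le> n \<and> steps s \<le> poly q (draws s)) \<and>
         measure (measure_spmf (run A p n \<epsilon> \<delta>))
           {s. real (draws s) \<le> soft_bound C c (sample_rate n (min_bins n p) \<epsilon> \<delta>) \<and>
               1 \<le> out_bins s \<and> out_bins s \<le> 2 * min_bins n p \<and>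
               (\<exists>H \<in> histograms n (out_bins s). tv_dist n p H \<le> \<epsilon>)} \<ge> 1 - \<delta>"
proof (rule exI[of _ histogram_com], rule exI[of _ 2000000], rule exI[of _ 2],
    rule exI[of _ "[:3:] + monom 6501 6"], intro allI impI)
  fix n :: nat and \<epsilon> \<delta> :: real and p :: "nat pmf"
  assume *: "1 \<le> n \<and> 0 < \<epsilon> \<and> \<epsilon> \<le> 1 \<and> 0 < \<delta> \<and> \<delta> \<le> 1 \<and> set_pmf p \<subseteq> {1..n}"
  hence pos: "0 < \<epsilon>" "\<epsilon> \<le> 1" "0 < \<delta>" "\<delta> \<le> 1" "1 \<le> n" and p: "set_pmf p \<subseteq> {1..n}" by auto
  define k where "k = min_bins n p"
  have k: "p \<in> histograms n k" "1 \<le> k" using min_bins_histogram[OF pos(5) p] by (auto simp: k_def)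
  define s where "s = effect (Seq (NSet ''K'' (NV ''n'')) (NSet ''b'' (Const 1))) (init_state n \<epsilon> \<delta>)"
  have s: "at_level n \<epsilon> \<delta> 1 n s" "draws s = 0" "steps s = 2"
    by (auto simp: s_def at_level_def init_state_def)
  have run: "run histogram_com p n \<epsilon> \<delta> = exec p search_com s"
    by (simp add: run_def histogram_com_def s_def)
  \<comment> \<open>The constant term 3 of the polynomial: two initial assignments and the last loop
    test.\<close>
  have sure: "lossless_spmf (exec p search_com s) \<and> (\<forall>t\<in>set_spmf (exec p search_com s).
     1 \<le> out_bins t \<and> out_bins t \<le> n \<and> steps t \<le> 2 + 1 + 6501 * draws t ^ 6)"
    by (rule search_sure[OF pos s(1)]) (use s pos in auto)
  define B where "B = budget n k \<epsilon> \<delta>"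
  let ?G = "{t. good_output n p \<epsilon> k B t}"
  let ?A = "{s. real (draws s) \<le> soft_bound 2000000 2 (sample_rate n k \<epsilon> \<delta>) \<and>
               1 \<le> out_bins s \<and> out_bins s \<le> 2 * k \<and> (\<exists>H \<in> histograms n (out_bins s). tv_dist n p H \<le> \<epsilon>)}"
  \<comment> \<open>The guess starts at 1, so at most \<open>n - 1\<close> failures of probability
    \<open>\<delta> / n\<close> are charged.\<close>
  have "real (n - 1) * (\<delta> / real n) \<le> \<delta>"
    using pos by (simp add: field_simps of_nat_diff)
  hence "1 - \<delta> \<le> 1 - real (n - 1) * (\<delta> / real n)" by simp
  also have "\<dots> \<le> measure (measure_spmf (exec p search_com s)) ?G"
    by (rule search_good[OF p pos k B_def s(1), where l = 0]) (use k s in auto)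
  also have "\<dots> \<le> measure (measure_spmf (exec p search_com s)) ?A"
  proof (intro measure_spmf.finite_measure_mono subsetI)
    fix t assume t: "t \<in> ?G"
    hence "1 \<le> out_bins t" using histograms_pos[OF pos(5)] by (auto simp: good_output_def)
    thus "t \<in> ?A" using t budget_soft(1)[OF pos(1,2,5) k(2) pos(3,4)]
      by (auto simp: good_output_def B_def)
  qed simp
  finally show "lossless_spmf (run histogram_com p n \<epsilon> \<delta>) \<and>
         (\<forall>s \<in> set_spmf (run histogram_com p n \<epsilon> \<delta>).
            1 \<le> out_bins s \<and> out_bins s \<le> n \<and> steps s \<le> poly ([:3:] + monom 6501 6) (draws s)) \<and>
         measure (measure_spmf (run histogram_com p n \<epsilon> \<delta>))
           {s. real (draws s) \<le> soft_bound 2000000 2 (sample_rate n (min_bins n p) \<epsilon> \<delta>) \<and>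
               1 \<le> out_bins s \<and> out_bins s \<le> 2 * min_bins n p \<and>
               (\<exists>H \<in> histograms n (out_bins s). tv_dist n p H \<le> \<epsilon>)} \<ge> 1 - \<delta>"
    using sure by (simp add: run k_def poly_monom)
qed

end
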